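(* A qc structure on a $(4n+3)$-dimensional manifold is integrable in the sense of Duchemin if and only if it is compatible with an integrable qc $K$-structure, i.e. the $Q$-structure defined by the qc distribution contains an integrable qc $K$-structure.
   Context: Fix $n\ge 1$. $T=\mathbb R^{4n+3}=V\oplus W$, $V=\mathbb R^{4n}$, $W=\mathbb R^3$; $e_1,\dots,e_{4n+3}$ standard basis, $e^a$ dual basis, $e^{ab}=e^a\wedge e^b$, $w_s=e_{4n+s}$, $w^s=e^{4n+s}$. Set $\omega_1=\sum_{j=1}^n(e^{4j-3,4j-2}-e^{4j-1,4j})$, $\omega_2=\sum_{j=1}^n(e^{4j-3,4j-1}+e^{4j-2,4j})$, $\omega_3=\sum_{j=1}^n(e^{4j-3,4j}-e^{4j-2,4j-1})$, and $\Theta_0=\sum_s\omega_s\otimes w_s\in\Lambda^2T^*\otimes T$. A qc structure is a rank $4n$ distribution $\mathcal D$ that can locally be written $\ker\eta_1\cap\ker\eta_2\cap\ker\eta_3$, with one-forms $\eta_s$ such that at each point there is a linear isomorphism $u\colon\mathbb R^{4n}\to\mathcal D_x$ with $d\eta_s(u(e_a),u(e_b))=\omega_s(e_a,e_b)$. It is integrable in the sense of Duchemin if near each point there are one-forms $\eta_1,\eta_2,\eta_3$ with $\mathcal D=\ker\eta_1\cap\ker\eta_2\cap\ker\eta_3$, admitting at each point $x$ a linear isomorphism $u\colon\mathbb R^{4n}\to\mathcal D_x$ with $d\eta_s(u(e_a),u(e_b))=\omega_s(e_a,e_b)$, and such that at each point there are vectors $R_1,R_2,R_3$ with $\eta_s(R_r)=\delta_{sr}$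 and $(R_s\lrcorner d\eta_r)|_{\mathcal D}+(R_r\lrcorner d\eta_s)|_{\mathcal D}=0$ for all $r,s$. For a Lie subgroup $G\subset\mathrm{GL}(T)$ with Lie algebra $\mathfrak g$, a $G$-structure is a reduction to $G$ of the bundle of frames $u\colon T\to T_xM$; $\partial_G\colon T^*\otimes\mathfrak g\to\Lambda^2T^*\otimes T$ is the restriction of $e^k\otimes(e^i\otimes e_j)\mapsto e^{ki}\otimes e_j$. The torsion of any connection, projected to $\mathrm{coker}\,\partial_G$, is the intrinsic torsion $\Theta^G$; $\Theta_0^G$ is the class of $\Theta_0$. $Q\subset\mathrm{GL}(T)$ is the stabilizer of $V$ (a rank $4n$ distribution is a $Q$-structure, $\mathcal D_x=u(V)$), and $B=\mathrm{Sp}(n)\mathbb H^*\ltimes\mathrm{Hom}(W,V)$ is the stabilizer in $Q$ of $\Theta_0^Q\in\mathrm{coker}\,\partial_Q=\Lambda^2V^*\otimes T/V$; identifying $\mathbb R^{4n}=\mathbb H^n$ via $1,i,j,k$ in each factor, $(g,p)\in\mathrm{Sp}(n)\times\mathbb H^*$ acts on $V$ by $v\mapsto gvp^{-1}$ and on $W$ as the dual of the action $q\mapsto pq\bar p$ on $\mathrm{Im}\,\mathbb H\cong W^*$. Identifying $V\cong V^*$ via the standard metric, $EH=\{\sum_s w^s\otimes(v\lrcorner\omega_s)\mid v\in V\}\subset\mathrm{Hom}(W,V)$; $K=\mathrm{Sp}(n)\mathbb H^*\ltimes EH$. An integrable qc $K$-structure is a $K$-structure $P$ such that the intrinsic torsion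 $\Theta^B$ of the $B$-structure $P\cdot B$ equals $\Theta_0^B$ at all points of $P$. *)

theory Defs
  imports "HOL-Analysis.Analysis"
begin

section \<open>Smooth manifolds\<close>

primrec Ck_on :: "nat \<Rightarrow> 'a::real_normed_vector set \<Rightarrow> ('a \<Rightarrow> 'b::real_normed_vector) \<Rightarrow> bool" where
  "Ck_on 0 S f \<longleftrightarrow> continuous_on S f"
| "Ck_on (Suc k) S f \<longleftrightarrow>
     (\<forall>x\<in>S. f differentiable (at x)) \<and> (\<forall>v. Ck_on k S (\<lambda>x. frechet_derivative f (at x) v))"

text \<open>Only meant for open sets.\<close>
definition smooth_on :: "'a::real_normed_vector set \<Rightarrow> ('a \<Rightarrow> 'b::real_normed_vector) \<Rightarrow> bool" where
  "smooth_on S f \<longleftrightarrow> (\<forall>k. Ck_on k S f)"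

text \<open>
  A manifold has as its points a whole type; being Hausdorff and second countable is a matter of
  the type classes of that type. Its smooth structure is given by an atlas, which need not be maximal.
\<close>
type_synonym ('m, 'e) chart = "'m set \<times> ('m \<Rightarrow> 'e)"

definition chart_inv :: "('m, 'e) chart \<Rightarrow> 'e \<Rightarrow> 'm" where
  "chart_inv c = inv_into (fst c) (snd c)"

definition smooth_atlas :: "('m::topological_space, 'e::euclidean_space) chart set \<Rightarrow> bool" where
  "smooth_atlas \<A> \<longleftrightarrow>
     (\<Union>c\<in>\<A>. fst c) = UNIV \<and>
     (\<forall>c\<in>\<A>. open (fst c) \<and> open (snd c ` fst c) \<and>
        homeomorphism (fst c) (snd c ` fst c) (snd c) (chart_inv c)) \<and>
     (\<forall>c\<in>\<A>. \<forall>c'\<in>\<A>. smooth_on (snd c ` (fst c \<inter> fst c')) (snd c' \<circ> chart_inv c))"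

text \<open>
  Every point \<open>x\<close> gets a preferred chart, and the tangent space at \<open>x\<close> is the model space \<open>'e\<close>,
  identified with the space of coordinate vectors in the preferred chart. So a vector field is a
  function \<open>'m \<Rightarrow> 'e\<close>, and a one-form a function \<open>'m \<Rightarrow> 'e \<Rightarrow> real\<close>. The preferred chart does not
  depend continuously on \<open>x\<close>, so smoothness is expressed after passing to the components in a
  fixed chart.
\<close>
definition chart_at :: "('m, 'e) chart set \<Rightarrow> 'm \<Rightarrow> ('m, 'e) chart" where
  "chart_at \<A> x = (SOME c. c \<in> \<A> \<and> x \<in> fst c)"

text \<open>Components in the chart \<open>c\<close> of a tangent vector at \<open>x\<close>, and the inverse isomorphism.\<close>
definition to_chart ::
  "('m, 'e::euclidean_space) chart set \<Rightarrow> ('m, 'e) chart \<Rightarrow> 'm \<Rightarrow> 'e \<Rightarrow> 'e" where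
  "to_chart \<A> c x =
     frechet_derivative (snd c \<circ> chart_inv (chart_at \<A> x)) (at (snd (chart_at \<A> x) x))"

definition from_chart ::
  "('m, 'e::euclidean_space) chart set \<Rightarrow> ('m, 'e) chart \<Rightarrow> 'm \<Rightarrow> 'e \<Rightarrow> 'e" where
  "from_chart \<A> c x =
     frechet_derivative (snd (chart_at \<A> x) \<circ> chart_inv c) (at (snd c x))"

definition smooth_vector_field ::
  "('m, 'e::euclidean_space) chart set \<Rightarrow> 'm set \<Rightarrow> ('m \<Rightarrow> 'e) \<Rightarrow> bool" where
  "smooth_vector_field \<A> U X \<longleftrightarrow>
     (\<forall>c\<in>\<A>. smooth_on (snd c ` (U \<inter> fst c))
        (\<lambda>y. to_chart \<A> c (chart_inv c y) (X (chart_inv c y))))"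

text \<open>The component at \<open>y\<close> along \<open>v\<close> of a one-form with values in \<open>'b\<close> in the chart \<open>c\<close>.\<close>
definition form_in_chart ::
  "('m, 'e::euclidean_space) chart set \<Rightarrow> ('m, 'e) chart \<Rightarrow> ('m \<Rightarrow> 'e \<Rightarrow> 'b) \<Rightarrow> 'e \<Rightarrow> 'e \<Rightarrow> 'b" where
  "form_in_chart \<A> c \<alpha> y v = \<alpha> (chart_inv c y) (from_chart \<A> c (chart_inv c y) v)"

definition smooth_one_form ::
  "('m, 'e::euclidean_space) chart set \<Rightarrow> 'm set \<Rightarrow> ('m \<Rightarrow> 'e \<Rightarrow> 'b::real_normed_vector) \<Rightarrow> bool" where
  "smooth_one_form \<A> U \<alpha> \<longleftrightarrow>
     (\<forall>x\<in>U. linear (\<alpha> x)) \<and>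
     (\<forall>c\<in>\<A>. \<forall>v. smooth_on (snd c ` (U \<inter> fst c)) (\<lambda>y. form_in_chart \<A> c \<alpha> y v))"

text \<open>\<open>f\<close> differentiated at \<open>x\<close> along the tangent vector \<open>X\<close>.\<close>
definition dir_deriv ::
  "('m, 'e::euclidean_space) chart set \<Rightarrow> ('m \<Rightarrow> 'b::real_normed_vector) \<Rightarrow> 'm \<Rightarrow> 'e \<Rightarrow> 'b" where
  "dir_deriv \<A> f x X =
     frechet_derivative (f \<circ> chart_inv (chart_at \<A> x)) (at (snd (chart_at \<A> x) x)) X"

text \<open>
  Exterior derivative of a one-form, without factor 1/2, computed in the preferred chart:
  \<open>d\<alpha>(X,Y) = X(\<alpha>(Y)) - Y(\<alpha>(X))\<close> for coordinate vector fields.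
\<close>
definition ext_deriv ::
  "('m, 'e::euclidean_space) chart set \<Rightarrow> ('m \<Rightarrow> 'e \<Rightarrow> 'b::real_normed_vector)
     \<Rightarrow> 'm \<Rightarrow> 'e \<Rightarrow> 'e \<Rightarrow> 'b" where
  "ext_deriv \<A> \<alpha> x X Y =
     (let c = chart_at \<A> x; p = snd c x in
        frechet_derivative (\<lambda>y. form_in_chart \<A> c \<alpha> y Y) (at p) X
      - frechet_derivative (\<lambda>y. form_in_chart \<A> c \<alpha> y X) (at p) Y)"

definition distribution ::
  "('m::topological_space, 'e::euclidean_space) chart set \<Rightarrow> nat \<Rightarrow> ('m \<Rightarrow> 'e set) \<Rightarrow> bool" where
  "distribution \<A> k D \<longleftrightarrow>
     (\<forall>x. subspace (D x) \<and> dim (D x) = k) \<and>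
     (\<forall>x. \<exists>U X. open U \<and> x \<in> U \<and> (\<forall>i<k. smooth_vector_field \<A> U (X i)) \<and>
        (\<forall>y\<in>U. D y = span ((\<lambda>i. X i y) ` {..<k})))"


section \<open>G-structures and intrinsic torsion\<close>

text \<open>
  A frame at \<open>x\<close> is a linear isomorphism \<open>u\<close> from the model space \<open>'e\<close> to the tangent space at \<open>x\<close>,
  which is again \<open>'e\<close>. A field of frames has type \<open>'m \<Rightarrow> 'e \<Rightarrow> 'e\<close>.
\<close>
definition smooth_frame_field ::
  "('m, 'e::euclidean_space) chart set \<Rightarrow> 'm set \<Rightarrow> ('m \<Rightarrow> 'e \<Rightarrow> 'e) \<Rightarrow> bool" where
  "smooth_frame_field \<A> U s \<longleftrightarrow>
     (\<forall>x\<in>U. linear (s x) \<and> bij (s x)) \<and> (\<forall>v. smooth_vector_field \<A> U (\<lambda>x. s x v))"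

definition local_section ::
  "('m, 'e::euclidean_space) chart set \<Rightarrow> ('m \<Rightarrow> ('e \<Rightarrow> 'e) set) \<Rightarrow> 'm set \<Rightarrow> ('m \<Rightarrow> 'e \<Rightarrow> 'e) \<Rightarrow> bool" where
  "local_section \<A> P U s \<longleftrightarrow> smooth_frame_field \<A> U s \<and> (\<forall>x\<in>U. s x \<in> P x)"

definition G_structure ::
  "('m::topological_space, 'e::euclidean_space) chart set \<Rightarrow> ('e \<Rightarrow> 'e) set
     \<Rightarrow> ('m \<Rightarrow> ('e \<Rightarrow> 'e) set) \<Rightarrow> bool" where
  "G_structure \<A> G P \<longleftrightarrow>
     (\<forall>x. \<forall>u\<in>P x. linear u \<and> bij u \<and> P x = {u \<circ> g |g. g \<in> G}) \<and>
     (\<forall>x. \<exists>U s. open U \<and> x \<in> U \<and> local_section \<A> P U s)"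

definition extend_structure ::
  "('m \<Rightarrow> ('e \<Rightarrow> 'e) set) \<Rightarrow> ('e \<Rightarrow> 'e) set \<Rightarrow> 'm \<Rightarrow> ('e \<Rightarrow> 'e) set" where
  "extend_structure P G x = {u \<circ> g |u g. u \<in> P x \<and> g \<in> G}"

text \<open>Lie algebra of a (closed) subgroup of the general linear group: velocities at the identity.\<close>
definition lie_algebra :: "('e::euclidean_space \<Rightarrow> 'e) set \<Rightarrow> ('e \<Rightarrow> 'e) set" where
  "lie_algebra G =
     {A. linear A \<and> (\<exists>\<gamma>::real \<Rightarrow> 'e \<Rightarrow> 'e. (\<forall>t. \<gamma> t \<in> G) \<and> \<gamma> 0 = id \<and>
        (\<forall>v. smooth_on UNIV (\<lambda>t. \<gamma> t v) \<and> ((\<lambda>t. \<gamma> t v) has_vector_derivative A v) (at 0)))}"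

text \<open>
  The map \<open>\<partial>\<^sub>G\<close>, with two-forms as alternating functions of two vectors; as
  \<open>e\<^sup>k \<otimes> (e\<^sup>i \<otimes> e\<^sub>j)\<close> is the function \<open>X \<mapsto> (Y \<mapsto> e\<^sup>k(X) e\<^sup>i(Y) e\<^sub>j)\<close>, antisymmetrizing gives
  \<open>e\<^sup>k\<^sup>i \<otimes> e\<^sub>j\<close>. Elements of the cokernel are represented as cosets of the image.
\<close>
definition partial_map :: "('e::real_vector \<Rightarrow> 'e \<Rightarrow> 'e) \<Rightarrow> 'e \<Rightarrow> 'e \<Rightarrow> 'e" where
  "partial_map a X Y = a X Y - a Y X"

definition coker_class ::
  "('e::euclidean_space \<Rightarrow> 'e) set \<Rightarrow> ('e \<Rightarrow> 'e \<Rightarrow> 'e) \<Rightarrow> ('e \<Rightarrow> 'e \<Rightarrow> 'e) set" where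
  "coker_class G \<theta> =
     {(\<lambda>X Y. \<theta> X Y + partial_map a X Y) |a.
        (\<forall>X. a X \<in> lie_algebra G) \<and> (\<forall>Y. linear (\<lambda>X. a X Y))}"

text \<open>
  A connection on the restriction of the G-structure \<open>P\<close> to the open set \<open>U\<close> is given by its
  connection forms \<open>\<omega> s\<close> (the pullbacks of the principal connection form along the local sections
  \<open>s\<close>), which take values in the Lie algebra and satisfy
  \<open>\<omega>(s g) = g\<^sup>-\<^sup>1 \<omega>(s) g + g\<^sup>-\<^sup>1 dg\<close>.
\<close>
definition G_connection ::
  "('m::topological_space, 'e::euclidean_space) chart set \<Rightarrow> ('e \<Rightarrow> 'e) set
     \<Rightarrow> ('m \<Rightarrow> ('e \<Rightarrow> 'e) set) \<Rightarrow> 'm set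
     \<Rightarrow> (('m \<Rightarrow> 'e \<Rightarrow> 'e) \<Rightarrow> 'm \<Rightarrow> 'e \<Rightarrow> 'e \<Rightarrow> 'e) \<Rightarrow> bool" where
  "G_connection \<A> G P U \<omega> \<longleftrightarrow>
     (\<forall>N s. open N \<and> N \<subseteq> U \<and> local_section \<A> P N s \<longrightarrow>
        (\<forall>x\<in>N. \<forall>X. \<omega> s x X \<in> lie_algebra G) \<and>
        (\<forall>v. smooth_one_form \<A> N (\<lambda>x X. \<omega> s x X v))) \<and>
     (\<forall>N s s'. open N \<and> N \<subseteq> U \<and> local_section \<A> P N s \<and> local_section \<A> P N s' \<longrightarrow>
        (let g = (\<lambda>x. inv (s x) \<circ> s' x) in
         \<forall>x\<in>N. \<forall>X v. \<omega> s' x X v =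
           inv (g x) (\<omega> s x X (g x v)) + inv (g x) (dir_deriv \<A> (\<lambda>y. g y v) x X)))"

text \<open>
  The torsion of the connection \<open>\<omega>\<close> at the frame \<open>s x\<close>, by the first structure equation:
  the pullback along \<open>s\<close> of the tautological form is the coframe \<open>\<theta> = s\<^sup>-\<^sup>1\<close>, and the torsion is
  \<open>d\<theta> + \<omega> \<and> \<theta>\<close>.
\<close>
definition torsion ::
  "('m, 'e::euclidean_space) chart set \<Rightarrow> (('m \<Rightarrow> 'e \<Rightarrow> 'e) \<Rightarrow> 'm \<Rightarrow> 'e \<Rightarrow> 'e \<Rightarrow> 'e)
     \<Rightarrow> ('m \<Rightarrow> 'e \<Rightarrow> 'e) \<Rightarrow> 'm \<Rightarrow> 'e \<Rightarrow> 'e \<Rightarrow> 'e" where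
  "torsion \<A> \<omega> s x X Y =
     ext_deriv \<A> (\<lambda>y. inv (s y)) x (s x X) (s x Y)
     + \<omega> s x (s x X) Y - \<omega> s x (s x Y) X"

text \<open>
  The intrinsic torsion at the frame \<open>u \<in> P x\<close> is the class of the torsion at \<open>u\<close> of any connection.
  The class does not depend on the connection or on the section through \<open>u\<close>, and a connection on
  the restriction of \<open>P\<close> to a neighbourhood of \<open>x\<close> is enough; the union is over equal cosets.
\<close>
definition intrinsic_torsion ::
  "('m::topological_space, 'e::euclidean_space) chart set \<Rightarrow> ('e \<Rightarrow> 'e) set
     \<Rightarrow> ('m \<Rightarrow> ('e \<Rightarrow> 'e) set) \<Rightarrow> 'm \<Rightarrow> ('e \<Rightarrow> 'e) \<Rightarrow> ('e \<Rightarrow> 'e \<Rightarrow> 'e) set" where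
  "intrinsic_torsion \<A> G P x u =
     \<Union>{coker_class G (torsion \<A> \<omega> s x) |\<omega> s.
        \<exists>U. open U \<and> x \<in> U \<and> local_section \<A> P U s \<and> s x = u \<and> G_connection \<A> G P U \<omega>}"


section \<open>Quaternions and the linear model\<close>

text \<open>The coordinates of \<open>real^4\<close> are those with respect to \<open>1, i, j, k\<close>.\<close>
definition qmul :: "real^4 \<Rightarrow> real^4 \<Rightarrow> real^4" where
  "qmul p q = vector
     [p$1 * q$1 - p$2 * q$2 - p$3 * q$3 - p$4 * q$4,
      p$1 * q$2 + p$2 * q$1 + p$3 * q$4 - p$4 * q$3,
      p$1 * q$3 - p$2 * q$4 + p$3 * q$1 + p$4 * q$2,
      p$1 * q$4 + p$2 * q$3 - p$3 * q$2 + p$4 * q$1]"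

definition qone :: "real^4" where
  "qone = vector [1, 0, 0, 0]"

definition qconj :: "real^4 \<Rightarrow> real^4" where
  "qconj p = vector [p$1, - p$2, - p$3, - p$4]"

definition qinv :: "real^4 \<Rightarrow> real^4" where
  "qinv p = (1 / (norm p)\<^sup>2) *\<^sub>R qconj p"

text \<open>The imaginary quaternions are \<open>real^3\<close>.\<close>
definition q_of_im :: "real^3 \<Rightarrow> real^4" where
  "q_of_im w = vector [0, w$1, w$2, w$3]"

definition im_part :: "real^4 \<Rightarrow> real^3" where
  "im_part p = vector [p$2, p$3, p$4]"

text \<open>
  \<open>V = real^4^'n\<close> with \<open>n = CARD('n)\<close>: component \<open>a\<close> of entry \<open>j\<close> is the coordinate \<open>4j - 4 + a\<close>.
  \<open>W = real^3\<close>, and \<open>T = V \<times> W\<close>.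
\<close>
type_synonym 'n model = "(real^4^'n) \<times> (real^3)"

text \<open>\<open>e\<^sup>a\<^sup>b(x,y)\<close> within one quaternionic factor.\<close>
definition wedge_coord :: "4 \<Rightarrow> 4 \<Rightarrow> real^4 \<Rightarrow> real^4 \<Rightarrow> real" where
  "wedge_coord a b x y = x$a * y$b - x$b * y$a"

definition qc_omega :: "3 \<Rightarrow> real^4^'n \<Rightarrow> real^4^'n \<Rightarrow> real" where
  "qc_omega s x y =
     (\<Sum>j\<in>UNIV.
        if s = 1 then wedge_coord 1 2 (x$j) (y$j) - wedge_coord 3 4 (x$j) (y$j)
        else if s = 2 then wedge_coord 1 3 (x$j) (y$j) + wedge_coord 2 4 (x$j) (y$j)
        else wedge_coord 1 4 (x$j) (y$j) - wedge_coord 2 3 (x$j) (y$j))"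

definition Theta0 :: "'n::finite model \<Rightarrow> 'n model \<Rightarrow> 'n model" where
  "Theta0 X Y = (0, \<chi> s. qc_omega s (fst X) (fst Y))"

definition Sp :: "(real^4^'n^'n) set" where
  "Sp = {g. \<forall>i j. (\<Sum>k\<in>UNIV. qmul (qconj (g$k$i)) (g$k$j)) = (if i = j then qone else 0)}"

definition act_V :: "real^4^'n^'n \<Rightarrow> real^4 \<Rightarrow> real^4^'n \<Rightarrow> real^4^'n" where
  "act_V g p v = (\<chi> i. qmul (\<Sum>j\<in>UNIV. qmul (g$i$j) (v$j)) (qinv p))"

definition act_Im :: "real^4 \<Rightarrow> real^3 \<Rightarrow> real^3" where
  "act_Im p q = im_part (qmul (qmul p (q_of_im q)) (qconj p))"

text \<open>The contragredient of \<open>act_Im\<close>; the dual of the imaginary quaternions is identified with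
  \<open>real^3\<close> through the dual basis, so that transposes are adjoints.\<close>
definition act_W :: "real^4 \<Rightarrow> real^3 \<Rightarrow> real^3" where
  "act_W p = adjoint (inv (act_Im p))"

definition EH :: "(real^3 \<Rightarrow> real^4^'n) set" where
  "EH = {(\<lambda>w. \<Sum>s\<in>UNIV. w$s *\<^sub>R (\<Sum>b\<in>Basis. qc_omega s v b *\<^sub>R b)) |v. True}"

text \<open>Semidirect product of \<open>Sp(n)\<H>\<^sup>*\<close> with an invariant subspace of \<open>Hom(W,V)\<close>.\<close>
definition semidirect :: "(real^3 \<Rightarrow> real^4^'n) set \<Rightarrow> ('n::finite model \<Rightarrow> 'n model) set" where
  "semidirect F =
     {(\<lambda>(v, w). (act_V g p v + f (act_W p w), act_W p w)) |g p f. g \<in> Sp \<and> p \<noteq> 0 \<and> f \<in> F}"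

definition B_group :: "('n::finite model \<Rightarrow> 'n model) set" where
  "B_group = semidirect {f. linear f}"

definition K_group :: "('n::finite model \<Rightarrow> 'n model) set" where
  "K_group = semidirect EH"


section \<open>Quaternionic contact structures\<close>

definition qc_forms ::
  "('m, 'n::finite model) chart set \<Rightarrow> ('m \<Rightarrow> 'n model set) \<Rightarrow> 'm set
     \<Rightarrow> (3 \<Rightarrow> 'm \<Rightarrow> 'n model \<Rightarrow> real) \<Rightarrow> bool" where
  "qc_forms \<A> D U \<eta> \<longleftrightarrow>
     (\<forall>s. smooth_one_form \<A> U (\<eta> s)) \<and>
     (\<forall>x\<in>U. D x = {X. \<forall>s. \<eta> s x X = 0} \<and>
        (\<exists>u :: real^4^'n \<Rightarrow> 'n model. linear u \<and> bij_betw u UNIV (D x) \<and>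
           (\<forall>s v v'. ext_deriv \<A> (\<eta> s) x (u v) (u v') = qc_omega s v v')))"

definition qc_structure ::
  "('m::topological_space, 'n::finite model) chart set \<Rightarrow> ('m \<Rightarrow> 'n model set) \<Rightarrow> bool" where
  "qc_structure \<A> D \<longleftrightarrow>
     distribution \<A> (4 * CARD('n)) D \<and>
     (\<forall>x. \<exists>U \<eta>. open U \<and> x \<in> U \<and> qc_forms \<A> D U \<eta>)"

definition duchemin_integrable ::
  "('m::topological_space, 'n::finite model) chart set \<Rightarrow> ('m \<Rightarrow> 'n model set) \<Rightarrow> bool" where
  "duchemin_integrable \<A> D \<longleftrightarrow>
     (\<forall>x. \<exists>U \<eta>. open U \<and> x \<in> U \<and> qc_forms \<A> D U \<eta> \<and>
        (\<forall>y\<in>U. \<exists>R :: 3 \<Rightarrow> 'n model. \<forall>r s.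
           \<eta> s y (R r) = (if s = r then 1 else 0) \<and>
           (\<forall>X\<in>D y. ext_deriv \<A> (\<eta> r) y (R s) X + ext_deriv \<A> (\<eta> s) y (R r) X = 0)))"

definition integrable_qc_K_structure ::
  "('m::topological_space, 'n::finite model) chart set
     \<Rightarrow> ('m \<Rightarrow> ('n model \<Rightarrow> 'n model) set) \<Rightarrow> bool" where
  "integrable_qc_K_structure \<A> P \<longleftrightarrow>
     G_structure \<A> K_group P \<and>
     (\<forall>x. \<forall>u\<in>P x.
        intrinsic_torsion \<A> B_group (extend_structure P B_group) x u = coker_class B_group Theta0)"

text \<open>The frames \<open>u\<close> at \<open>x\<close> with \<open>u(V) = D x\<close>.\<close>
definition Q_structure_of ::
  "('m \<Rightarrow> 'n::finite model set) \<Rightarrow> 'm \<Rightarrow> ('n model \<Rightarrow> 'n model) set" where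
  "Q_structure_of D x = {u. linear u \<and> bij u \<and> u ` (UNIV \<times> {0}) = D x}"

end

(*
  A frame field s with coframe theta = inverse of s, whose W-component is (eta_1, eta_2, eta_3), is
  called good if it is adapted to D, if d eta restricted to D is the standard triple omega, and if the
  symmetric part of W x W -> V*, (w, w') |-> d eta_w'(s w, .), is conformal, i.e. a multiple of the
  metric of W. The values of good frame fields form the K-structure of a Duchemin integrable D:

  - The transition g between two good frame fields takes values in B, because B is the stabilizer of
    omega. So the W-component of g is conformal near each point, and differentiating this shows that
    the Hom(W,V)-part of g preserves the conformality of the symmetric part, which means it lies in EH.
  - The torsion d theta of a good frame field differs from Theta_0 by an element of the image of
    partial_B. On all components but the V-component on V x V this is linear algebra. There the Bianchi
    identity d d eta = 0 says, after subtracting the part fixed by the conformal action on W, that the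
    three fundamental forms are closed with respect to the remaining torsion, and the argument of
    Hitchin's lemma shows that the Levi-Civita-type (Koszul) solution takes values in sp(n).
  - Good frame fields exist locally: a quaternionic Gram-Schmidt process yields smooth adapted frames
    of D, and among the Reeb vectors that make the symmetric part conformal, which form an affine
    space over EH, one can be chosen by an explicit smooth formula.

  Conversely, for a section of an integrable qc K-structure the torsion condition says that d eta is
  omega on D and that the symmetric part is conformal; the multiple of the metric is removed by adding
  an element of EH to the Reeb vectors at each point. A flat connection of the given section serves to
  compute the intrinsic torsion in both directions.
*)
theory Submission
  imports Defs
begin

text \<open>A good frame field has conformal, not vanishing, symmetric part because only this is
  invariant under \<open>K_group\<close>: by the Clifford relation \<open>rim_conformal\<close> an
  element of EH shifts the multiple of the metric by an arbitrary covector, and a varying scale on W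
  shifts it by the derivative of the scale. Torsion depends on the first jet of a frame field, so
  the fibres of the K-structure are sets of values of good sections, not frames singled out by a
  pointwise condition. The Lie algebra of B is never computed. One direction needs three families
  inside it (quaternionic scalars, Hom(W,V), skew maps commuting with the quaternions), each given
  by explicit curves in the group; the other needs only two linear constraints,
  \<open>lie_algebra_B_D\<close>. In Duchemin's condition the frames and the Reeb vectors are given
  at each point separately and may vary discontinuously. Only the forms are smooth, so the smooth
  objects are rebuilt from them: the quaternionic structure from quotients of Gram matrices, the
  Reeb vectors from the lift normalised by \<open>f i = 0\<close>.\<close>

section \<open>Smooth maps\<close>

lemma Ck_on_cong:
  assumes "open S" "\<And>x. x \<in> S \<Longrightarrow> f x = g x"
  shows "Ck_on k S f \<longleftrightarrow> Ck_on k S g"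
proof -
  have *: "Ck_on k S f \<Longrightarrow> Ck_on k S g" if "\<And>x. x \<in> S \<Longrightarrow> f x = g x" for f g :: "'a \<Rightarrow> 'b"
    using that
  proof (induction k arbitrary: f g)
    case 0
    then show ?case using continuous_on_cong[of S S f g] by simp
  next
    case (Suc k)
    have d: "(g has_derivative frechet_derivative f (at x)) (at x)" if "x \<in> S" for x
    proof -
      have "(f has_derivative frechet_derivative f (at x)) (at x)"
        using Suc.prems(1) that frechet_derivative_works by (metis Ck_on.simps(2))
      then show ?thesis
        by (rule has_derivative_transform_within_open[OF _ \<open>open S\<close> that]) (rule Suc.prems(2))
    qed
    then have e: "frechet_derivative g (at x) = frechet_derivative f (at x)" if "x \<in> S" for x
      using that by (metis frechet_derivative_at)
    have "Ck_on k S (\<lambda>x. frechet_derivative g (at x) v)" for v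
    proof (rule Suc.IH)
      show "Ck_on k S (\<lambda>x. frechet_derivative f (at x) v)" using Suc.prems(1) by simp
    qed (simp add: e)
    moreover have "\<forall>x\<in>S. g differentiable (at x)" using d differentiable_def by blast
    ultimately show ?case by simp
  qed
  show ?thesis using *[of f g] *[of g f] assms(2) by auto
qed

lemma Ck_on_subset: "Ck_on k S f \<Longrightarrow> T \<subseteq> S \<Longrightarrow> Ck_on k T f"
  by (induction k arbitrary: f) (auto intro: continuous_on_subset)

lemma Ck_on_SucD: "Ck_on (Suc k) S f \<Longrightarrow> Ck_on k S f"
  by (induction k arbitrary: f)
     (auto intro!: continuous_at_imp_continuous_on differentiable_imp_continuous_within)

lemma Ck_on_imp_continuous: "Ck_on k S f \<Longrightarrow> continuous_on S f"
  by (cases k) (auto intro!: continuous_at_imp_continuous_on differentiable_imp_continuous_within)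

text \<open>\<open>frechet_derivative\<close> is a choice operator; this rule lets the inductions on
  \<open>k\<close> work with any explicit formula for the derivative.\<close>

lemma Ck_on_SucI:
  assumes "open S" "\<And>x. x \<in> S \<Longrightarrow> (f has_derivative f' x) (at x)"
    "\<And>v. Ck_on k S (\<lambda>x. f' x v)"
  shows "Ck_on (Suc k) S f"
proof -
  have "frechet_derivative f (at x) = f' x" if "x \<in> S" for x
    using assms(2)[OF that] by (metis frechet_derivative_at)
  then have "Ck_on k S (\<lambda>x. frechet_derivative f (at x) v)" for v
    using assms(3)[of v] Ck_on_cong[OF assms(1), of "\<lambda>x. frechet_derivative f (at x) v" "\<lambda>x. f' x v" k] by simp
  then show ?thesis using assms(2) by (auto simp: differentiable_def)
qed

lemma Ck_on_SucE:
  assumes "Ck_on (Suc k) S f" "x \<in> S"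
  shows "(f has_derivative frechet_derivative f (at x)) (at x)"
  using assms frechet_derivative_works by (metis Ck_on.simps(2))

lemma Ck_on_const [simp]: "Ck_on k S (\<lambda>x. c)"
  by (induction k arbitrary: c) auto

lemma Ck_on_bounded_linear:
  assumes "bounded_linear h" "open S" "Ck_on k S f"
  shows "Ck_on k S (\<lambda>x. h (f x))"
  using assms(3)
proof (induction k arbitrary: f)
  case 0
  then show ?case using assms(1) by (auto intro: bounded_linear.continuous_on)
next
  case (Suc k)
  show ?case
    by (rule Ck_on_SucI[OF assms(2) bounded_linear.has_derivative[OF assms(1) Ck_on_SucE[OF Suc.prems]]])
       (use Suc in auto)
qed

lemma Ck_on_ident: "open S \<Longrightarrow> Ck_on k S (\<lambda>x. x)"
  by (cases k) (auto intro!: Ck_on_SucI has_derivative_ident)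

lemma Ck_on_add:
  assumes "open S" "Ck_on k S f" "Ck_on k S g"
  shows "Ck_on k S (\<lambda>x. f x + g x)"
  using assms(2,3)
proof (induction k arbitrary: f g)
  case 0
  then show ?case by (auto intro: continuous_intros)
next
  case (Suc k)
  show ?case
  proof (rule Ck_on_SucI[OF assms(1)])
    show "((\<lambda>x. f x + g x) has_derivative
       (\<lambda>v. frechet_derivative f (at x) v + frechet_derivative g (at x) v)) (at x)" if "x \<in> S" for x
      by (intro has_derivative_add Ck_on_SucE[OF Suc.prems(1) that] Ck_on_SucE[OF Suc.prems(2) that])
    show "Ck_on k S (\<lambda>x. frechet_derivative f (at x) v + frechet_derivative g (at x) v)" for v
      by (rule Suc.IH) (use Suc.prems in auto)
  qed
qed

lemma Ck_on_sum:
  assumes "open S" "\<And>i. i \<in> I \<Longrightarrow> Ck_on k S (f i)"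
  shows "Ck_on k S (\<lambda>x. \<Sum>i\<in>I. f i x)"
  using assms(2) by (induction I rule: infinite_finite_induct) (auto intro: Ck_on_add[OF assms(1)])

lemma Ck_on_bilinear:
  assumes "bounded_bilinear h" "open S" "Ck_on k S f" "Ck_on k S g"
  shows "Ck_on k S (\<lambda>x. h (f x) (g x))"
  using assms(3,4)
proof (induction k arbitrary: f g)
  case 0
  then show ?case using assms(1) by (auto intro: bounded_bilinear.continuous_on)
next
  case (Suc k)
  have f: "Ck_on k S f" and g: "Ck_on k S g" using Suc.prems by (auto intro: Ck_on_SucD simp del: Ck_on.simps)
  show ?case
  proof (rule Ck_on_SucI[OF assms(2)])
    show "((\<lambda>x. h (f x) (g x)) has_derivative
       (\<lambda>v. h (f x) (frechet_derivative g (at x) v) + h (frechet_derivative f (at x) v) (g x))) (at x)"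
      if "x \<in> S" for x
      by (rule bounded_bilinear.FDERIV[OF assms(1) Ck_on_SucE[OF Suc.prems(1) that] Ck_on_SucE[OF Suc.prems(2) that]])
    show "Ck_on k S (\<lambda>x. h (f x) (frechet_derivative g (at x) v) + h (frechet_derivative f (at x) v) (g x))" for v
      by (rule Ck_on_add[OF assms(2)]; rule Suc.IH) (use Suc.prems f g in auto)
  qed
qed

lemma linear_euclidean:
  fixes L :: "'a::euclidean_space \<Rightarrow> 'b::real_vector"
  assumes "linear L"
  shows "L v = (\<Sum>b\<in>Basis. (v \<bullet> b) *\<^sub>R L b)"
proof -
  have "L v = L (\<Sum>b\<in>Basis. (v \<bullet> b) *\<^sub>R b)" by (simp only: euclidean_representation)
  then show ?thesis by (simp only: linear_sum[OF assms] linear_cmul[OF assms])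
qed

text \<open>In the chain rule both the linear map \<open>Dg(f x)\<close> and its argument
  \<open>Df(x) v\<close> vary with \<open>x\<close>. Expanding the argument in a basis turns the
  composite into a sum of products, to which the induction hypothesis applies; hence the Euclidean
  domain of \<open>g\<close>.\<close>

lemma Ck_on_compose:
  fixes g :: "'b::euclidean_space \<Rightarrow> 'c::real_normed_vector"
  assumes "open S" "Ck_on k S f" "Ck_on k T g" "f ` S \<subseteq> T"
  shows "Ck_on k S (\<lambda>x. g (f x))"
  using assms(2,3)
proof (induction k arbitrary: g)
  case 0
  then show ?case using assms(4) by (auto intro: continuous_on_compose2)
next
  case (Suc k)
  have f: "Ck_on k S f" by (rule Ck_on_SucD[OF Suc.prems(1)])
  show ?case
  proof (rule Ck_on_SucI[OF assms(1)])
    fix x assume x: "x \<in> S"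
    have "linear (frechet_derivative g (at (f x)))"
      using Suc.prems(2) x assms(4) by (intro linear_frechet_derivative) auto
    then have "(\<lambda>v. frechet_derivative g (at (f x)) (frechet_derivative f (at x) v))
      = (\<lambda>v. \<Sum>b\<in>Basis. (frechet_derivative f (at x) v \<bullet> b) *\<^sub>R frechet_derivative g (at (f x)) b)"
      using linear_euclidean by blast
    moreover have "((\<lambda>x. g (f x)) has_derivative
        (\<lambda>v. frechet_derivative g (at (f x)) (frechet_derivative f (at x) v))) (at x)"
      using Suc.prems x assms(4)
      by (intro has_derivative_compose[of f _ x UNIV g] Ck_on_SucE[of k S] Ck_on_SucE[of k T]) auto
    ultimately show "((\<lambda>x. g (f x)) has_derivative
        (\<lambda>v. \<Sum>b\<in>Basis. (frechet_derivative f (at x) v \<bullet> b) *\<^sub>R frechet_derivative g (at (f x)) b)) (at x)"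
      by simp
  next
    fix v
    have "Ck_on k S (\<lambda>x. frechet_derivative f (at x) v \<bullet> b)" for b
      using Suc.prems(1) by (intro Ck_on_bounded_linear[OF bounded_linear_inner_left assms(1)]) auto
    moreover have "Ck_on k S (\<lambda>x. frechet_derivative g (at (f x)) b)" for b
      by (rule Suc.IH[OF f]) (use Suc.prems in auto)
    ultimately show "Ck_on k S (\<lambda>x. \<Sum>b\<in>Basis. (frechet_derivative f (at x) v \<bullet> b) *\<^sub>R frechet_derivative g (at (f x)) b)"
      by (intro Ck_on_sum Ck_on_bilinear[OF bounded_bilinear_scaleR] assms(1))
  qed
qed

lemma smooth_on_cong: "open S \<Longrightarrow> (\<And>x. x \<in> S \<Longrightarrow> f x = g x) \<Longrightarrow> smooth_on S f \<longleftrightarrow> smooth_on S g"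
  unfolding smooth_on_def using Ck_on_cong by blast

lemma smooth_on_subset: "smooth_on S f \<Longrightarrow> T \<subseteq> S \<Longrightarrow> smooth_on T f"
  unfolding smooth_on_def using Ck_on_subset by blast

lemma smooth_on_continuous: "smooth_on S f \<Longrightarrow> continuous_on S f"
  unfolding smooth_on_def using Ck_on_imp_continuous by blast

lemma smooth_on_has_derivative:
  "smooth_on S f \<Longrightarrow> x \<in> S \<Longrightarrow> (f has_derivative frechet_derivative f (at x)) (at x)"
  unfolding smooth_on_def using Ck_on_SucE by blast

lemma smooth_on_frechet: "smooth_on S f \<Longrightarrow> smooth_on S (\<lambda>x. frechet_derivative f (at x) v)"
  unfolding smooth_on_def by (metis Ck_on.simps(2))

lemma smooth_on_const [simp]: "smooth_on S (\<lambda>x. c)"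
  unfolding smooth_on_def by simp

lemma smooth_on_ident: "open S \<Longrightarrow> smooth_on S (\<lambda>x. x)"
  unfolding smooth_on_def using Ck_on_ident by blast

lemma smooth_on_bounded_linear:
  "bounded_linear h \<Longrightarrow> open S \<Longrightarrow> smooth_on S f \<Longrightarrow> smooth_on S (\<lambda>x. h (f x))"
  unfolding smooth_on_def using Ck_on_bounded_linear by blast

lemma smooth_on_linear:
  fixes h :: "'b::euclidean_space \<Rightarrow> 'c::real_normed_vector"
  shows "linear h \<Longrightarrow> open S \<Longrightarrow> smooth_on S f \<Longrightarrow> smooth_on S (\<lambda>x. h (f x))"
  by (simp add: linear_conv_bounded_linear smooth_on_bounded_linear)

lemma smooth_on_add: "open S \<Longrightarrow> smooth_on S f \<Longrightarrow> smooth_on S g \<Longrightarrow> smooth_on S (\<lambda>x. f x + g x)"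
  unfolding smooth_on_def using Ck_on_add by blast

lemma smooth_on_minus: "open S \<Longrightarrow> smooth_on S f \<Longrightarrow> smooth_on S (\<lambda>x. - f x)"
  by (rule smooth_on_bounded_linear[OF bounded_linear_minus[OF bounded_linear_ident]])

lemma smooth_on_diff: "open S \<Longrightarrow> smooth_on S f \<Longrightarrow> smooth_on S g \<Longrightarrow> smooth_on S (\<lambda>x. f x - g x)"
  unfolding diff_conv_add_uminus
proof -
  assume S: "open S" "smooth_on S f" "smooth_on S g"
  show "smooth_on S (\<lambda>x. f x + - g x)"
    by (rule smooth_on_add[OF S(1,2) smooth_on_minus[OF S(1,3)]])
qed

lemma smooth_on_sum: "open S \<Longrightarrow> (\<And>i. i \<in> I \<Longrightarrow> smooth_on S (f i)) \<Longrightarrow> smooth_on S (\<lambda>x. \<Sum>i\<in>I. f i x)"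
  by (simp add: smooth_on_def Ck_on_sum)

lemma smooth_on_bilinear:
  "bounded_bilinear h \<Longrightarrow> open S \<Longrightarrow> smooth_on S f \<Longrightarrow> smooth_on S g \<Longrightarrow> smooth_on S (\<lambda>x. h (f x) (g x))"
  unfolding smooth_on_def using Ck_on_bilinear by blast

lemmas smooth_on_scaleR = smooth_on_bilinear[OF bounded_bilinear_scaleR]
lemmas smooth_on_mult = smooth_on_bilinear[OF bounded_bilinear_mult]
lemmas smooth_on_inner = smooth_on_bilinear[OF bounded_bilinear_inner]

lemma smooth_on_compose:
  fixes g :: "'b::euclidean_space \<Rightarrow> 'c::real_normed_vector"
  shows "open S \<Longrightarrow> smooth_on S f \<Longrightarrow> smooth_on T g \<Longrightarrow> f ` S \<subseteq> T \<Longrightarrow> smooth_on S (\<lambda>x. g (f x))"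
  unfolding smooth_on_def using Ck_on_compose by blast

lemma smooth_on_Pair:
  assumes "open S" "smooth_on S f" "smooth_on S g"
  shows "smooth_on S (\<lambda>x. (f x, g x))"
proof -
  have "smooth_on S (\<lambda>x. (f x, 0) + (0, g x))"
    by (intro smooth_on_add assms smooth_on_bounded_linear[of "\<lambda>y. (y, 0)" S f]
        smooth_on_bounded_linear[of "\<lambda>y. (0, y)" S g] bounded_linear_Pair bounded_linear_ident bounded_linear_zero)
  then show ?thesis by simp
qed

lemma smooth_on_fst: "open S \<Longrightarrow> smooth_on S f \<Longrightarrow> smooth_on S (\<lambda>x. fst (f x))"
  by (rule smooth_on_bounded_linear[OF bounded_linear_fst])

lemma smooth_on_nth: "open S \<Longrightarrow> smooth_on S f \<Longrightarrow> smooth_on S (\<lambda>x. f x $ i)"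
  by (rule smooth_on_bounded_linear[OF bounded_linear_vec_nth])

lemma smooth_on_vec_lambda:
  fixes f :: "'a::real_normed_vector \<Rightarrow> 'i::finite \<Rightarrow> 'b::euclidean_space"
  assumes "open S" "\<And>i. smooth_on S (\<lambda>x. f x i)"
  shows "smooth_on S (\<lambda>x. \<chi> i. f x i)"
proof -
  have "linear (\<lambda>y::'b. axis i y)" for i :: 'i
    by (rule linearI) (auto simp: vec_eq_iff axis_def)
  then have "smooth_on S (\<lambda>x. axis i (f x i))" for i
    by (rule smooth_on_linear[OF _ assms(1), of "axis i"]) (rule assms(2))
  then have "smooth_on S (\<lambda>x. \<Sum>i\<in>UNIV. axis i (f x i))"
    by (intro smooth_on_sum assms(1))
  moreover have "(\<Sum>i\<in>UNIV. axis i (f x i)) = (\<chi> i. f x i)" for x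
    by (simp add: vec_eq_iff axis_def)
  ultimately show ?thesis by simp
qed

text \<open>A smooth family of linear maps is encoded throughout by smoothness of its value at each
  fixed vector. Expansion in a basis passes from fixed to varying arguments.\<close>

lemma smooth_on_apply:
  fixes f :: "'a::real_normed_vector \<Rightarrow> 'b::euclidean_space"
  assumes "open S" "\<And>x. x \<in> S \<Longrightarrow> linear (L x)" "\<And>v. smooth_on S (\<lambda>x. L x v)" "smooth_on S f"
  shows "smooth_on S (\<lambda>x. L x (f x))"
proof -
  have "smooth_on S (\<lambda>x. \<Sum>b\<in>Basis. (f x \<bullet> b) *\<^sub>R L x b)"
    by (intro smooth_on_sum smooth_on_scaleR smooth_on_inner assms smooth_on_const)
  moreover have "(\<Sum>b\<in>Basis. (f x \<bullet> b) *\<^sub>R L x b) = L x (f x)" if "x \<in> S" for x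
    using linear_euclidean[OF assms(2)[OF that], of "f x"] by simp
  ultimately show ?thesis 
    using smooth_on_cong[OF assms(1), of "\<lambda>x. \<Sum>b\<in>Basis. (f x \<bullet> b) *\<^sub>R L x b" "\<lambda>x. L x (f x)"] by simp
qed

text \<open>The derivative of a power is a multiple of another power, so the induction runs over all
  exponents at once. It serves to normalise vectors in the Gram-Schmidt process.\<close>

lemma smooth_on_powr:
  assumes "open S" "smooth_on S f" "\<And>x. x \<in> S \<Longrightarrow> f x > (0::real)"
  shows "smooth_on S (\<lambda>x. f x powr a)"
proof -
  have "Ck_on k {0<..} (\<lambda>t::real. t powr a)" for k
  proof (induction k arbitrary: a)
    case 0
    then show ?case by (auto intro!: continuous_intros)
  next
    case (Suc k)
    have "((\<lambda>t::real. t powr a) has_derivative (\<lambda>v. (a * t powr (a - 1)) * v)) (at t)" if "t > 0" for t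
      using has_real_derivative_powr[OF that, of a]
      by (simp add: has_field_derivative_def)
    then show ?case
      by (intro Ck_on_SucI[where f' = "\<lambda>t v. (a * t powr (a - 1)) * v"] Ck_on_bilinear[OF bounded_bilinear_mult] Suc)
         (auto)
  qed
  then show ?thesis
    using smooth_on_compose[OF assms(1,2), of "{0<..}" "\<lambda>t. t powr a"] assms(3)
    by (auto simp: smooth_on_def)
qed

lemma smooth_on_exp: "open S \<Longrightarrow> smooth_on S (f::_ \<Rightarrow> real) \<Longrightarrow> smooth_on S (\<lambda>x. exp (f x))"
proof -
  have "Ck_on k UNIV (exp :: real \<Rightarrow> real)" for k
  proof (induction k)
    case (Suc k)
    have "(exp has_derivative (\<lambda>v. exp t * v)) (at t)" for t :: real
      using DERIV_exp[of t] by (simp add: has_field_derivative_def)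
    then show ?case
      by (intro Ck_on_SucI[where f' = "\<lambda>t v. exp t * v"] Ck_on_bilinear[OF bounded_bilinear_mult] Suc) auto
  next
    case 0
    show ?case by (auto intro: continuous_intros)
  qed
  then show "open S \<Longrightarrow> smooth_on S f \<Longrightarrow> smooth_on S (\<lambda>x. exp (f x))"
    using smooth_on_compose[of S f UNIV exp] by (auto simp: smooth_on_def)
qed

text \<open>The sine is the bounded reparametrization of time in
  \<open>lie_algebra_family\<close>.\<close>

lemma smooth_on_sin: "open S \<Longrightarrow> smooth_on S (f::_ \<Rightarrow> real) \<Longrightarrow> smooth_on S (\<lambda>x. sin (f x))"
proof -
  have "Ck_on k UNIV (sin :: real \<Rightarrow> real) \<and> Ck_on k UNIV (cos :: real \<Rightarrow> real)" for k
  proof (induction k)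
    case (Suc k)
    have "(sin has_derivative (\<lambda>v. cos t * v)) (at t)" "(cos has_derivative (\<lambda>v. - sin t * v)) (at t)" for t :: real
      using DERIV_sin[of t] DERIV_cos[of t] by (simp_all only: has_field_derivative_def)
    moreover have "Ck_on k UNIV (\<lambda>t::real. - sin t)"
      using Suc Ck_on_bounded_linear[OF bounded_linear_minus[OF bounded_linear_ident]] by blast
    ultimately show ?case using Suc
      by (intro conjI Ck_on_SucI[where f' = "\<lambda>t v. cos t * v"] Ck_on_SucI[where f' = "\<lambda>t v. - sin t * v"]
           Ck_on_bilinear[OF bounded_bilinear_mult]) auto
  next
    case 0
    show ?case by (auto intro: continuous_intros)
  qed
  then show "open S \<Longrightarrow> smooth_on S f \<Longrightarrow> smooth_on S (\<lambda>x. sin (f x))"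
    using smooth_on_compose[of S f UNIV sin] by (auto simp: smooth_on_def)
qed

section \<open>Symmetry of second derivatives\<close>

text \<open>The mean value theorem is used twice: along \<open>v\<close> for the difference of
  \<open>f\<close> across the edge \<open>h w\<close> of the parallelogram, then along
  \<open>w\<close> for the derivative of \<open>f\<close> in direction \<open>v\<close>.\<close>

lemma second_difference_mean_value:
  fixes f :: "'a::real_normed_vector \<Rightarrow> real"
  assumes S: "smooth_on S f" and h: "h > 0"
    and sub: "\<And>s t. 0 \<le> s \<Longrightarrow> s \<le> h \<Longrightarrow> 0 \<le> t \<Longrightarrow> t \<le> h \<Longrightarrow> p + s *\<^sub>R v + t *\<^sub>R w \<in> S"
  shows "\<exists>s t. 0 \<le> s \<and> s \<le> h \<and> 0 \<le> t \<and> t \<le> h \<and>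
    f (p + h *\<^sub>R v + h *\<^sub>R w) - f (p + h *\<^sub>R v) - f (p + h *\<^sub>R w) + f p
     = h * h * frechet_derivative (\<lambda>x. frechet_derivative f (at x) v) (at (p + s *\<^sub>R v + t *\<^sub>R w)) w"
proof -
  define g where "g = (\<lambda>x. frechet_derivative f (at x) v)"
  have line: "((\<lambda>r. F (q + r *\<^sub>R u)) has_real_derivative frechet_derivative F (at (q + r *\<^sub>R u)) u) (at r)"
    if "smooth_on S F" "q + r *\<^sub>R u \<in> S" for F :: "'a \<Rightarrow> real" and q u r
  proof -
    have F: "(F has_derivative frechet_derivative F (at (q + r *\<^sub>R u))) (at (q + r *\<^sub>R u))"
      using smooth_on_has_derivative[OF that] .
    have "((\<lambda>r. F (q + r *\<^sub>R u)) has_derivative (\<lambda>d. frechet_derivative F (at (q + r *\<^sub>R u)) (d *\<^sub>R u))) (at r)"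
      by (rule has_derivative_compose[of "\<lambda>r. q + r *\<^sub>R u", OF _ F]) (auto intro!: derivative_eq_intros)
    moreover have "(\<lambda>d. frechet_derivative F (at (q + r *\<^sub>R u)) (d *\<^sub>R u)) = (*) (frechet_derivative F (at (q + r *\<^sub>R u)) u)"
      using has_derivative_linear[OF F] by (auto simp: linear_cmul)
    ultimately show ?thesis by (simp add: has_field_derivative_def)
  qed
  have g: "smooth_on S g" unfolding g_def by (rule smooth_on_frechet[OF S])
  define \<phi> where "\<phi> = (\<lambda>s. f ((p + h *\<^sub>R w) + s *\<^sub>R v) - f (p + s *\<^sub>R v))"
  have m1: "p + h *\<^sub>R w + s *\<^sub>R v \<in> S" "p + s *\<^sub>R v \<in> S" if "0 \<le> s" "s \<le> h" for s
    using sub[of s h] sub[of s 0] that h by (auto simp: algebra_simps)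
  have "\<exists>s. s > 0 \<and> s < h \<and> \<phi> h - \<phi> 0 = (h - 0) * (g ((p + h *\<^sub>R w) + s *\<^sub>R v) - g (p + s *\<^sub>R v))"
    unfolding \<phi>_def g_def using h m1
    by (intro MVT2 DERIV_diff line S) auto
  then obtain s where s: "s > 0" "s < h" "\<phi> h - \<phi> 0 = h * (g (p + h *\<^sub>R w + s *\<^sub>R v) - g (p + s *\<^sub>R v))"
    by auto
  have m2: "p + s *\<^sub>R v + t *\<^sub>R w \<in> S" if "0 \<le> t" "t \<le> h" for t
    using sub[of s t] s that by auto
  have "\<exists>t. t > 0 \<and> t < h \<and> g (p + s *\<^sub>R v + h *\<^sub>R w) - g (p + s *\<^sub>R v + 0 *\<^sub>R w)
      = (h - 0) * frechet_derivative g (at (p + s *\<^sub>R v + t *\<^sub>R w)) w"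
    using h m2 by (intro MVT2 line g) auto
  then obtain t where t: "t > 0" "t < h"
    "g (p + s *\<^sub>R v + h *\<^sub>R w) - g (p + s *\<^sub>R v) = h * frechet_derivative g (at (p + s *\<^sub>R v + t *\<^sub>R w)) w"
    by auto
  have "f (p + h *\<^sub>R v + h *\<^sub>R w) - f (p + h *\<^sub>R v) - f (p + h *\<^sub>R w) + f p = \<phi> h - \<phi> 0"
    by (simp add: \<phi>_def algebra_simps)
  also have "\<dots> = h * (h * frechet_derivative g (at (p + s *\<^sub>R v + t *\<^sub>R w)) w)"
    using s(3) t(3) by (simp add: algebra_simps)
  finally show ?thesis using s t unfolding g_def
    by (intro exI[of _ s] exI[of _ t]) (simp add: mult.assoc)
qed

text \<open>The second difference is symmetric in \<open>v\<close> and \<open>w\<close>, so the two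
  mixed derivatives take a common value at points as close to \<open>p\<close> as desired;
  continuity moves the equality to \<open>p\<close>.\<close>

lemma frechet_derivative_commute_real:
  fixes f :: "'a::real_normed_vector \<Rightarrow> real"
  assumes S: "smooth_on S f" "open S" "p \<in> S"
  shows "frechet_derivative (\<lambda>x. frechet_derivative f (at x) v) (at p) w
       = frechet_derivative (\<lambda>x. frechet_derivative f (at x) w) (at p) v"
proof -
  define A where "A v w = (\<lambda>q. frechet_derivative (\<lambda>x. frechet_derivative f (at x) v) (at q) w)" for v w
  have cont: "continuous_on S (A v w)" for v w
    unfolding A_def by (intro smooth_on_continuous smooth_on_frechet S)
  have "dist (A v w p) (A w v p) < e" if e: "e > 0" for e
  proof -
    obtain r where r: "r > 0" "ball p r \<subseteq> S" using S open_contains_ball by blast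
    obtain d1 where d1: "d1 > 0" "\<And>q. q \<in> S \<Longrightarrow> dist q p < d1 \<Longrightarrow> dist (A v w q) (A v w p) < e / 2"
      using cont S(3) half_gt_zero[OF e] unfolding continuous_on_iff by blast
    obtain d2 where d2: "d2 > 0" "\<And>q. q \<in> S \<Longrightarrow> dist q p < d2 \<Longrightarrow> dist (A w v q) (A w v p) < e / 2"
      using cont S(3) half_gt_zero[OF e] unfolding continuous_on_iff by blast
    define d where "d = min r (min d1 d2)"
    \<comment> \<open>Small enough to keep the whole parallelogram within distance \<open>d\<close>
      of \<open>p\<close>; the summand 1 covers the case that both vectors vanish.\<close>
    define h where "h = d / (norm v + norm w + 1)"
    have d: "d > 0" "d \<le> r" "d \<le> d1" "d \<le> d2" using r d1 d2 unfolding d_def by auto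
    have pos: "norm v + norm w + 1 > 0" by (smt (verit) norm_ge_zero)
    have h: "h > 0" unfolding h_def using pos d by (simp)
    have close: "dist (p + s *\<^sub>R a + t *\<^sub>R b) p < d"
      if "0 \<le> s" "s \<le> h" "0 \<le> t" "t \<le> h" "{a,b} = {v,w}" for s t a b
    proof -
      have "dist (p + s *\<^sub>R a + t *\<^sub>R b) p = norm (s *\<^sub>R a + t *\<^sub>R b)" by (simp add: dist_norm add.assoc)
      also have "\<dots> \<le> s * norm a + t * norm b"
        using that by (metis abs_of_nonneg norm_scaleR norm_triangle_ineq)
      also have "\<dots> \<le> h * norm a + h * norm b"
        using that by (intro add_mono mult_right_mono) auto
      also have "\<dots> = h * (norm v + norm w)"
        using that(5) by (auto simp: doubleton_eq_iff algebra_simps)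
      also have "\<dots> < h * (norm v + norm w + 1)" using h by simp
      also have "\<dots> = d" using pos by (simp add: h_def)
      finally show ?thesis .
    qed
    then have inS: "p + s *\<^sub>R a + t *\<^sub>R b \<in> S"
      if "0 \<le> s" "s \<le> h" "0 \<le> t" "t \<le> h" "{a,b} = {v,w}" for s t a b
      using close[OF that] d(2) r(2) by (auto simp: dist_commute)
    obtain s t where st: "0 \<le> s" "s \<le> h" "0 \<le> t" "t \<le> h"
      "f (p + h *\<^sub>R v + h *\<^sub>R w) - f (p + h *\<^sub>R v) - f (p + h *\<^sub>R w) + f p = h * h * A v w (p + s *\<^sub>R v + t *\<^sub>R w)"
      unfolding A_def using second_difference_mean_value[OF S(1) h, of p v w] inS by blast
    obtain s' t' where st': "0 \<le> s'" "s' \<le> h" "0 \<le> t'" "t' \<le> h"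
      "f (p + h *\<^sub>R w + h *\<^sub>R v) - f (p + h *\<^sub>R w) - f (p + h *\<^sub>R v) + f p = h * h * A w v (p + s' *\<^sub>R w + t' *\<^sub>R v)"
      unfolding A_def using second_difference_mean_value[OF S(1) h, of p w v] inS by blast
    have "h * h * A v w (p + s *\<^sub>R v + t *\<^sub>R w) = h * h * A w v (p + s' *\<^sub>R w + t' *\<^sub>R v)"
      using st(5) st'(5) by (simp add: algebra_simps)
    then have eq: "A v w (p + s *\<^sub>R v + t *\<^sub>R w) = A w v (p + s' *\<^sub>R w + t' *\<^sub>R v)" using h by simp
    have "dist (A v w (p + s *\<^sub>R v + t *\<^sub>R w)) (A v w p) < e / 2"
      by (rule d1(2)[OF inS[OF st(1-4)] less_le_trans[OF close[OF st(1-4)] d(3)]]) auto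
    moreover have "dist (A w v (p + s' *\<^sub>R w + t' *\<^sub>R v)) (A w v p) < e / 2"
      by (rule d2(2)[OF inS[OF st'(1-4)] less_le_trans[OF close[OF st'(1-4)] d(4)]]) auto
    ultimately show ?thesis
      using dist_triangle_half_r[of "A w v (p + s' *\<^sub>R w + t' *\<^sub>R v)" "A v w p" e "A w v p"] unfolding eq by simp
  qed
  then have "A v w p = A w v p" by (metis dist_pos_lt less_irrefl)
  then show ?thesis by (simp add: A_def)
qed

lemma frechet_derivative_bounded_linear:
  assumes "bounded_linear h" "f differentiable (at x)"
  shows "frechet_derivative (\<lambda>x. h (f x)) (at x) v = h (frechet_derivative f (at x) v)"
  using bounded_linear.has_derivative[OF assms(1), of f "frechet_derivative f (at x)" "at x"] assms(2)
  by (metis frechet_derivative_works frechet_derivative_at)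

lemma smooth_on_differentiable: "smooth_on S f \<Longrightarrow> x \<in> S \<Longrightarrow> f differentiable (at x)"
  using smooth_on_has_derivative differentiable_def by blast

lemma frechet_derivative_cong_open:
  assumes "open S" "x \<in> S" "\<And>y. y \<in> S \<Longrightarrow> f y = g y"
  shows "frechet_derivative f (at x) = frechet_derivative g (at x)"
proof -
  have "(f has_derivative f') (at x) \<longleftrightarrow> (g has_derivative f') (at x)" for f'
    using has_derivative_transform_within_open[of f f' x UNIV S g] has_derivative_transform_within_open[of g f' x UNIV S f] assms by auto
  then show ?thesis unfolding frechet_derivative_def by simp
qed

lemma frechet_derivative_commute:
  fixes f :: "'a::real_normed_vector \<Rightarrow> 'b::euclidean_space"
  assumes S: "smooth_on S f" "open S" "p \<in> S"
  shows "frechet_derivative (\<lambda>x. frechet_derivative f (at x) v) (at p) w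
       = frechet_derivative (\<lambda>x. frechet_derivative f (at x) w) (at p) v"
proof (rule euclidean_eqI)
  fix b :: 'b assume "b \<in> Basis"
  have *: "frechet_derivative (\<lambda>x. frechet_derivative f (at x) v) (at p) w \<bullet> b =
     frechet_derivative (\<lambda>x. frechet_derivative (\<lambda>x. f x \<bullet> b) (at x) v) (at p) w" for v w
  proof -
    have "frechet_derivative (\<lambda>x. frechet_derivative (\<lambda>x. f x \<bullet> b) (at x) v) (at p)
       = frechet_derivative (\<lambda>x. frechet_derivative f (at x) v \<bullet> b) (at p)"
      by (rule frechet_derivative_cong_open[OF S(2,3)])
         (rule frechet_derivative_bounded_linear[OF bounded_linear_inner_left smooth_on_differentiable[OF S(1)]])
    then show ?thesis
      using frechet_derivative_bounded_linear[OF bounded_linear_inner_left[of b] smooth_on_differentiable[OF smooth_on_frechet[OF S(1), of v] S(3)], of w]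
      by simp
  qed
  have "smooth_on S (\<lambda>x. f x \<bullet> b)" by (intro smooth_on_inner S smooth_on_const)
  from frechet_derivative_commute_real[OF this S(2,3)] show
    "frechet_derivative (\<lambda>x. frechet_derivative f (at x) v) (at p) w \<bullet> b
       = frechet_derivative (\<lambda>x. frechet_derivative f (at x) w) (at p) v \<bullet> b"
    by (simp add: *)
qed

section \<open>Smooth families of linear maps and their inverses\<close>

text \<open>Where one factor vanishes, the product rule needs only continuity of the other. This
  gives the derivative of an inverse family before that family is known to be
  differentiable.\<close>

lemma has_derivative_scaleR_null:
  fixes r :: "'a::real_normed_vector \<Rightarrow> real" and m :: "'a \<Rightarrow> 'b::real_normed_vector"
  assumes r: "(r has_derivative r') (at x)" "r x = 0" and m: "isCont m x"
  shows "((\<lambda>y. r y *\<^sub>R m y) has_derivative (\<lambda>w. r' w *\<^sub>R m x)) (at x)"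
proof -
  have "((\<lambda>y. r y *\<^sub>R (m y - m x)) has_derivative (\<lambda>w. 0)) (at x)"
    unfolding has_derivative_at_alt
  proof (intro conjI allI impI)
    fix e :: real assume e: "e > 0"
    obtain K where K: "K > 0" "\<And>w. norm (r' w) \<le> norm w * K"
      using has_derivative_bounded_linear[OF r(1)] bounded_linear.pos_bounded by blast
    obtain d1 where d1: "d1 > 0" "\<And>y. norm (y - x) < d1 \<Longrightarrow> norm (r y - r x - r' (y - x)) \<le> 1 * norm (y - x)"
      using r(1) unfolding has_derivative_at_alt by (metis zero_less_one)
    have "e / (K + 1) > 0" using e K by simp
    then obtain d2 where d2: "d2 > 0" "\<And>y. dist y x < d2 \<Longrightarrow> dist (m y) (m x) < e / (K + 1)"
      using m unfolding continuous_at_eps_delta by blast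
    show "\<exists>d>0. \<forall>y. norm (y - x) < d \<longrightarrow>
       norm (r y *\<^sub>R (m y - m x) - r x *\<^sub>R (m x - m x) - 0) \<le> e * norm (y - x)"
    proof (intro exI[of _ "min d1 d2"] conjI allI impI)
      fix y assume y: "norm (y - x) < min d1 d2"
      have "\<bar>r y\<bar> \<le> norm (r y - r x - r' (y - x)) + norm (r' (y - x))"
        using r(2) norm_triangle_sub[of "r y" "r' (y - x)"] by simp
      also have "\<dots> \<le> (K + 1) * norm (y - x)"
        using d1(2)[of y] y K(2)[of "y - x"] by (simp add: algebra_simps)
      finally have a: "\<bar>r y\<bar> \<le> (K + 1) * norm (y - x)" .
      have b: "norm (m y - m x) \<le> e / (K + 1)"
        using d2(2)[of y] y by (simp add: dist_norm)
      have "norm (r y *\<^sub>R (m y - m x)) \<le> ((K + 1) * norm (y - x)) * (e / (K + 1))"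
        unfolding norm_scaleR by (intro mult_mono a b) (use K in auto)
      also have "\<dots> = e * norm (y - x)" using K by simp
      finally show "norm (r y *\<^sub>R (m y - m x) - r x *\<^sub>R (m x - m x) - 0) \<le> e * norm (y - x)" by simp
    qed (use d1 d2 in auto)
  qed simp
  from has_derivative_add[OF this has_derivative_scaleR_left[OF r(1), of "m x"]]
  show ?thesis by (simp add: algebra_simps)
qed

lemma linear_family_bounded_below:
  fixes L :: "'a::real_normed_vector \<Rightarrow> 'b::euclidean_space \<Rightarrow> 'c::euclidean_space"
  assumes S: "open S" "x \<in> S" and lin: "\<And>y. y \<in> S \<Longrightarrow> linear (L y)"
    and cont: "\<And>v. continuous_on S (\<lambda>y. L y v)" and inj: "inj (L x)"
  obtains c T where "c > 0" "open T" "x \<in> T" "T \<subseteq> S" "\<And>y v. y \<in> T \<Longrightarrow> c * norm v \<le> norm (L y v)"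
proof -
  obtain B where B: "B > 0" "\<And>v. B * norm v \<le> norm (L x v)"
    using linear_inj_bounded_below_pos[OF lin[OF S(2)] inj] by blast
  \<comment> \<open>The errors on the \<open>DIM('b)\<close> basis vectors then add up to at most
    \<open>B / 2\<close> times the norm, half of the lower bound at \<open>x\<close>.\<close>
  define e where "e = B / (2 * DIM('b))"
  have e: "e > 0" using B by (simp add: e_def)
  define T where "T = S \<inter> (\<Inter>b\<in>Basis. {y\<in>S. norm (L y b - L x b) < e})"
  have o: "open {y\<in>S. norm (L y b - L x b) < e}" for b
  proof -
    have "continuous_on S (\<lambda>y. norm (L y b - L x b))" by (intro continuous_intros cont)
    then have "open ((\<lambda>y. norm (L y b - L x b)) -` {..<e} \<inter> S)"
      using continuous_on_open_vimage[OF S(1)] open_lessThan by blast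
    moreover have "(\<lambda>y. norm (L y b - L x b)) -` {..<e} \<inter> S = {y\<in>S. norm (L y b - L x b) < e}" by auto
    ultimately show ?thesis by simp
  qed
  have "B / 2 * norm v \<le> norm (L y v)" if "y \<in> T" for y v
  proof -
    have y: "y \<in> S" "\<And>b. b \<in> Basis \<Longrightarrow> norm (L y b - L x b) < e" using that by (auto simp: T_def)
    have "L y v - L x v = (\<Sum>b\<in>Basis. (v \<bullet> b) *\<^sub>R (L y b - L x b))"
      using linear_euclidean[OF lin[OF y(1)], of v] linear_euclidean[OF lin[OF S(2)], of v]
      by (simp add: scaleR_right_diff_distrib sum_subtractf)
    then have "norm (L y v - L x v) \<le> (\<Sum>b\<in>Basis. norm ((v \<bullet> b) *\<^sub>R (L y b - L x b)))"
      using norm_sum by metis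
    also have "\<dots> \<le> (\<Sum>b\<in>(Basis::'b set). norm v * e)"
    proof (rule sum_mono)
      fix b :: 'b assume b: "b \<in> Basis"
      show "norm ((v \<bullet> b) *\<^sub>R (L y b - L x b)) \<le> norm v * e"
        unfolding norm_scaleR
        using Basis_le_norm[OF b, of v] y(2)[OF b] by (intro mult_mono) auto
    qed
    also have "\<dots> = B / 2 * norm v" by (simp add: e_def)
    finally have "norm (L y v - L x v) \<le> B / 2 * norm v" .
    then show ?thesis using B(2)[of v] norm_triangle_ineq2[of "L x v" "L y v"]
by (simp add: norm_minus_commute)
  qed
  moreover have "open T" unfolding T_def by (intro open_Int S open_INT ballI o finite_Basis)
  moreover have "x \<in> T" "T \<subseteq> S" using S e by (auto simp: T_def)
  ultimately show ?thesis using that[of "B/2" T] B(1) half_gt_zero by blast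
qed

lemma linear_family_bij_open:
  fixes L :: "'a::real_normed_vector \<Rightarrow> 'b::euclidean_space \<Rightarrow> 'b"
  assumes "open S" "x \<in> S" "\<And>y. y \<in> S \<Longrightarrow> linear (L y)"
    and "\<And>v. continuous_on S (\<lambda>y. L y v)" and "inj (L x)"
  obtains T where "open T" "x \<in> T" "T \<subseteq> S" "\<And>y. y \<in> T \<Longrightarrow> bij (L y)"
proof -
  obtain c T where T: "c > 0" "open T" "x \<in> T" "T \<subseteq> S" "\<And>y v. y \<in> T \<Longrightarrow> c * norm v \<le> norm (L y v)"
    using linear_family_bounded_below[OF assms] by metis
  have "bij (L y)" if "y \<in> T" for y
  proof -
    have l: "linear (L y)" using assms(3) T that by blast
    have "v = 0" if "L y v = 0" for v
      using T(5)[OF \<open>y \<in> T\<close>, of v] T(1) that by (simp add: mult_le_0_iff)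
    then have "inj (L y)" using l by (simp add: linear_injective_0)
    then show ?thesis using l by (simp add: bij_def linear_injective_imp_surjective)
  qed
  then show ?thesis using that T by blast
qed

lemma linear_inv: "linear f \<Longrightarrow> bij f \<Longrightarrow> linear (inv f)" for f :: "'b::real_vector \<Rightarrow> 'c::real_vector"
proof -
  assume f: "linear f" "bij f"
  have *: "f (inv f y) = y" "inv f (f x) = x" for x y
    using f(2) by (auto simp: bij_def surj_f_inv_f)
  show "linear (inv f)"
  proof (rule linearI)
    show "inv f (x + y) = inv f x + inv f y" for x y
      using *(2)[of "inv f x + inv f y"] by (simp add: linear_add[OF f(1)] *(1))
    show "inv f (r *\<^sub>R x) = r *\<^sub>R inv f x" for r x
      using *(2)[of "r *\<^sub>R inv f x"] by (simp add: linear_cmul[OF f(1)] *(1))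
  qed
qed

lemma has_derivative_apply:
  fixes f :: "'a::real_normed_vector \<Rightarrow> 'b::euclidean_space" and L :: "'a \<Rightarrow> 'b \<Rightarrow> 'c::real_normed_vector"
  assumes S: "open S" "x \<in> S" and lin: "\<And>y. y \<in> S \<Longrightarrow> linear (L y)"
    and L: "\<And>v. smooth_on S (\<lambda>y. L y v)" and f: "(f has_derivative f') (at x)"
  shows "((\<lambda>y. L y (f y)) has_derivative
      (\<lambda>w. frechet_derivative (\<lambda>y. L y (f x)) (at x) w + L x (f' w))) (at x)"
proof -
  have d: "((\<lambda>y. L y (f y)) has_derivative (\<lambda>w. (\<Sum>b\<in>Basis. (f x \<bullet> b) *\<^sub>R frechet_derivative (\<lambda>y. L y b) (at x) w)
     + L x (f' w))) (at x)" if f: "(f has_derivative f') (at x)" for f f'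
  proof (rule has_derivative_transform_within_open[OF _ S])
    show "(\<Sum>b\<in>Basis. (f y \<bullet> b) *\<^sub>R L y b) = L y (f y)" if "y \<in> S" for y
      using linear_euclidean[OF lin[OF that], of "f y"] by simp
    have "((\<lambda>y. \<Sum>b\<in>Basis. (f y \<bullet> b) *\<^sub>R L y b) has_derivative
       (\<lambda>w. \<Sum>b\<in>Basis. (f x \<bullet> b) *\<^sub>R frechet_derivative (\<lambda>y. L y b) (at x) w + (f' w \<bullet> b) *\<^sub>R L x b)) (at x)"
      by (intro has_derivative_sum has_derivative_scaleR has_derivative_inner_left f
          smooth_on_has_derivative[OF L S(2)])
    then show "((\<lambda>y. \<Sum>b\<in>Basis. (f y \<bullet> b) *\<^sub>R L y b) has_derivative
       (\<lambda>w. (\<Sum>b\<in>Basis. (f x \<bullet> b) *\<^sub>R frechet_derivative (\<lambda>y. L y b) (at x) w) + L x (f' w))) (at x)"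
      by (simp add: sum.distrib linear_euclidean[OF lin[OF S(2)], of "f' _"])
  qed
  have "frechet_derivative (\<lambda>y. L y (f x)) (at x) = (\<lambda>w. (\<Sum>b\<in>Basis. (f x \<bullet> b) *\<^sub>R frechet_derivative (\<lambda>y. L y b) (at x) w))"
    using d[of "\<lambda>_. f x", OF has_derivative_const] linear_0[OF lin[OF S(2)]]
    by (metis (no_types, lifting) add.right_neutral ext frechet_derivative_at)
  with d[OF f] show ?thesis by simp
qed

lemma linear_frechet_family:
  fixes L :: "'a::real_normed_vector \<Rightarrow> 'b::euclidean_space \<Rightarrow> 'c::real_normed_vector"
  assumes S: "open S" "x \<in> S" and lin: "\<And>y. y \<in> S \<Longrightarrow> linear (L y)"
    and L: "\<And>v. smooth_on S (\<lambda>y. L y v)"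
  shows "linear (\<lambda>v. frechet_derivative (\<lambda>y. L y v) (at x) w)"
proof (rule linearI)
  have D: "((\<lambda>y. L y v) has_derivative frechet_derivative (\<lambda>y. L y v) (at x)) (at x)" for v
    by (rule smooth_on_has_derivative[OF L S(2)])
  fix u v :: 'b and c :: real
  have "((\<lambda>y. L y (u + v)) has_derivative (\<lambda>w. frechet_derivative (\<lambda>y. L y u) (at x) w + frechet_derivative (\<lambda>y. L y v) (at x) w)) (at x)"
    by (rule has_derivative_transform_within_open[OF has_derivative_add[OF D D] S]) (simp add: linear_add lin)
  then show "frechet_derivative (\<lambda>y. L y (u + v)) (at x) w = frechet_derivative (\<lambda>y. L y u) (at x) w + frechet_derivative (\<lambda>y. L y v) (at x) w"
    by (metis frechet_derivative_at)
  have "((\<lambda>y. L y (c *\<^sub>R v)) has_derivative (\<lambda>w. c *\<^sub>R frechet_derivative (\<lambda>y. L y v) (at x) w)) (at x)"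
    by (rule has_derivative_transform_within_open[OF has_derivative_scaleR_right[OF D] S]) (simp add: linear_cmul lin)
  then show "frechet_derivative (\<lambda>y. L y (c *\<^sub>R v)) (at x) w = c *\<^sub>R frechet_derivative (\<lambda>y. L y v) (at x) w"
    by (metis frechet_derivative_at)
qed

text \<open>Continuity of the inverse comes from the local lower bound. With
  \<open>z = inv (L x) v\<close>, the identity
  \<open>inv (L y) v = z + inv (L y) (v - L y z)\<close> has a factor that vanishes at
  \<open>x\<close>, so continuity already yields the derivative. This derivative is polynomial in
  the inverse and in the derivatives of \<open>L\<close>, and regularity follows by
  induction.\<close>

lemma smooth_on_inv_family:
  fixes L :: "'a::real_normed_vector \<Rightarrow> 'b::euclidean_space \<Rightarrow> 'c::euclidean_space"
  assumes S: "open S" and lin: "\<And>y. y \<in> S \<Longrightarrow> linear (L y)" and bij: "\<And>y. y \<in> S \<Longrightarrow> bij (L y)"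
    and L: "\<And>v. smooth_on S (\<lambda>y. L y v)"
  shows "smooth_on S (\<lambda>y. inv (L y) v)"
proof -
  have linv: "linear (inv (L y))" if "y \<in> S" for y using lin bij that by (simp add: linear_inv)
  have inv1: "L y (inv (L y) u) = u" "inv (L y) (L y z) = z" if "y \<in> S" for y u z
    using bij[OF that] by (auto simp: bij_def surj_f_inv_f)
  have cont: "continuous_on S (\<lambda>y. inv (L y) v)" for v
  proof (rule continuous_at_imp_continuous_on, rule ballI)
    fix x assume x: "x \<in> S"
    have "inj (L x)" using bij[OF x] by (simp add: bij_def)
    then obtain c T where T: "c > 0" "open T" "x \<in> T" "T \<subseteq> S" "\<And>y v. y \<in> T \<Longrightarrow> c * norm v \<le> norm (L y v)"
      using linear_family_bounded_below[OF S x lin smooth_on_continuous[OF L]] by metis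
    define z where "z = inv (L x) v"
    have "((\<lambda>y. L y z) \<longlongrightarrow> L x z) (at x)"
      using smooth_on_continuous[OF L, of z] S x by (metis continuous_on_eq_continuous_at isCont_def)
    then have lim: "((\<lambda>y. inverse c * norm (v - L y z)) \<longlongrightarrow> inverse c * norm (v - L x z)) (at x)"
      by (intro tendsto_intros)
    have "((\<lambda>y. inv (L y) v - z) \<longlongrightarrow> 0) (at x)"
    proof (rule Lim_null_comparison)
      show "((\<lambda>y. inverse c * norm (v - L y z)) \<longlongrightarrow> 0) (at x)"
        using lim inv1(1)[OF x] by (simp add: z_def)
      show "\<forall>\<^sub>F y in at x. norm (inv (L y) v - z) \<le> inverse c * norm (v - L y z)"
        using eventually_at_in_open'[OF T(2,3)]
      proof eventually_elim
        case (elim y)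
        then have y: "y \<in> S" using T by auto
        have "L y (inv (L y) v - z) = v - L y z"
          using linear_diff[OF lin[OF y]] inv1(1)[OF y] by simp
        then have "c * norm (inv (L y) v - z) \<le> norm (v - L y z)" using T(5)[OF elim, of "inv (L y) v - z"] by simp
        then show ?case using T(1) by (simp add: field_simps)
      qed
    qed
    then show "isCont (\<lambda>y. inv (L y) v) x" by (simp add: isCont_def z_def LIM_zero_iff)
  qed
  define L' where "L' x b w = frechet_derivative (\<lambda>y. L y b) (at x) w" for x b w
  have der: "((\<lambda>y. inv (L y) v) has_derivative
      (\<lambda>w. - (\<Sum>b\<in>Basis. \<Sum>c\<in>Basis. ((inv (L x) v \<bullet> b) * (L' x b w \<bullet> c)) *\<^sub>R inv (L x) c))) (at x)" if x: "x \<in> S" for x v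
  proof -
    define z where "z = inv (L x) v"
    define h where "h y = v - L y z" for y
    have h: "(h has_derivative (\<lambda>w. - L' x z w)) (at x)" unfolding h_def L'_def
      using has_derivative_diff[OF has_derivative_const smooth_on_has_derivative[OF L x]] by simp
    have h0: "h x = 0" using inv1(1)[OF x] by (simp add: h_def z_def)
    have "((\<lambda>y. z + (\<Sum>c\<in>Basis. (h y \<bullet> c) *\<^sub>R inv (L y) c)) has_derivative
        (\<lambda>w. 0 + (\<Sum>c\<in>Basis. (- L' x z w \<bullet> c) *\<^sub>R inv (L x) c))) (at x)"
      using cont S x h0
      by (intro has_derivative_add has_derivative_const has_derivative_sum has_derivative_scaleR_null
            has_derivative_inner_left h) (auto simp: continuous_on_eq_continuous_at)
    moreover have "z + (\<Sum>c\<in>Basis. (h y \<bullet> c) *\<^sub>R inv (L y) c) = inv (L y) v" if "y \<in> S" for y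
    proof -
      have "(\<Sum>c\<in>Basis. (h y \<bullet> c) *\<^sub>R inv (L y) c) = inv (L y) (h y)"
        using linear_euclidean[OF linv[OF that], of "h y"] by simp
      also have "\<dots> = inv (L y) v - z" unfolding h_def using linear_diff[OF linv[OF that]] inv1(2)[OF that] by simp
      finally show ?thesis by simp
    qed
    ultimately have *: "((\<lambda>y. inv (L y) v) has_derivative
        (\<lambda>w. 0 + (\<Sum>c\<in>Basis. (- L' x z w \<bullet> c) *\<^sub>R inv (L x) c))) (at x)"
      by (rule has_derivative_transform_within_open[OF _ S x])
    have "L' x z w = (\<Sum>b\<in>Basis. (z \<bullet> b) *\<^sub>R L' x b w)" for w
      using linear_euclidean[OF linear_frechet_family[OF S x lin L], where v = z] unfolding L'_def by blast
    then have "(\<lambda>w. 0 + (\<Sum>c\<in>Basis. (- L' x z w \<bullet> c) *\<^sub>R inv (L x) c)) =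
        (\<lambda>w. - (\<Sum>b\<in>Basis. \<Sum>c\<in>Basis. ((z \<bullet> b) * (L' x b w \<bullet> c)) *\<^sub>R inv (L x) c))"
      by (subst sum.swap) (simp add: inner_sum_left scaleR_sum_left sum_negf)
    with * show ?thesis by (simp add: z_def)
  qed
  have "Ck_on k S (\<lambda>y. inv (L y) v)" for k
  proof (induction k arbitrary: v)
    case 0
    then show ?case using cont by simp
  next
    case (Suc k)
    have "Ck_on k S (\<lambda>x. L' x b w)" for b w
      using smooth_on_frechet[OF L] unfolding L'_def smooth_on_def by blast
    then have "Ck_on k S (\<lambda>x. \<Sum>b\<in>Basis. \<Sum>c\<in>Basis. ((inv (L x) v \<bullet> b) * (L' x b w \<bullet> c)) *\<^sub>R inv (L x) c)" for w
      using Suc by (intro Ck_on_sum S Ck_on_bilinear[OF bounded_bilinear_scaleR] Ck_on_bilinear[OF bounded_bilinear_mult]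
          Ck_on_bilinear[OF bounded_bilinear_inner] Ck_on_const)
    then have "Ck_on k S (\<lambda>x. - (\<Sum>b\<in>Basis. \<Sum>c\<in>Basis. ((inv (L x) v \<bullet> b) * (L' x b w \<bullet> c)) *\<^sub>R inv (L x) c))" for w
      by (rule Ck_on_bounded_linear[OF bounded_linear_minus[OF bounded_linear_ident] S])
    then show ?case by (intro Ck_on_SucI[OF S der])
  qed
  then show ?thesis by (simp add: smooth_on_def)
qed

section \<open>Changes of charts\<close>

text \<open>Indexed by the point of the manifold and not by its coordinates, so that the cocycle
  rule \<open>jac_compose\<close> involves a single point.\<close>

definition jac :: "('m, 'e::euclidean_space) chart \<Rightarrow> ('m, 'e) chart \<Rightarrow> 'm \<Rightarrow> 'e \<Rightarrow> 'e" where
  "jac c c' x = frechet_derivative (snd c' \<circ> chart_inv c) (at (snd c x))"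

definition ext_deriv_flat :: "('e::real_normed_vector \<Rightarrow> 'e \<Rightarrow> 'b::real_normed_vector) \<Rightarrow> 'e \<Rightarrow> 'e \<Rightarrow> 'e \<Rightarrow> 'b" where
  "ext_deriv_flat a p X Y =
     frechet_derivative (\<lambda>y. a y Y) (at p) X - frechet_derivative (\<lambda>y. a y X) (at p) Y"

locale smooth_manifold =
  fixes \<A> :: "('m::topological_space, 'e::euclidean_space) chart set"
  assumes atlas: "smooth_atlas \<A>"
begin

lemma chart_at: "chart_at \<A> x \<in> \<A>" "x \<in> fst (chart_at \<A> x)"
proof -
  have "\<exists>c. c \<in> \<A> \<and> x \<in> fst c" using atlas unfolding smooth_atlas_def by blast
  from someI_ex[OF this] show "chart_at \<A> x \<in> \<A>" "x \<in> fst (chart_at \<A> x)"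
    unfolding chart_at_def by auto
qed

lemma open_chart: "c \<in> \<A> \<Longrightarrow> open (fst c)"
  and open_chart_image: "c \<in> \<A> \<Longrightarrow> open (snd c ` fst c)"
  and chart_homeomorphism: "c \<in> \<A> \<Longrightarrow> homeomorphism (fst c) (snd c ` fst c) (snd c) (chart_inv c)"
  and smooth_transition: "c \<in> \<A> \<Longrightarrow> c' \<in> \<A> \<Longrightarrow> smooth_on (snd c ` (fst c \<inter> fst c')) (snd c' \<circ> chart_inv c)"
  using atlas unfolding smooth_atlas_def by auto

lemma chart_inv_chart: "c \<in> \<A> \<Longrightarrow> x \<in> fst c \<Longrightarrow> chart_inv c (snd c x) = x"
  using homeomorphism_apply1[OF chart_homeomorphism] .

lemma open_image_chart:
  assumes "c \<in> \<A>" "open U" shows "open (snd c ` (U \<inter> fst c))"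
proof -
  have "openin (top_of_set (snd c ` fst c)) (snd c ` (U \<inter> fst c))"
    using assms open_chart[OF assms(1)]
    by (intro homeomorphism_imp_open_map[OF chart_homeomorphism[OF assms(1)]]) (auto simp: openin_open)
  then show ?thesis using open_chart_image[OF assms(1)] openin_open_trans by blast
qed

lemma open_image_chart_subset: "c \<in> \<A> \<Longrightarrow> open U \<Longrightarrow> U \<subseteq> fst c \<Longrightarrow> open (snd c ` U)"
  using open_image_chart[of c U] by (simp add: Int_absorb2)

lemma open_chart_preimage:
  assumes "c \<in> \<A>" "open T" shows "open {x \<in> fst c. snd c x \<in> T}"
proof -
  have "continuous_on (fst c) (snd c)" using chart_homeomorphism[OF assms(1)] by (simp add: homeomorphism_def)
  then have "open (snd c -` T \<inter> fst c)"
    using continuous_on_open_vimage[OF open_chart[OF assms(1)]] assms(2) by blast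
  moreover have "snd c -` T \<inter> fst c = {x \<in> fst c. snd c x \<in> T}" by auto
  ultimately show ?thesis by simp
qed

lemma jac_derivative:
  assumes "c \<in> \<A>" "c' \<in> \<A>" "x \<in> fst c" "x \<in> fst c'"
  shows "((snd c' \<circ> chart_inv c) has_derivative jac c c' x) (at (snd c x))"
  unfolding jac_def
  by (rule smooth_on_has_derivative[OF smooth_transition[OF assms(1,2)]]) (use assms in auto)

lemma linear_jac:
  "c \<in> \<A> \<Longrightarrow> c' \<in> \<A> \<Longrightarrow> x \<in> fst c \<Longrightarrow> x \<in> fst c' \<Longrightarrow> linear (jac c c' x)"
  using jac_derivative has_derivative_linear by blast

lemma jac_compose:
  assumes "c \<in> \<A>" "c' \<in> \<A>" "c'' \<in> \<A>" "x \<in> fst c" "x \<in> fst c'" "x \<in> fst c''"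
  shows "jac c' c'' x (jac c c' x v) = jac c c'' x v"
proof -
  have e: "(snd c' \<circ> chart_inv c) (snd c x) = snd c' x"
    using chart_inv_chart[OF assms(1,4)] by simp
  have "(((snd c'' \<circ> chart_inv c') \<circ> (snd c' \<circ> chart_inv c)) has_derivative (jac c' c'' x \<circ> jac c c' x)) (at (snd c x))"
    by (rule diff_chain_at[OF jac_derivative]) (use assms e jac_derivative[of c' c'' x] in simp_all)
  then have "((snd c'' \<circ> chart_inv c) has_derivative (jac c' c'' x \<circ> jac c c' x)) (at (snd c x))"
  proof (rule has_derivative_transform_within_open)
    show "open (snd c ` (fst c' \<inter> fst c))" by (rule open_image_chart[OF assms(1) open_chart[OF assms(2)]])
    show "snd c x \<in> snd c ` (fst c' \<inter> fst c)" using assms by auto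
    fix y assume "y \<in> snd c ` (fst c' \<inter> fst c)"
    then show "((snd c'' \<circ> chart_inv c') \<circ> (snd c' \<circ> chart_inv c)) y = (snd c'' \<circ> chart_inv c) y"
      using chart_inv_chart[OF assms(1)] chart_inv_chart[OF assms(2)] by auto
  qed
  then have "jac c c'' x = jac c' c'' x \<circ> jac c c' x"
    unfolding jac_def[of c c''] by (metis frechet_derivative_at)
  then show ?thesis by simp
qed

lemma jac_self:
  assumes "c \<in> \<A>" "x \<in> fst c" shows "jac c c x v = v"
proof -
  have "((snd c \<circ> chart_inv c) has_derivative (\<lambda>v. v)) (at (snd c x))"
    by (rule has_derivative_transform_within_open[OF has_derivative_ident open_chart_image[OF assms(1)]])
       (use assms chart_inv_chart[OF assms(1)] in auto)
  then have "jac c c x = (\<lambda>v. v)" unfolding jac_def by (metis frechet_derivative_at)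
  then show ?thesis by simp
qed

lemma jac_inverse:
  assumes "c \<in> \<A>" "c' \<in> \<A>" "x \<in> fst c" "x \<in> fst c'"
  shows "jac c' c x (jac c c' x v) = v"
  using jac_compose[OF assms(1,2,1,3,4,3)] jac_self[OF assms(1,3)] by simp

lemma smooth_jac:
  assumes "c \<in> \<A>" "c' \<in> \<A>"
  shows "smooth_on (snd c ` (fst c \<inter> fst c')) (\<lambda>y. jac c c' (chart_inv c y) v)"
proof -
  have "smooth_on (snd c ` (fst c \<inter> fst c')) (\<lambda>y. frechet_derivative (snd c' \<circ> chart_inv c) (at y) v)"
    by (intro smooth_on_frechet smooth_transition assms)
  moreover have "open (snd c ` (fst c \<inter> fst c'))"
    using open_image_chart[OF assms(1) open_chart[OF assms(2)]] by (simp add: Int_commute)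
  moreover have "frechet_derivative (snd c' \<circ> chart_inv c) (at y) v = jac c c' (chart_inv c y) v"
    if "y \<in> snd c ` (fst c \<inter> fst c')" for y
    using that chart_inv_chart[OF assms(1)] by (auto simp: jac_def)
  ultimately show ?thesis using smooth_on_cong by (metis (no_types, lifting))
qed

lemma to_chart_jac: "to_chart \<A> c x = jac (chart_at \<A> x) c x"
  and from_chart_jac: "from_chart \<A> c x = jac c (chart_at \<A> x) x"
  by (simp_all add: to_chart_def from_chart_def jac_def)

lemma to_from_chart [simp]:
  "c \<in> \<A> \<Longrightarrow> x \<in> fst c \<Longrightarrow> to_chart \<A> c x (from_chart \<A> c x v) = v"
  "c \<in> \<A> \<Longrightarrow> x \<in> fst c \<Longrightarrow> from_chart \<A> c x (to_chart \<A> c x v) = v"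
  unfolding to_chart_jac from_chart_jac using jac_inverse chart_at by blast+

lemma linear_to_chart: "c \<in> \<A> \<Longrightarrow> x \<in> fst c \<Longrightarrow> linear (to_chart \<A> c x)"
  and linear_from_chart: "c \<in> \<A> \<Longrightarrow> x \<in> fst c \<Longrightarrow> linear (from_chart \<A> c x)"
  unfolding to_chart_jac from_chart_jac using linear_jac chart_at by blast+

lemma to_chart_change:
  "c \<in> \<A> \<Longrightarrow> c' \<in> \<A> \<Longrightarrow> x \<in> fst c \<Longrightarrow> x \<in> fst c' \<Longrightarrow> to_chart \<A> c' x X = jac c c' x (to_chart \<A> c x X)"
  unfolding to_chart_jac using jac_compose chart_at by metis

lemma from_chart_change:
  "c \<in> \<A> \<Longrightarrow> c' \<in> \<A> \<Longrightarrow> x \<in> fst c \<Longrightarrow> x \<in> fst c' \<Longrightarrow> from_chart \<A> c' x v = from_chart \<A> c x (jac c' c x v)"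
  unfolding from_chart_jac using jac_compose chart_at by metis

text \<open>The components in two charts differ by the smooth Jacobian of the transition, so one
  chart containing \<open>U\<close> decides.\<close>

lemma smooth_vector_field_chartI:
  assumes c: "c \<in> \<A>" and U: "open U" "U \<subseteq> fst c"
    and X: "smooth_on (snd c ` U) (\<lambda>y. to_chart \<A> c (chart_inv c y) (X (chart_inv c y)))"
  shows "smooth_vector_field \<A> U X"
  unfolding smooth_vector_field_def
proof
  fix c' assume c': "c' \<in> \<A>"
  let ?S = "snd c' ` (U \<inter> fst c')" and ?T = "snd c ` (U \<inter> fst c')" and ?\<tau> = "snd c \<circ> chart_inv c'"
  have oS: "open ?S" by (rule open_image_chart[OF c' U(1)])
  have oT: "open ?T"
    by (rule open_image_chart_subset[OF c]) (use U open_chart[OF c'] in auto)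
  have "smooth_on ?T (\<lambda>y. jac c c' (chart_inv c y) (to_chart \<A> c (chart_inv c y) (X (chart_inv c y))))"
  proof (rule smooth_on_apply[OF oT, where L = "\<lambda>y. jac c c' (chart_inv c y)"])
    fix y assume "y \<in> ?T"
    then obtain x where "x \<in> U" "x \<in> fst c'" "y = snd c x" by auto
    then show "linear (jac c c' (chart_inv c y))"
      using U chart_inv_chart[OF c, of x] linear_jac[OF c c', of x] by auto
  next
    show "smooth_on ?T (\<lambda>y. jac c c' (chart_inv c y) v)" for v
      by (rule smooth_on_subset[OF smooth_jac[OF c c']]) (use U in auto)
    show "smooth_on ?T (\<lambda>y. to_chart \<A> c (chart_inv c y) (X (chart_inv c y)))"
      by (rule smooth_on_subset[OF X]) auto
  qed
  moreover have "smooth_on ?S ?\<tau>"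
    by (rule smooth_on_subset[OF smooth_transition[OF c' c]]) (use U in auto)
  moreover have "?\<tau> ` ?S \<subseteq> ?T" using chart_inv_chart[OF c'] by auto
  ultimately have "smooth_on ?S (\<lambda>y. jac c c' (chart_inv c (?\<tau> y)) (to_chart \<A> c (chart_inv c (?\<tau> y)) (X (chart_inv c (?\<tau> y)))))"
    using smooth_on_compose[OF oS] by blast
  moreover have "jac c c' (chart_inv c (?\<tau> y)) (to_chart \<A> c (chart_inv c (?\<tau> y)) (X (chart_inv c (?\<tau> y))))
     = to_chart \<A> c' (chart_inv c' y) (X (chart_inv c' y))" if "y \<in> ?S" for y
  proof -
    obtain x where x: "x \<in> U" "x \<in> fst c'" "y = snd c' x" using \<open>y \<in> ?S\<close> by auto
    then have "x \<in> fst c" using U by auto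
    then show ?thesis using x chart_inv_chart[OF c'] chart_inv_chart[OF c] to_chart_change[OF c c'] by simp
  qed
  ultimately show "smooth_on ?S (\<lambda>y. to_chart \<A> c' (chart_inv c' y) (X (chart_inv c' y)))"
    using smooth_on_cong[OF oS] by (metis (no_types, lifting))
qed

lemma form_in_chart_change:
  assumes "c \<in> \<A>" "c' \<in> \<A>" "y \<in> snd c ` (fst c \<inter> fst c')"
  shows "form_in_chart \<A> c \<alpha> y v
    = form_in_chart \<A> c' \<alpha> ((snd c' \<circ> chart_inv c) y) (frechet_derivative (snd c' \<circ> chart_inv c) (at y) v)"
proof -
  obtain x where x: "x \<in> fst c" "x \<in> fst c'" "y = snd c x" using assms(3) by auto
  then show ?thesis
    using chart_inv_chart assms(1,2) from_chart_change[OF assms(2,1), of x v]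
    by (simp add: form_in_chart_def jac_def)
qed

lemma linear_form_in_chart:
  assumes "smooth_one_form \<A> U \<alpha>" "c \<in> \<A>" "y \<in> snd c ` (U \<inter> fst c)"
  shows "linear (form_in_chart \<A> c \<alpha> y)"
proof -
  obtain x where x: "x \<in> U" "x \<in> fst c" "y = snd c x" using assms(3) by auto
  then show ?thesis
    using linear_compose[OF linear_from_chart[OF assms(2) x(2)], of "\<alpha> x"] assms(1) chart_inv_chart[OF assms(2) x(2)]
    unfolding smooth_one_form_def form_in_chart_def[abs_def] by (simp add: o_def)
qed

text \<open>The terms with second derivatives of the transition map cancel by symmetry.\<close>
lemma ext_deriv_chart:
  fixes \<alpha> :: "'m \<Rightarrow> 'e \<Rightarrow> 'b::real_normed_vector"
  assumes \<alpha>: "smooth_one_form \<A> U \<alpha>" and U: "open U" "x \<in> U" and c: "c \<in> \<A>" "x \<in> fst c"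
  shows "ext_deriv \<A> \<alpha> x X Y =
    ext_deriv_flat (form_in_chart \<A> c \<alpha>) (snd c x) (to_chart \<A> c x X) (to_chart \<A> c x Y)"
proof -
  let ?c0 = "chart_at \<A> x"
  let ?p = "snd ?c0 x" and ?\<tau> = "snd c \<circ> chart_inv ?c0"
  let ?S = "snd ?c0 ` (fst ?c0 \<inter> fst c)" and ?a = "form_in_chart \<A> c \<alpha>"
  have c0: "?c0 \<in> \<A>" "x \<in> fst ?c0" by (rule chart_at)+
  have oS: "open ?S" using open_image_chart[OF c0(1) open_chart[OF c(1)]] by (simp add: Int_commute)
  have pS: "?p \<in> ?S" using c c0 by auto
  have q: "?\<tau> ?p = snd c x" using chart_inv_chart[OF c0] by simp
  define T where "T = snd c ` (U \<inter> fst c)"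
  have T: "open T" "snd c x \<in> T" unfolding T_def using open_image_chart[OF c(1) U(1)] U c by auto
  have lina: "linear (?a y)" if "y \<in> T" for y using linear_form_in_chart[OF \<alpha> c(1)] that by (simp add: T_def)
  have sa: "smooth_on T (\<lambda>y. ?a y v)" for v using \<alpha> c unfolding smooth_one_form_def T_def by blast
  define J where "J = (\<lambda>y. frechet_derivative ?\<tau> (at y))"
  have \<tau>d: "(?\<tau> has_derivative J ?p) (at ?p)"
    unfolding J_def by (rule smooth_on_has_derivative[OF smooth_transition[OF c0(1) c(1)] pS])
  have Jx: "J ?p v = to_chart \<A> c x v" for v by (simp add: J_def to_chart_jac jac_def)
  have e: "frechet_derivative (\<lambda>y. form_in_chart \<A> ?c0 \<alpha> y Y) (at ?p) X =
      frechet_derivative (\<lambda>y. ?a y (J ?p Y)) (at (snd c x)) (J ?p X)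
      + ?a (snd c x) (frechet_derivative (\<lambda>y. J y Y) (at ?p) X)" for X Y
  proof -
    have Jd: "((\<lambda>y. J y Y) has_derivative frechet_derivative (\<lambda>y. J y Y) (at ?p)) (at ?p)"
      unfolding J_def
      by (rule smooth_on_has_derivative[OF smooth_on_frechet[OF smooth_transition[OF c0(1) c(1)]] pS])
    \<comment> \<open>The form becomes a function of pairs (point, vector); the chain rule along
      \<open>y \<mapsto> (\<tau> y, J y Y)\<close> then produces the first-order and the
      second-order term together.\<close>
    have sf: "smooth_on (T \<times> UNIV) (\<lambda>z::'e \<times> 'e. ?a (fst z) v)" for v
    proof -
      have o: "open (T \<times> (UNIV :: 'e set))" using T by (simp add: open_Times)
      show ?thesis by (rule smooth_on_compose[OF o smooth_on_fst[OF o smooth_on_ident[OF o]] sa]) auto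
    qed
    have "((\<lambda>z. ?a (fst z) (snd z)) has_derivative
       (\<lambda>w. frechet_derivative (\<lambda>z. ?a (fst z) (J ?p Y)) (at (snd c x, J ?p Y)) w + ?a (snd c x) (snd w))) (at (snd c x, J ?p Y))"
      using has_derivative_apply[of "T \<times> UNIV" "(snd c x, J ?p Y)" "\<lambda>z. ?a (fst z)" snd snd,
          OF _ _ _ sf has_derivative_snd[OF has_derivative_ident]] T lina
      by (auto simp: open_Times)
    moreover have "((\<lambda>z. ?a (fst z) (J ?p Y)) has_derivative
        (\<lambda>w. frechet_derivative (\<lambda>y. ?a y (J ?p Y)) (at (snd c x)) (fst w))) (at (snd c x, J ?p Y))"
      by (rule has_derivative_compose[OF has_derivative_fst[OF has_derivative_ident]])
         (use smooth_on_has_derivative[OF sa T(2)] in simp)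
    ultimately have "((\<lambda>z. ?a (fst z) (snd z)) has_derivative
       (\<lambda>w. frechet_derivative (\<lambda>y. ?a y (J ?p Y)) (at (snd c x)) (fst w) + ?a (snd c x) (snd w))) (at (?\<tau> ?p, J ?p Y))"
      using q by (metis (no_types, lifting) ext frechet_derivative_at)
    from has_derivative_compose[OF has_derivative_Pair[OF \<tau>d Jd] this]
    have "((\<lambda>y. ?a (?\<tau> y) (J y Y)) has_derivative (\<lambda>w. frechet_derivative (\<lambda>y. ?a y (J ?p Y)) (at (snd c x)) (J ?p w)
        + ?a (snd c x) (frechet_derivative (\<lambda>y. J y Y) (at ?p) w))) (at ?p)"
      by simp
    then have "((\<lambda>y. form_in_chart \<A> ?c0 \<alpha> y Y) has_derivative (\<lambda>w. frechet_derivative (\<lambda>y. ?a y (J ?p Y)) (at (snd c x)) (J ?p w)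
        + ?a (snd c x) (frechet_derivative (\<lambda>y. J y Y) (at ?p) w))) (at ?p)"
      by (rule has_derivative_transform_within_open[OF _ oS pS])
         (simp add: form_in_chart_change[OF c0(1) c(1)] J_def)
    then show ?thesis by (metis (no_types, lifting) frechet_derivative_at)
  qed
  have "frechet_derivative (\<lambda>y. J y Y) (at ?p) X = frechet_derivative (\<lambda>y. J y X) (at ?p) Y"
    unfolding J_def by (rule frechet_derivative_commute[OF smooth_transition[OF c0(1) c(1)] oS pS])
  then show ?thesis unfolding ext_deriv_def ext_deriv_flat_def Let_def e Jx by simp
qed

lemma dir_deriv_chart:
  assumes c: "c \<in> \<A>" "x \<in> fst c" and f: "(f \<circ> chart_inv c) differentiable (at (snd c x))"
  shows "dir_deriv \<A> f x X = frechet_derivative (f \<circ> chart_inv c) (at (snd c x)) (to_chart \<A> c x X)"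
proof -
  let ?c0 = "chart_at \<A> x"
  have c0: "?c0 \<in> \<A>" "x \<in> fst ?c0" by (rule chart_at)+
  have q: "(snd c \<circ> chart_inv ?c0) (snd ?c0 x) = snd c x" using chart_inv_chart[OF c0] by simp
  have "((f \<circ> chart_inv c \<circ> (snd c \<circ> chart_inv ?c0)) has_derivative
      (frechet_derivative (f \<circ> chart_inv c) (at (snd c x)) \<circ> jac ?c0 c x)) (at (snd ?c0 x))"
    by (rule diff_chain_at[OF jac_derivative[OF c0(1) c(1) c0(2) c(2)]])
       (use f in \<open>simp add: q[simplified] frechet_derivative_works\<close>)
  then have "((f \<circ> chart_inv ?c0) has_derivative
      (frechet_derivative (f \<circ> chart_inv c) (at (snd c x)) \<circ> jac ?c0 c x)) (at (snd ?c0 x))"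
  proof (rule has_derivative_transform_within_open)
    show "open (snd ?c0 ` (fst c \<inter> fst ?c0))" by (rule open_image_chart[OF c0(1) open_chart[OF c(1)]])
    show "snd ?c0 x \<in> snd ?c0 ` (fst c \<inter> fst ?c0)" using c c0 by auto
    show "(f \<circ> chart_inv c \<circ> (snd c \<circ> chart_inv ?c0)) y = (f \<circ> chart_inv ?c0) y"
      if "y \<in> snd ?c0 ` (fst c \<inter> fst ?c0)" for y
      using that chart_inv_chart[OF c(1)] chart_inv_chart[OF c0(1)] by auto
  qed
  then show ?thesis unfolding dir_deriv_def to_chart_jac by (metis comp_apply frechet_derivative_at)
qed

end

section \<open>The quaternionic model\<close>

lemmas quat_defs = qmul_def qone_def qconj_def q_of_im_def im_part_def

lemma vector_4 [simp]:
  "(vector [x, y, z, w] :: 'a::zero^4) $ 1 = x" "(vector [x, y, z, w] :: 'a::zero^4) $ 2 = y"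
  "(vector [x, y, z, w] :: 'a::zero^4) $ 3 = z" "(vector [x, y, z, w] :: 'a::zero^4) $ 4 = w"
  unfolding vector_def by simp_all

lemma qmul_nth [simp]:
  "qmul p q $ 1 = p$1 * q$1 - p$2 * q$2 - p$3 * q$3 - p$4 * q$4"
  "qmul p q $ 2 = p$1 * q$2 + p$2 * q$1 + p$3 * q$4 - p$4 * q$3"
  "qmul p q $ 3 = p$1 * q$3 - p$2 * q$4 + p$3 * q$1 + p$4 * q$2"
  "qmul p q $ 4 = p$1 * q$4 + p$2 * q$3 - p$3 * q$2 + p$4 * q$1"
  by (simp_all add: qmul_def)

lemma quat_nth [simp]:
  "qone $ 1 = 1" "qone $ 2 = 0" "qone $ 3 = 0" "qone $ 4 = 0"
  "qconj p $ 1 = p$1" "qconj p $ 2 = - p$2" "qconj p $ 3 = - p$3" "qconj p $ 4 = - p$4"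
  "q_of_im w $ 1 = 0" "q_of_im w $ 2 = w$1" "q_of_im w $ 3 = w$2" "q_of_im w $ 4 = w$3"
  "im_part p $ 1 = p$2" "im_part p $ 2 = p$3" "im_part p $ 3 = p$4"
  by (simp_all add: quat_defs)

lemma quat_eq_iff: "p = q \<longleftrightarrow> p$1 = q$1 \<and> p$2 = q$2 \<and> p$3 = q$3 \<and> p$4 = q$4" for p q :: "'a^4"
  by (simp add: vec_eq_iff forall_4)

lemma im_eq_iff: "p = q \<longleftrightarrow> p$1 = q$1 \<and> p$2 = q$2 \<and> p$3 = q$3" for p q :: "'a^3"
  by (simp add: vec_eq_iff forall_3)

lemma inner_4: "p \<bullet> q = p$1 * q$1 + p$2 * q$2 + p$3 * q$3 + p$4 * q$4" for p q :: "real^4"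
  by (simp add: inner_vec_def sum_4)

lemma inner_3: "p \<bullet> q = p$1 * q$1 + p$2 * q$2 + p$3 * q$3" for p q :: "real^3"
  by (simp add: inner_vec_def sum_3)

lemma qmul_assoc: "qmul (qmul p q) r = qmul p (qmul q r)"
  by (simp add: quat_eq_iff algebra_simps)

lemma qmul_qone [simp]: "qmul qone p = p" "qmul p qone = p"
  by (simp_all add: quat_eq_iff)

lemma qmul_distribs:
  "qmul (p + q) r = qmul p r + qmul q r" "qmul p (q + r) = qmul p q + qmul p r"
  "qmul (c *\<^sub>R p) r = c *\<^sub>R qmul p r" "qmul p (c *\<^sub>R r) = c *\<^sub>R qmul p r"
  "qmul (- p) r = - qmul p r" "qmul p (- r) = - qmul p r"
  "qmul 0 r = 0" "qmul p 0 = 0"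
  by (simp_all add: quat_eq_iff algebra_simps)

lemma bounded_bilinear_qmul: "bounded_bilinear qmul"
proof -
  have "bilinear qmul"
    unfolding bilinear_def by (auto intro!: linearI simp: qmul_distribs)
  then show ?thesis by (simp add: bilinear_conv_bounded_bilinear)
qed

lemma qmul_sum_left: "qmul (\<Sum>i\<in>I. f i) q = (\<Sum>i\<in>I. qmul (f i) q)"
  and qmul_sum_right: "qmul q (\<Sum>i\<in>I. f i) = (\<Sum>i\<in>I. qmul q (f i))"
  by (simp_all add: bounded_bilinear.sum_left[OF bounded_bilinear_qmul] bounded_bilinear.sum_right[OF bounded_bilinear_qmul])

lemma linear_qconj: "linear qconj"
  by (rule linearI) (simp_all add: quat_eq_iff)

lemma linear_im_part: "linear im_part"
  by (rule linearI) (simp_all add: im_eq_iff)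

lemma linear_q_of_im: "linear q_of_im"
  by (rule linearI) (simp_all add: quat_eq_iff)

lemma qconj_qmul: "qconj (qmul p q) = qmul (qconj q) (qconj p)"
  by (simp add: quat_eq_iff algebra_simps)

lemma qconj_qconj [simp]: "qconj (qconj p) = p"
  by (simp add: quat_eq_iff)

lemma norm_quat: "(norm p)\<^sup>2 = (p$1)\<^sup>2 + (p$2)\<^sup>2 + (p$3)\<^sup>2 + (p$4)\<^sup>2" for p :: "real^4"
  unfolding power2_norm_eq_inner inner_4 by (simp add: power2_eq_square)

lemma qmul_qconj: "qmul p (qconj p) = (norm p)\<^sup>2 *\<^sub>R qone" "qmul (qconj p) p = (norm p)\<^sup>2 *\<^sub>R qone"
  unfolding norm_quat by (simp_all add: quat_eq_iff power2_eq_square algebra_simps)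

lemma qmul_qinv [simp]: "p \<noteq> 0 \<Longrightarrow> qmul p (qinv p) = qone" "p \<noteq> 0 \<Longrightarrow> qmul (qinv p) p = qone"
  by (simp_all add: qinv_def qmul_distribs qmul_qconj)

lemma q_of_im_squared: "qmul (q_of_im w) (q_of_im w) = - (norm w)\<^sup>2 *\<^sub>R qone"
  by (simp add: quat_eq_iff power2_norm_eq_inner inner_3 algebra_simps)

definition rmul :: "real^4^'n \<Rightarrow> real^4 \<Rightarrow> real^4^'n::finite" where
  "rmul v q = (\<chi> j. qmul (v$j) q)"

definition rim :: "real^3 \<Rightarrow> real^4^'n \<Rightarrow> real^4^'n::finite" where
  "rim w v = rmul v (q_of_im w)"

text \<open>The quaternionic Hermitian form for right multiplication. Its real part is the metric
  and its imaginary part the triple of fundamental forms (\<open>hprod_nth1\<close>,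
  \<open>im_hprod\<close>); the signs in \<open>qc_omega\<close> are those of conjugate times
  quaternion.\<close>

definition hprod :: "real^4^'n \<Rightarrow> real^4^'n \<Rightarrow> real^4" where
  "hprod v v' = (\<Sum>j\<in>UNIV. qmul (qconj (v$j)) (v'$j))"

definition om :: "real^4^'n \<Rightarrow> real^4^'n \<Rightarrow> real^3" where
  "om v v' = (\<chi> s. qc_omega s v v')"

lemma rmul_nth [simp]: "rmul v q $ j = qmul (v$j) q"
  by (simp add: rmul_def)

lemma rmul_rmul: "rmul (rmul v p) q = rmul v (qmul p q)"
  by (rule vec_eq_iff[THEN iffD2]) (simp add: qmul_assoc)

lemma rmul_qone [simp]: "rmul v qone = v"
  by (rule vec_eq_iff[THEN iffD2]) simp

lemma rmul_distribs:
  "rmul (u + v) q = rmul u q + rmul v q" "rmul v (p + q) = rmul v p + rmul v q"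
  "rmul (c *\<^sub>R v) q = c *\<^sub>R rmul v q" "rmul v (c *\<^sub>R q) = c *\<^sub>R rmul v q"
  "rmul (- v) q = - rmul v q" "rmul v (- q) = - rmul v q" "rmul 0 q = 0" "rmul v 0 = 0"
  by (rule vec_eq_iff[THEN iffD2]; simp add: qmul_distribs)+

lemma bilinear_rightmul: "bilinear rmul"
  unfolding bilinear_def by (auto intro!: linearI simp: rmul_distribs)

lemma linear_rim: "linear (rim w)" "linear (\<lambda>w. rim w v)"
  unfolding rim_def
  by (rule linearI; simp add: rmul_distribs linear_add[OF linear_q_of_im] linear_cmul[OF linear_q_of_im])+

lemma rim_rim: "rim w (rim w v) = - (norm w)\<^sup>2 *\<^sub>R v"
  by (simp add: rim_def rmul_rmul q_of_im_squared rmul_distribs)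

lemma hprod_nth1: "hprod v v' $ 1 = v \<bullet> v'"
  by (simp add: hprod_def inner_vec_def[of v] inner_4 algebra_simps)

lemma im_hprod: "im_part (hprod v v') = om v v'"
  by (simp add: im_eq_iff om_def hprod_def qc_omega_def wedge_coord_def algebra_simps)

lemma hprod_decomp: "hprod v v' = (v \<bullet> v') *\<^sub>R qone + q_of_im (om v v')"
  by (simp add: quat_eq_iff hprod_nth1 flip: im_hprod)

lemma hprod_rmul: "hprod (rmul v p) (rmul v' q) = qmul (qconj p) (qmul (hprod v v') q)"
  by (simp add: hprod_def qconj_qmul qmul_assoc qmul_sum_left qmul_sum_right)

text \<open>Moving an imaginary quaternion out of the Hermitian form and taking real parts. Through
  this duality statements on the fundamental forms become statements on the endomorphisms
  \<open>rim w\<close> and the metric.\<close>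

lemma om_inner: "om v v' \<bullet> w = rim w v \<bullet> v'"
proof -
  have "rim w v \<bullet> v' = qmul (qconj (q_of_im w)) (hprod v v') $ 1"
    using hprod_rmul[of v "q_of_im w" v' qone] by (simp flip: hprod_nth1 add: rim_def)
  also have "\<dots> = im_part (hprod v v') \<bullet> w" by (simp add: inner_3 algebra_simps)
  finally show ?thesis by (simp add: im_hprod)
qed

lemma bilinear_om: "bilinear om"
proof -
  have *: "x = y" if "\<And>w. x \<bullet> w = y \<bullet> w" for x y :: "real^3"
    using that vector_eq_rdot[of x y] by blast
  show ?thesis
    unfolding bilinear_def
    by (intro conjI allI linearI; rule *)
       (simp_all add: om_inner inner_add inner_add_right linear_add[OF linear_rim(1)] linear_cmul[OF linear_rim(1)])
qed

lemmas om_add = bilinear_ladd[OF bilinear_om] bilinear_radd[OF bilinear_om]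
  and om_scaleR = bilinear_lmul[OF bilinear_om] bilinear_rmul[OF bilinear_om]
  and om_diff = bilinear_lsub[OF bilinear_om] bilinear_rsub[OF bilinear_om]

lemma om_skew: "om v v' = - om v' v"
  by (simp add: im_eq_iff om_def qc_omega_def wedge_coord_def algebra_simps flip: sum_negf)

lemma rim_skew: "rim w v \<bullet> v' = - (v \<bullet> rim w v')"
  using om_inner[of v v' w] om_inner[of v' v w] om_skew[of v v'] by (simp add: inner_commute)

text \<open>One quaternionic axis suffices to reach all of W, so the action of a
  structure-preserving map on W is determined by its action on V. The axis exists because n is at
  least 1.\<close>

lemma om_surj: "om (axis j qone) (axis j (q_of_im w)) = w" for j :: "'n::finite"
proof -
  have "hprod (axis j qone) (axis j (q_of_im w)) = q_of_im w"
    unfolding hprod_def by (subst sum.remove[of _ j]) (auto simp: axis_def quat_eq_iff intro!: sum.neutral)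
  then show ?thesis unfolding im_hprod[symmetric] by (simp add: im_eq_iff)
qed

lemma norm_rmul: "(norm (rmul v q))\<^sup>2 = (norm q)\<^sup>2 * (norm v)\<^sup>2"
proof -
  have "rmul v q \<bullet> rmul v q = qmul (qconj q) (qmul (hprod v v) q) $ 1"
    by (simp only: hprod_nth1[symmetric] hprod_rmul)
  moreover have "om v v = 0" using om_skew[of v v] by (simp add: im_eq_iff)
  ultimately show ?thesis
    by (simp add: hprod_decomp linear_0[OF linear_q_of_im] qmul_distribs qmul_qconj power2_norm_eq_inner algebra_simps)
qed

lemma act_V_rmul: "act_V g p v = rmul (\<chi> i. \<Sum>j\<in>UNIV. qmul (g$i$j) (v$j)) (qinv p)"
  by (rule vec_eq_iff[THEN iffD2]) (simp add: act_V_def)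

lemma hprod_Sp:
  assumes "g \<in> Sp"
  shows "hprod (\<chi> i. \<Sum>j\<in>UNIV. qmul (g$i$j) (v$j)) (\<chi> i. \<Sum>j\<in>UNIV. qmul (g$i$j) (v'$j)) = hprod v v'"
proof -
  have "hprod (\<chi> i. \<Sum>j\<in>UNIV. qmul (g$i$j) (v$j)) (\<chi> i. \<Sum>j\<in>UNIV. qmul (g$i$j) (v'$j))
     = (\<Sum>k\<in>UNIV. \<Sum>j\<in>UNIV. \<Sum>i\<in>UNIV. qmul (qmul (qconj (v$i)) (qmul (qconj (g$k$i)) (g$k$j))) (v'$j))"
    by (simp add: hprod_def linear_sum[OF linear_qconj] qmul_sum_left qmul_sum_right qconj_qmul qmul_assoc)
  also have "\<dots> = (\<Sum>j\<in>UNIV. \<Sum>i\<in>UNIV. \<Sum>k\<in>UNIV. qmul (qmul (qconj (v$i)) (qmul (qconj (g$k$i)) (g$k$j))) (v'$j))"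
    by (subst sum.swap) (intro sum.cong refl sum.swap)
  also have "\<dots> = (\<Sum>j\<in>UNIV. \<Sum>i\<in>UNIV. qmul (qmul (qconj (v$i)) (\<Sum>k\<in>UNIV. qmul (qconj (g$k$i)) (g$k$j))) (v'$j))"
    by (simp add: qmul_sum_left qmul_sum_right)
  also have "\<dots> = (\<Sum>j\<in>UNIV. \<Sum>i\<in>UNIV. if i = j then qmul (qconj (v$i)) (v'$j) else 0)"
    using assms by (intro sum.cong refl) (auto simp: Sp_def qmul_distribs)
  also have "\<dots> = hprod v v'" by (simp add: hprod_def)
  finally show ?thesis .
qed

lemma linear_act_Im: "linear (act_Im p)"
  unfolding act_Im_def
  by (rule linearI) (simp_all add: linear_add[OF linear_q_of_im] linear_cmul[OF linear_q_of_im] qmul_distribs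
      linear_add[OF linear_im_part] linear_cmul[OF linear_im_part])

lemma act_Im_inner: "act_Im (qconj p) x \<bullet> y = x \<bullet> act_Im p y"
  by (simp add: act_Im_def inner_3 algebra_simps)

lemma act_Im_inverse: "act_Im p (act_Im (qconj p) x) = (norm p)^4 *\<^sub>R x"
proof -
  have "q_of_im (act_Im (qconj p) x) = qmul (qmul (qconj p) (q_of_im x)) p"
    by (simp add: act_Im_def quat_eq_iff algebra_simps)
  then have "act_Im p (act_Im (qconj p) x) = im_part (qmul (qmul p (qconj p)) (qmul (q_of_im x) (qmul p (qconj p))))"
    by (simp add: act_Im_def[of p] qmul_assoc)
  also have "\<dots> = (norm p)^4 *\<^sub>R x"
    by (simp add: qmul_qconj qmul_distribs im_eq_iff power4_eq_xxxx power2_eq_square)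
  finally show ?thesis .
qed

text \<open>\<open>act_Im p\<close> is a rotation times the square of the norm of \<open>p\<close>,
  so its inverse adjoint is the same rotation times the inverse of that factor.\<close>

lemma act_W_eq:
  assumes "p \<noteq> 0" shows "act_W p w = (1 / norm p ^ 4) *\<^sub>R act_Im p w"
proof -
  have "inv (act_Im p) = (\<lambda>x. (1 / norm p ^ 4) *\<^sub>R act_Im (qconj p) x)"
  proof (rule inv_unique_comp)
    show "act_Im p \<circ> (\<lambda>x. (1 / norm p ^ 4) *\<^sub>R act_Im (qconj p) x) = id"
      using assms by (simp add: fun_eq_iff linear_cmul[OF linear_act_Im] act_Im_inverse)
    have "norm (qconj p) = norm p" by (simp add: norm_eq inner_4)
    then show "(\<lambda>x. (1 / norm p ^ 4) *\<^sub>R act_Im (qconj p) x) \<circ> act_Im p = id"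
      using assms act_Im_inverse[of "qconj p"] by (simp add: fun_eq_iff)
  qed
  then show ?thesis
    unfolding act_W_def
    by (simp add: adjoint_unique[of _ "\<lambda>w. (1 / norm p ^ 4) *\<^sub>R act_Im p w"] act_Im_inner)
qed

text \<open>The right factor \<open>qinv p\<close> conjugates the Hermitian form by
  \<open>p\<close>, up to scale. Conjugation keeps real quaternions real, so the imaginary part
  transforms by itself.\<close>

lemma om_act:
  assumes "g \<in> Sp" "p \<noteq> 0"
  shows "om (act_V g p v) (act_V g p v') = act_W p (om v v')"
proof -
  have "hprod (act_V g p v) (act_V g p v') = qmul (qconj (qinv p)) (qmul (hprod v v') (qinv p))"
    by (simp add: act_V_rmul hprod_rmul hprod_Sp[OF assms(1)])
  also have "\<dots> = (1 / norm p ^ 4) *\<^sub>R qmul (qmul p (hprod v v')) (qconj p)"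
    by (simp add: qinv_def linear_cmul[OF linear_qconj] qmul_distribs qmul_assoc power2_eq_square power4_eq_xxxx)
  also have "qmul (qmul p (hprod v v')) (qconj p) = (v \<bullet> v' * (norm p)\<^sup>2) *\<^sub>R qone + qmul (qmul p (q_of_im (om v v'))) (qconj p)"
    by (simp add: hprod_decomp qmul_distribs qmul_qconj)
  finally have "om (act_V g p v) (act_V g p v') = (1 / norm p ^ 4) *\<^sub>R
     im_part ((v \<bullet> v' * (norm p)\<^sup>2) *\<^sub>R qone + qmul (qmul p (q_of_im (om v v'))) (qconj p))"
    by (metis im_hprod linear_cmul[OF linear_im_part])
  also have "\<dots> = (1 / norm p ^ 4) *\<^sub>R act_Im p (om v v')"
    by (simp add: linear_add[OF linear_im_part] act_Im_def im_eq_iff)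
  finally show ?thesis by (simp add: act_W_eq[OF assms(2)])
qed

section \<open>Linear maps of V that transform the fundamental forms by a map of W\<close>

abbreviation "q_i \<equiv> (axis 1 1 :: real^3)"
abbreviation "q_j \<equiv> (axis 2 1 :: real^3)"
abbreviation "q_k \<equiv> (axis 3 1 :: real^3)"

lemma axis_3 [simp]:
  "q_i $ 1 = 1" "q_i $ 2 = 0" "q_i $ 3 = 0" "q_j $ 1 = 0" "q_j $ 2 = 1" "q_j $ 3 = 0"
  "q_k $ 1 = 0" "q_k $ 2 = 0" "q_k $ 3 = 1"
  by (auto simp: axis_def)

lemma norm_units [simp]: "norm q_i = 1" "norm q_j = 1" "norm q_k = 1"
  by (simp_all add: norm_eq_1 inner_3)

lemma rim_units [simp]:
  "rim q_j (rim q_i v) = rim q_k v" "rim q_i (rim q_j v) = - rim q_k v"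
  "rim q_k (rim q_j v) = rim q_i v" "rim q_j (rim q_k v) = - rim q_i v"
  "rim q_i (rim q_k v) = rim q_j v" "rim q_k (rim q_i v) = - rim q_j v"
  unfolding rim_def rmul_rmul rmul_distribs(6)[symmetric]
  by (intro arg_cong[where f = "rmul v"]; simp add: quat_eq_iff)+

lemma rmul_eq_iff: "(\<forall>v::real^4^'n::finite. rmul v p = rmul v q) \<longleftrightarrow> p = q"
proof
  assume *: "\<forall>v::real^4^'n. rmul v p = rmul v q"
  fix j :: 'n
  have "rmul (axis j qone :: real^4^'n) p $ j = rmul (axis j qone) q $ j" using * by simp
  then show "p = q" by (simp add: axis_def)
qed simp

text \<open>The intertwiner is found among the sums \<open>x - i x \<phi>\<^sub>1 - j x \<phi>\<^sub>2 - k x \<phi>\<^sub>3\<close>: the trace of this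
  map in \<open>x\<close> is 4, so it does not vanish on all of the quaternions.\<close>
lemma quaternion_intertwiner:
  fixes p1 p2 p3 :: "real^4"
  assumes sq: "qmul p1 p1 = - qone" "qmul p2 p2 = - qone" "qmul p3 p3 = - qone"
    and pr: "qmul p1 p2 = p3" "qmul p2 p3 = p1" "qmul p3 p1 = p2"
      "qmul p2 p1 = - p3" "qmul p3 p2 = - p1" "qmul p1 p3 = - p2"
    and im: "p1 $ 1 = 0" "p2 $ 1 = 0" "p3 $ 1 = 0"
  obtains p where "p \<noteq> 0" "qmul (q_of_im q_i) p = qmul p p1" "qmul (q_of_im q_j) p = qmul p p2"
    "qmul (q_of_im q_k) p = qmul p p3"
proof -
  let ?i = "q_of_im q_i" and ?j = "q_of_im q_j" and ?k = "q_of_im q_k"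
  \<comment> \<open>Up to a factor 2, the sum over the eight units of the quaternion group of: unit,
    times \<open>x\<close>, times the inverse of the image of the unit. Such a group average
    intertwines the two actions.\<close>
  define L where "L x = x - qmul (qmul ?i x) p1 - qmul (qmul ?j x) p2 - qmul (qmul ?k x) p3" for x
  have u: "qmul ?i ?i = - qone" "qmul ?j ?j = - qone" "qmul ?k ?k = - qone"
    "qmul ?i ?j = ?k" "qmul ?j ?k = ?i" "qmul ?k ?i = ?j" "qmul ?j ?i = - ?k" "qmul ?k ?j = - ?i" "qmul ?i ?k = - ?j"
    by (simp_all add: quat_eq_iff)
  have u': "qmul ?i (qmul ?i x) = - x" "qmul ?j (qmul ?j x) = - x" "qmul ?k (qmul ?k x) = - x"
    "qmul ?i (qmul ?j x) = qmul ?k x" "qmul ?j (qmul ?k x) = qmul ?i x" "qmul ?k (qmul ?i x) = qmul ?j x"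
    "qmul ?j (qmul ?i x) = - qmul ?k x" "qmul ?k (qmul ?j x) = - qmul ?i x" "qmul ?i (qmul ?k x) = - qmul ?j x" for x
    by (simp_all add: u qmul_distribs flip: qmul_assoc)
  have d: "qmul (x - y) z = qmul x z - qmul y z" "qmul z (x - y) = qmul z x - qmul z y" for x y z
    by (simp_all add: quat_eq_iff algebra_simps)
  have L: "qmul ?i (L x) = qmul (L x) p1" "qmul ?j (L x) = qmul (L x) p2" "qmul ?k (L x) = qmul (L x) p3" for x
    by (simp_all add: L_def d qmul_assoc u' sq pr qmul_distribs)
  have "qone \<bullet> L qone + ?i \<bullet> L ?i + ?j \<bullet> L ?j + ?k \<bullet> L ?k = 4"
    by (simp add: L_def inner_4 im)
  then have "\<exists>x. L x \<noteq> 0" by (metis add.right_neutral inner_zero_right zero_neq_numeral)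
  then show ?thesis using that L by blast
qed

context
  fixes A :: "real^4^'n::finite \<Rightarrow> real^4^'n" and \<rho> :: "real^3 \<Rightarrow> real^3"
  assumes A: "linear A" "bij A" and \<rho>: "linear \<rho>" and omA: "\<And>v v'. om (A v) (A v') = \<rho> (om v v')"
begin

text \<open>\<open>omA\<close> rewritten with \<open>om_inner\<close>. For a multiple of an isometry
  it says that conjugation by \<open>A\<close> permutes the maps \<open>rim w\<close>; that
  \<open>A\<close> is such a multiple is the point of \<open>A_adjoint_scalar\<close>.\<close>

lemma conjugation_adjoint: "adjoint A (rim w (A v)) = rim (adjoint \<rho> w) v"
proof (rule vector_eq_rdot[THEN iffD1], rule allI)
  fix z
  have "adjoint A (rim w (A v)) \<bullet> z = om (A v) (A z) \<bullet> w"
    using adjoint_clauses(2)[OF A(1)] by (simp add: om_inner)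
  also have "\<dots> = om v z \<bullet> adjoint \<rho> w"
    using adjoint_clauses(1)[OF \<rho>] by (simp add: omA)
  finally show "adjoint A (rim w (A v)) \<bullet> z = rim (adjoint \<rho> w) v \<bullet> z" by (simp add: om_inner)
qed

lemma linear_adj: "linear (adjoint A)"
  using A(1) by (rule adjoint_linear)

lemma adjoint_injective: "adjoint A v = 0 \<Longrightarrow> v = 0"
proof -
  assume "adjoint A v = 0"
  moreover obtain u where "v = A u" using A(2) by (metis bij_pointE)
  ultimately have "v \<bullet> v = 0"
    using adjoint_clauses(2)[OF A(1), of v u] by simp
  then show "v = 0" by simp
qed

text \<open>\<open>S = A A\<^sup>T\<close> satisfies \<open>S R\<^sub>w S R\<^sub>w = - c\<^sub>w\<close> for imaginary units \<open>w\<close>. Comparing \<open>i\<close>, \<open>j\<close> and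
  \<open>k = i j\<close> shows that \<open>S\<^sup>2\<close> is a scalar, hence so is the positive operator \<open>S\<close>.\<close>
lemma A_adjoint_scalar: "\<exists>d>0. \<forall>v. A (adjoint A v) = d *\<^sub>R v"
proof -
  define S where "S v = A (adjoint A v)" for v
  have linS: "linear S" unfolding S_def[abs_def] using linear_compose[OF linear_adj A(1)] by (simp add: o_def)
  have injS: "v = 0" if "S v = 0" for v
    using that A linear_injective_0[OF A(1)] adjoint_injective unfolding S_def bij_def by blast
  define c where "c w = (norm (adjoint \<rho> w))\<^sup>2" for w
  have SRSR: "S (rim w (S (rim w y))) = - c w *\<^sub>R y" for w y
  proof -
    obtain u where u: "y = A u" using A(2) by (metis bij_pointE)
    have "S (rim w (S (rim w y))) = A (rim (adjoint \<rho> w) (rim (adjoint \<rho> w) u))"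
      by (simp add: S_def u conjugation_adjoint)
    then show ?thesis by (simp add: rim_rim c_def u linear_cmul[OF A(1)] linear_neg[OF A(1)])
  qed
  have cpos: "c w > 0" if w: "norm w = 1" for w
  proof -
    fix j :: 'n
    have "c w \<noteq> 0"
    proof
      assume "c w = 0"
      define y :: "real^4^'n" where "y = axis j qone"
      have ny: "y \<noteq> 0" by (simp add: y_def axis_eq_0_iff quat_eq_iff)
      have inj: "v = 0" if "rim w v = 0" for v :: "real^4^'n"
        using rim_rim[of w v] that w by (simp add: linear_0[OF linear_rim(1)])
      have "S (rim w (S (rim w y))) = 0" using SRSR[of w y] \<open>c w = 0\<close> by simp
      from inj[OF injS[OF inj[OF injS[OF this]]]] ny show False by simp
    qed
    then show ?thesis by (simp add: c_def)
  qed
  have SRS: "S (rim w (S y)) = c w *\<^sub>R rim w y" if w: "norm w = 1" for w y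
  proof -
    have yy: "rim w (rim w y) = - y" using w by (simp add: rim_rim)
    have "- S (rim w (S y)) = - c w *\<^sub>R rim w y"
      using SRSR[of w "rim w y"] unfolding yy linear_neg[OF linS] linear_neg[OF linear_rim(1)] .
    then show ?thesis by simp
  qed
  obtain s where s: "s > 0" "\<And>z :: real^4^'n. S (S z) = s *\<^sub>R z"
  proof
    let ?s = "c q_i * c q_j / c q_k"
    show "?s > 0" using cpos by simp
    fix z :: "real^4^'n"
    define y where "y = - rim q_i z"
    have y: "z = rim q_i y" by (simp add: y_def linear_neg[OF linear_rim(1)] rim_rim)
    \<comment> \<open>Applying \<open>S\<close> to \<open>rim q_k (S y) = rim q_j (S u)\<close>
      shows that \<open>u\<close> is a multiple of \<open>z\<close>, while
      \<open>S (S u) = S (rim q_i (S y))\<close> is \<open>c q_i\<close> times \<open>z\<close>.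
      Comparing the two gives the constant.\<close>
    have "surj S" using linear_injective_imp_surjective[OF linS] linear_injective_0[OF linS] injS by blast
    then obtain u where u: "S u = rim q_i (S y)" by (metis surjD)
    have "rim q_k (S y) = rim q_j (S u)" by (simp add: u)
    then have "c q_k *\<^sub>R rim q_k y = c q_j *\<^sub>R rim q_j u"
      using SRS[of q_k y] SRS[of q_j u] by simp
    then have "c q_k *\<^sub>R rim q_j (rim q_k y) = c q_j *\<^sub>R rim q_j (rim q_j u)"
      by (metis linear_cmul[OF linear_rim(1)])
    then have cu: "c q_j *\<^sub>R u = c q_k *\<^sub>R z" by (simp add: rim_rim y)
    have "S (S u) = c q_i *\<^sub>R z" using SRS[of q_i y] by (simp add: u y)
    then have "c q_j *\<^sub>R c q_i *\<^sub>R z = S (S (c q_j *\<^sub>R u))" by (simp add: linear_cmul[OF linS])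
    also have "\<dots> = c q_k *\<^sub>R S (S z)" by (simp add: cu linear_cmul[OF linS])
    finally have "(1 / c q_k) *\<^sub>R c q_k *\<^sub>R S (S z) = (1 / c q_k) *\<^sub>R c q_j *\<^sub>R c q_i *\<^sub>R z" by simp
    then show "S (S z) = ?s *\<^sub>R z" using cpos[of q_k] by (simp add: mult.commute)
  qed
  define d where "d = sqrt s"
  have d: "d > 0" "d * d = s" using s by (simp_all add: d_def)
  have "S v = d *\<^sub>R v" for v
  proof -
    \<comment> \<open>\<open>z\<close> lies in the eigenspace of \<open>S\<close> for
      \<open>- d\<close>, which is zero because \<open>S\<close> is positive.\<close>
    define z where "z = S v - d *\<^sub>R v"
    have "S z = - d *\<^sub>R z"
      by (simp add: z_def linear_diff[OF linS] linear_cmul[OF linS] s(2) scaleR_right_diff_distrib flip: d(2))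
    then have "- d * (z \<bullet> z) = S z \<bullet> z" by simp
    also have "\<dots> = adjoint A z \<bullet> adjoint A z"
      unfolding S_def using adjoint_clauses(1)[OF A(1)] by (simp add: inner_commute)
    finally have "d * (z \<bullet> z) \<le> 0" using inner_ge_zero[of "adjoint A z"] by linarith
    then have "z \<bullet> z \<le> 0" using d(1) by (simp add: mult_le_0_iff)
    then have "z = 0" using inner_ge_zero[of z] by (metis antisym inner_eq_zero_iff)
    then show ?thesis by (simp add: z_def)
  qed
  then show ?thesis using d(1) unfolding S_def by blast
qed

text \<open>\<open>A\<close> is a multiple of an isometry, so it carries right multiplication by i,
  j, k back to right multiplication by three quaternions with the same relations. The intertwiner
  \<open>p\<close> undoes this automorphism: \<open>B v = A (v p)\<close> commutes with all right
  multiplications, and an isometry with this property is a matrix in \<open>Sp\<close>.\<close>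

lemma conjugation_in_group: "\<exists>g p. g \<in> Sp \<and> p \<noteq> 0 \<and> A = act_V g p \<and> \<rho> = act_W p"
proof -
  obtain d where d: "d > 0" "\<And>v. A (adjoint A v) = d *\<^sub>R v" using A_adjoint_scalar by blast
  have inj: "A u = A v \<Longrightarrow> u = v" for u v using A(2) by (simp add: bij_def inj_eq)
  have AtA: "adjoint A (A v) = d *\<^sub>R v" for v
    by (rule inj) (simp add: d linear_cmul[OF A(1)])
  have isoA: "A u \<bullet> A v = d * (u \<bullet> v)" for u v
    using adjoint_clauses(2)[OF A(1), of "A u" v] by (simp add: AtA)
  define \<phi> where "\<phi> w = (1 / d) *\<^sub>R adjoint \<rho> w" for w
  have \<phi>: "rim w (A v) = A (rim (\<phi> w) v)" for w v
  proof -
    have "d *\<^sub>R rim w (A v) = A (rim (adjoint \<rho> w) v)"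
      using d(2)[of "rim w (A v)"] conjugation_adjoint by simp
    then show ?thesis using d(1)
      by (simp add: \<phi>_def linear_cmul[OF linear_rim(2)] linear_cmul[OF A(1)] flip: \<open>d *\<^sub>R _ = _\<close>)
  qed
  let ?f = "\<lambda>w. q_of_im (\<phi> w)"
  have uniq: "p = q" if "\<And>v. A (rmul v p) = A (rmul v q)" for p q
    using inj[OF that] rmul_eq_iff by blast
  have Af: "A (rmul v (?f w)) = rim w (A v)" for v w
    using \<phi>[of w v] by (simp add: rim_def)
  have Aff: "A (rmul v (qmul (?f w) (?f w'))) = rim w' (rim w (A v))" for v w w'
    by (simp add: Af flip: rmul_rmul)
  have sq: "qmul (?f q_i) (?f q_i) = - qone" "qmul (?f q_j) (?f q_j) = - qone" "qmul (?f q_k) (?f q_k) = - qone"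
    by (rule uniq; simp add: Aff rim_rim rmul_distribs linear_neg[OF A(1)])+
  have pr: "qmul (?f q_i) (?f q_j) = ?f q_k" "qmul (?f q_j) (?f q_k) = ?f q_i" "qmul (?f q_k) (?f q_i) = ?f q_j"
      "qmul (?f q_j) (?f q_i) = - ?f q_k" "qmul (?f q_k) (?f q_j) = - ?f q_i" "qmul (?f q_i) (?f q_k) = - ?f q_j"
    by (rule uniq; simp add: Aff Af rmul_distribs linear_neg[OF A(1)])+
  obtain p0 where p0: "p0 \<noteq> 0" "qmul (q_of_im q_i) p0 = qmul p0 (?f q_i)"
     "qmul (q_of_im q_j) p0 = qmul p0 (?f q_j)" "qmul (q_of_im q_k) p0 = qmul p0 (?f q_k)"
    using quaternion_intertwiner[OF sq pr] by auto
  \<comment> \<open>The intertwiner is determined up to a real factor only; this scale makes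
    \<open>B\<close> an isometry.\<close>
  define p where "p = (1 / (norm p0 * sqrt d)) *\<^sub>R p0"
  have p: "p \<noteq> 0" "d * (norm p)\<^sup>2 = 1" using p0(1) d(1) by (simp_all add: p_def power_mult_distrib field_simps)
  have pf: "qmul (q_of_im q_i) p = qmul p (?f q_i)" "qmul (q_of_im q_j) p = qmul p (?f q_j)"
     "qmul (q_of_im q_k) p = qmul p (?f q_k)" unfolding p_def qmul_distribs p0 by simp_all
  define B where "B v = A (rmul v p)" for v
  have linB: "linear B" unfolding B_def[abs_def]
    using A(1) by (intro linearI) (simp_all add: rmul_distribs linear_add linear_cmul)
  have Brim: "B (rim w v) = rim w (B v)" for w v
  proof -
    have u: "B (rim w v) = rim w (B v)" if "qmul (q_of_im w) p = qmul p (?f w)" for w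
      by (simp add: B_def rim_def rmul_rmul that) (simp add: Af rim_def flip: rmul_rmul)
    have w: "w = w$1 *\<^sub>R q_i + w$2 *\<^sub>R q_j + w$3 *\<^sub>R q_k" by (simp add: im_eq_iff)
    show ?thesis
      by (subst (1 2) w) (simp add: linear_add[OF linear_rim(2)] linear_cmul[OF linear_rim(2)] linear_add[OF linB] linear_cmul[OF linB] u pf)
  qed
  have qdec: "q = (q$1) *\<^sub>R qone + q_of_im (im_part q)" for q by (simp add: quat_eq_iff)
  have Brmul: "B (rmul v q) = rmul (B v) q" for v q
    by (subst (1 2) qdec) (simp add: rmul_distribs linear_add[OF linB] linear_cmul[OF linB] Brim[unfolded rim_def])
  have "(norm (B v))\<^sup>2 = (norm v)\<^sup>2" for v
    using p(2) by (simp add: B_def power2_norm_eq_inner isoA) (simp add: norm_rmul flip: power2_norm_eq_inner)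
  then have nB: "norm (B v) = norm v" for v by simp
  have isoB: "B u \<bullet> B v = u \<bullet> v" for u v
    using nB[of "u + v"] nB[of u] nB[of v] by (simp add: dot_norm linear_add[OF linB, symmetric])
  have hB: "hprod (B u) (B v) = hprod u v" for u v
  proof -
    have "om (B u) (B v) = om u v"
      by (rule vector_eq_rdot[THEN iffD1]) (simp add: om_inner isoB flip: Brim)
    then show ?thesis by (simp add: hprod_decomp isoB)
  qed
  define g :: "real^4^'n^'n" where "g = (\<chi> k j. B (axis j qone) $ k)"
  have hax: "hprod (axis i qone) (axis j qone) = (if i = j then qone else 0)" for i j :: 'n
    unfolding hprod_def by (subst sum.remove[of _ j]) (auto simp: axis_def quat_eq_iff intro!: sum.neutral)
  have gSp: "g \<in> Sp"
    unfolding Sp_def using hB[of "axis _ qone" "axis _ qone"] by (simp add: g_def hprod_def[of "B _"] hax)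
  have Bg: "B v = (\<chi> k. \<Sum>j\<in>UNIV. qmul (g$k$j) (v$j))" for v
  proof -
    have "v = (\<Sum>j\<in>UNIV. rmul (axis j qone) (v$j))"
    proof (rule vec_eq_iff[THEN iffD2], rule allI)
      fix i
      have "(\<Sum>j\<in>UNIV. rmul (axis j qone) (v$j) $ i) = (\<Sum>j\<in>UNIV. if j = i then v $ j else 0)"
        by (intro sum.cong refl) (simp add: axis_def qmul_distribs)
      then show "v $ i = (\<Sum>j\<in>UNIV. rmul (axis j qone) (v$j)) $ i" by simp
    qed
    then have "B v = (\<Sum>j\<in>UNIV. rmul (B (axis j qone)) (v$j))"
      by (metis (no_types, lifting) Brmul linear_sum[OF linB] sum.cong)
    then show ?thesis by (simp add: g_def vec_eq_iff)
  qed
  have AV: "A = act_V g p"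
  proof
    fix v
    have "A v = B (rmul v (qinv p))" by (simp add: B_def rmul_rmul p(1))
    also have "\<dots> = rmul (B v) (qinv p)" by (rule Brmul)
    also have "\<dots> = act_V g p v" by (simp add: act_V_rmul Bg)
    finally show "A v = act_V g p v" .
  qed
  have "\<rho> w = act_W p w" for w
  proof -
    fix j :: 'n
    show ?thesis
      using omA[of "axis j qone" "axis j (q_of_im w)"] om_act[OF gSp p(1)] by (simp add: AV om_surj)
  qed
  then show ?thesis using gSp p(1) AV by blast
qed

end

section \<open>The space EH and the stabilizer B\<close>

lemma linear_eq_axis:
  fixes f g :: "real^3 \<Rightarrow> 'b::real_vector"
  assumes "linear f" "linear g" "\<And>s. f (axis s 1) = g (axis s 1)"
  shows "f w = g w"
proof -
  have w: "(\<Sum>s\<in>UNIV. w$s *\<^sub>R axis s 1) = w" by (simp add: im_eq_iff sum_3)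
  have *: "h w = (\<Sum>s\<in>UNIV. w$s *\<^sub>R h (axis s 1))" if "linear h" for h :: "real^3 \<Rightarrow> 'b"
    by (subst w[symmetric]) (simp only: linear_sum[OF that] linear_cmul[OF that])
  show ?thesis using *[OF assms(1)] *[OF assms(2)] assms(3) by simp
qed

lemma om_axis_inner: "qc_omega s v b = rim (axis s 1) v \<bullet> b"
  using om_inner[of v b "axis s 1"] by (simp add: om_def inner_axis)

text \<open>By \<open>om_inner\<close> the metric dual of the contraction of \<open>v\<close> with
  the form \<open>\<omega>\<^sub>s\<close> is right multiplication of \<open>v\<close> by the
  corresponding unit.\<close>

lemma EH_eq: "(EH :: (real^3 \<Rightarrow> real^4^'n::finite) set) = {(\<lambda>w. rim w v) |v. True}"
proof -
  have "(\<Sum>s\<in>UNIV. w$s *\<^sub>R (\<Sum>b\<in>Basis. qc_omega s v b *\<^sub>R b)) = rim w v" for w and v :: "real^4^'n"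
  proof (rule linear_eq_axis[OF _ linear_rim(2)])
    have "linear (\<lambda>w::real^3. \<Sum>s\<in>UNIV. w$s *\<^sub>R x s)" for x :: "3 \<Rightarrow> real^4^'n"
      by (rule linearI) (simp_all add: scaleR_add_left sum.distrib scaleR_sum_right)
    then show "linear (\<lambda>w::real^3. \<Sum>s\<in>UNIV. w$s *\<^sub>R (\<Sum>b\<in>Basis. qc_omega s v b *\<^sub>R b))" .
    have "(\<Sum>t\<in>UNIV. axis s (1::real) $ t *\<^sub>R x t) = x s" for x :: "3 \<Rightarrow> real^4^'n" and s
      by (simp add: axis_def if_distrib[of "\<lambda>c. c *\<^sub>R _"] cong: if_cong)
    then show "(\<Sum>t\<in>UNIV. axis s (1::real) $ t *\<^sub>R (\<Sum>b\<in>Basis. qc_omega t v b *\<^sub>R b)) = rim (axis s 1) v" for s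
      by (simp add: om_axis_inner euclidean_representation)
  qed
  then show ?thesis unfolding EH_def by simp
qed

text \<open>The equations with \<open>r = s\<close> say that
  \<open>rim (axis s 1) (f (axis s 1))\<close> is dual to \<open>\<mu> / 2\<close>, hence the same
  vector for all \<open>s\<close>; multiplying by the unit once more gives \<open>f\<close>.\<close>

lemma EH_I:
  assumes f: "linear f" and m: "\<And>r s v. om (f (axis r 1)) v $ s + om (f (axis s 1)) v $ r = (if r = s then \<mu> v else 0)"
  shows "f \<in> EH"
proof -
  have rf: "rim (axis s 1) (f (axis s 1)) \<bullet> v = \<mu> v / 2" for s v
    using m[of s v s] by (simp add: om_inner[symmetric] inner_axis)
  define z where "z = rim q_i (f q_i)"
  have "rim (axis s 1) (f (axis s 1)) = z" for s
    by (rule vector_eq_rdot[THEN iffD1]) (simp add: rf z_def)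
  then have "rim (axis s 1) (rim (axis s 1) (f (axis s 1))) = rim (axis s 1) z" for s by simp
  then have "- f (axis s 1) = rim (axis s 1) z" for s
    by (simp add: rim_rim)
  then have fs: "f (axis s 1) = rim (axis s 1) (- z)" for s
    by (metis linear_neg[OF linear_rim(1)] minus_minus)
  have "f w = rim w (- z)" for w
    by (rule linear_eq_axis[OF f linear_rim(2) fs])
  then show ?thesis unfolding EH_eq by blast
qed

text \<open>The Clifford relation of imaginary quaternions. Moving the Reeb vectors along EH thus
  changes the symmetric part by a multiple of the metric of W, and \<open>EH_I\<close> shows that
  only EH does so.\<close>

lemma rim_conformal: "om (rim w z) v \<bullet> w' + om (rim w' z) v \<bullet> w = - 2 * (z \<bullet> v) * (w \<bullet> w')"
proof -
  have "rim w' (rim w z) + rim w (rim w' z) = rmul z (qmul (q_of_im w) (q_of_im w') + qmul (q_of_im w') (q_of_im w))"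
    by (simp add: rim_def rmul_rmul rmul_distribs)
  also have "qmul (q_of_im w) (q_of_im w') + qmul (q_of_im w') (q_of_im w) = (- 2 * (w \<bullet> w')) *\<^sub>R qone"
    by (simp add: quat_eq_iff inner_3 algebra_simps)
  finally have "(rim w' (rim w z) + rim w (rim w' z)) \<bullet> v = ((- 2 * (w \<bullet> w')) *\<^sub>R z) \<bullet> v"
    by (simp only: rmul_distribs rmul_qone)
  then show ?thesis by (simp add: om_inner inner_add)
qed

lemma inner_act_W:
  assumes "p \<noteq> 0" shows "act_W p w \<bullet> act_W p w' = (1 / norm p ^ 4) * (w \<bullet> w')"
proof -
  have "act_Im p w \<bullet> act_Im p w' = norm p ^ 4 * (w \<bullet> w')"
    using act_Im_inner[of "qconj p" w "act_Im p w'"] act_Im_inverse[of "qconj p" w'] by (simp add: norm_eq_sqrt_inner inner_4)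
  then show ?thesis using assms by (simp add: act_W_eq)
qed

lemma linear_act_V: "linear (act_V g p)"
  by (rule linearI; rule vec_eq_iff[THEN iffD2];
      simp add: act_V_def qmul_distribs sum.distrib qmul_sum_left scaleR_sum_right)

lemma linear_act_W: "p \<noteq> 0 \<Longrightarrow> linear (act_W p)"
  by (rule linearI; simp add: act_W_eq linear_add[OF linear_act_Im] linear_cmul[OF linear_act_Im] algebra_simps)

lemma bij_act:
  fixes g :: "real^4^'n::finite^'n"
  assumes "g \<in> Sp" "p \<noteq> 0" shows "bij (act_V g p)" "bij (act_W p)"
proof -
  have "v = 0" if "act_W p v = 0" for v
    using inner_act_W[OF assms(2), of v v] that assms(2) by simp
  then have "inj (act_W p)" using linear_injective_0[OF linear_act_W[OF assms(2)]] by blast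
  then show "bij (act_W p)" by (simp add: bij_def linear_injective_imp_surjective[OF linear_act_W[OF assms(2)]])
  have "v = 0" if "act_V g p v = 0" for v :: "real^4^'n"
  proof -
    have "rmul (rmul (\<chi> i. \<Sum>j\<in>UNIV. qmul (g$i$j) (v$j)) (qinv p)) p = 0"
      using that by (simp add: act_V_rmul rmul_distribs)
    then have "hprod v v = 0"
      using hprod_Sp[OF assms(1), of v v] assms(2) by (simp add: rmul_rmul hprod_def qmul_distribs)
    then show "v = 0" using hprod_nth1[of v v] by simp
  qed
  then have "inj (act_V g p)" using linear_injective_0[OF linear_act_V] by blast
  then show "bij (act_V g p)" by (simp add: bij_def linear_injective_imp_surjective[OF linear_act_V])
qed

lemma semidirect_iff:
  "b \<in> semidirect F \<longleftrightarrow> (\<exists>g p f. g \<in> Sp \<and> p \<noteq> 0 \<and> f \<in> F \<and> (\<forall>v w. b (v, w) = (act_V g p v + f (act_W p w), act_W p w)))"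
  unfolding semidirect_def by (auto simp: fun_eq_iff)

text \<open>\<open>B\<close> is the stabilizer of the class of \<open>\<Theta>\<^sub>0\<close>, which is read off from its \<open>W\<close>-component on \<open>V\<close>.\<close>
lemma B_group_iff:
  fixes b :: "'n::finite model \<Rightarrow> 'n model"
  shows "b \<in> B_group \<longleftrightarrow> linear b \<and> bij b \<and> (\<forall>v. snd (b (v, 0)) = 0) \<and>
    (\<forall>v v'. om (fst (b (v, 0))) (fst (b (v', 0))) = snd (b (0, om v v')))"
proof
  assume "b \<in> B_group"
  then obtain g p f where g: "g \<in> Sp" "p \<noteq> 0" "linear f" "\<And>v w. b (v, w) = (act_V g p v + f (act_W p w), act_W p w)"
    unfolding B_group_def semidirect_iff by auto
  have lin: "linear b"
  proof (rule linearI)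
    fix x y :: "'n model" and c :: real
    obtain v w v' w' where "x = (v, w)" "y = (v', w')" by fastforce
    then show "b (x + y) = b x + b y" "b (c *\<^sub>R x) = c *\<^sub>R b x"
      using linear_act_V[of g p] linear_act_W[OF g(2)] g(3) by (simp_all add: g(4) linear_add linear_cmul scaleR_add_right)
  qed
  have "x = 0" if "b x = 0" for x
  proof -
    obtain v w where x: "x = (v, w)" by fastforce
    have "act_W p w = 0" using that by (simp add: x g(4) zero_prod_def)
    then have "w = 0" using bij_act(2)[OF g(1,2)] linear_injective_0[OF linear_act_W[OF g(2)]] by (simp add: bij_def)
    moreover have "act_V g p v = 0" using that \<open>act_W p w = 0\<close> linear_0[OF g(3)] by (simp add: x g(4) zero_prod_def)
    then have "v = 0" using bij_act(1)[OF g(1,2)] linear_injective_0[OF linear_act_V[of g p]] by (simp add: bij_def)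
    ultimately show ?thesis by (simp add: x zero_prod_def)
  qed
  then have "bij b" using linear_injective_0[OF lin] linear_injective_imp_surjective[OF lin] by (auto simp: bij_def)
  then show "linear b \<and> bij b \<and> (\<forall>v. snd (b (v, 0)) = 0) \<and>
    (\<forall>v v'. om (fst (b (v, 0))) (fst (b (v', 0))) = snd (b (0, om v v')))"
    using lin linear_0[OF linear_act_W[OF g(2)]] linear_0[OF g(3)] om_act[OF g(1,2)] by (simp add: g(4))
next
  assume b: "linear b \<and> bij b \<and> (\<forall>v. snd (b (v, 0)) = 0) \<and>
    (\<forall>v v'. om (fst (b (v, 0))) (fst (b (v', 0))) = snd (b (0, om v v')))"
  define A where "A v = fst (b (v, 0))" for v
  define \<rho> where "\<rho> w = snd (b (0, w))" for w
  have add: "b (x + y) = b x + b y" and cmul: "b (c *\<^sub>R x) = c *\<^sub>R b x" for x y c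
    using b by (simp_all add: linear_add linear_cmul)
  have bd: "b (v, w) = (A v, 0) + b (0, w)" for v w
    using add[of "(v, 0)" "(0, w)"] b by (simp add: A_def prod_eq_iff)
  have lA: "linear A"
    using add[of "(_, 0)" "(_, 0)"] cmul[of _ "(_, 0)"] by (intro linearI) (simp_all add: A_def)
  have l\<rho>: "linear \<rho>"
    using add[of "(0, _)" "(0, _)"] cmul[of _ "(0, _)"] by (intro linearI) (simp_all add: \<rho>_def)
  have "v = 0" if "A v = 0" for v
  proof -
    have "b (v, 0) = b (0, 0)" using bd[of v 0] that by (simp add: zero_prod_def[symmetric])
    then show ?thesis using b by (metis bij_def inj_eq prod.inject)
  qed
  then have "bij A" using linear_injective_0[OF lA] linear_injective_imp_surjective[OF lA] by (auto simp: bij_def)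
  moreover have "om (A v) (A v') = \<rho> (om v v')" for v v' using b by (simp add: A_def \<rho>_def)
  ultimately obtain g p where g: "g \<in> Sp" "p \<noteq> 0" "A = act_V g p" "\<rho> = act_W p"
    using conjugation_in_group[OF lA _ l\<rho>] by blast
  \<comment> \<open>In \<open>semidirect\<close> the homomorphism is applied after
    \<open>act_W\<close>; hence the inverse.\<close>
  define f where "f w = fst (b (0, inv (act_W p) w))" for w
  have l: "linear (inv (act_W p))" by (rule linear_inv[OF linear_act_W[OF g(2)] bij_act(2)[OF g(1,2)]])
  have "linear f"
    using add[of "(0, _)" "(0, _)"] cmul[of _ "(0, _)"] by (intro linearI) (simp_all add: f_def linear_add[OF l] linear_cmul[OF l])
  moreover have "b (v, w) = (act_V g p v + f (act_W p w), act_W p w)" for v w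
  proof -
    have "inv (act_W p) (act_W p w) = w" using bij_act(2)[OF g(1,2)] by (simp add: bij_def)
    moreover have "snd (b (0, w)) = act_W p w" using g(4) by (simp add: \<rho>_def fun_eq_iff)
    ultimately show ?thesis using bd[of v w] by (simp add: f_def g(3) prod_eq_iff)
  qed
  ultimately show "b \<in> B_group" unfolding B_group_def semidirect_iff using g by blast
qed

section \<open>Lie algebras of linear groups\<close>

locale linear_group =
  fixes G :: "('e::euclidean_space \<Rightarrow> 'e) set"
  assumes lin: "g \<in> G \<Longrightarrow> linear g" and bij: "g \<in> G \<Longrightarrow> bij g" and id: "id \<in> G"
    and comp: "g \<in> G \<Longrightarrow> h \<in> G \<Longrightarrow> g \<circ> h \<in> G" and inv: "g \<in> G \<Longrightarrow> inv g \<in> G"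
begin

lemma lie_algebraI:
  assumes "linear A" "\<And>t. \<gamma> t \<in> G" "\<gamma> 0 = id" "\<And>v. smooth_on UNIV (\<lambda>t::real. \<gamma> t v)"
    "\<And>v. ((\<lambda>t. \<gamma> t v) has_vector_derivative A v) (at 0)"
  shows "A \<in> lie_algebra G"
  using assms unfolding lie_algebra_def by blast

lemma lie_algebra_0: "(\<lambda>v. 0) \<in> lie_algebra G"
  by (rule lie_algebraI[where \<gamma> = "\<lambda>t. id"]) (simp_all add: id linear_zero)

text \<open>Velocities add along the pointwise product of two curves through the identity.\<close>

lemma lie_algebra_add:
  assumes "A \<in> lie_algebra G" "B \<in> lie_algebra G"
  shows "(\<lambda>v. A v + B v) \<in> lie_algebra G"
proof -
  obtain \<gamma> \<delta> where A: "linear A" "\<And>t. \<gamma> t \<in> G" "\<gamma> 0 = id" "\<And>v. smooth_on UNIV (\<lambda>t::real. \<gamma> t v)"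
    "\<And>v. ((\<lambda>t. \<gamma> t v) has_vector_derivative A v) (at 0)"
    and B: "linear B" "\<And>t. \<delta> t \<in> G" "\<delta> 0 = id" "\<And>v. smooth_on UNIV (\<lambda>t::real. \<delta> t v)"
    "\<And>v. ((\<lambda>t. \<delta> t v) has_vector_derivative B v) (at 0)"
    using assms unfolding lie_algebra_def by blast
  show ?thesis
  proof (rule lie_algebraI[where \<gamma> = "\<lambda>t. \<gamma> t \<circ> \<delta> t"])
    show "linear (\<lambda>v. A v + B v)" by (rule linear_compose_add[OF A(1) B(1)])
    show "smooth_on UNIV (\<lambda>t. (\<gamma> t \<circ> \<delta> t) v)" for v
      using smooth_on_apply[of UNIV \<gamma> "\<lambda>t. \<delta> t v"] A(2,4) B(4) lin by simp
    show "((\<lambda>t. (\<gamma> t \<circ> \<delta> t) v) has_vector_derivative A v + B v) (at 0)" for v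
    proof -
      have d: "((\<lambda>t. \<delta> t v) has_derivative (\<lambda>t. t *\<^sub>R B v)) (at 0)"
        using B(5) by (simp add: has_vector_derivative_def)
      have "frechet_derivative (\<lambda>t. \<gamma> t v) (at 0) = (\<lambda>t. t *\<^sub>R A v)"
        using A(5)[of v] unfolding has_vector_derivative_def by (metis frechet_derivative_at)
      then show ?thesis
        using has_derivative_apply[of UNIV 0 \<gamma> "\<lambda>t. \<delta> t v", OF _ _ _ A(4) d] A(2,3) B(3) lin
        by (simp add: has_vector_derivative_def scaleR_add_right)
    qed
  qed (use A B comp in auto)
qed

lemma lie_algebra_scaleR:
  assumes "A \<in> lie_algebra G"
  shows "(\<lambda>v. c *\<^sub>R A v) \<in> lie_algebra G"
proof -
  obtain \<gamma> where A: "linear A" "\<And>t. \<gamma> t \<in> G" "\<gamma> 0 = id" "\<And>v. smooth_on UNIV (\<lambda>t::real. \<gamma> t v)"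
    "\<And>v. ((\<lambda>t. \<gamma> t v) has_vector_derivative A v) (at 0)"
    using assms unfolding lie_algebra_def by blast
  show ?thesis
  proof (rule lie_algebraI[where \<gamma> = "\<lambda>t. \<gamma> (c * t)"])
    show "linear (\<lambda>v. c *\<^sub>R A v)" by (rule linear_compose_scale_right[OF A(1)])
    show "smooth_on UNIV (\<lambda>t. \<gamma> (c * t) v)" for v
      by (rule smooth_on_compose[OF open_UNIV smooth_on_mult[OF open_UNIV smooth_on_const smooth_on_ident[OF open_UNIV]] A(4)]) simp
    show "((\<lambda>t. \<gamma> (c * t) v) has_vector_derivative c *\<^sub>R A v) (at 0)" for v
    proof -
      have "((\<lambda>t. \<gamma> t v) has_derivative (\<lambda>t. t *\<^sub>R A v)) (at (c * 0))"
        using A(5) by (simp add: has_vector_derivative_def)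
      moreover have "((\<lambda>t. c * t) has_derivative (\<lambda>t. c * t)) (at 0)"
        by (rule has_derivative_mult_right[OF has_derivative_ident])
      ultimately have "((\<lambda>t. \<gamma> (c * t) v) has_derivative (\<lambda>t. (c * t) *\<^sub>R A v)) (at 0)"
        by (rule has_derivative_compose[rotated])
      then show ?thesis by (simp add: has_vector_derivative_def mult.commute)
    qed
  qed (use A in auto)
qed

lemma lie_algebra_minus: "A \<in> lie_algebra G \<Longrightarrow> (\<lambda>v. - A v) \<in> lie_algebra G"
  using lie_algebra_scaleR[of A "-1"] by simp

lemma lie_algebra_diff: "A \<in> lie_algebra G \<Longrightarrow> B \<in> lie_algebra G \<Longrightarrow> (\<lambda>v. A v - B v) \<in> lie_algebra G"
  using lie_algebra_add[of A "\<lambda>v. - B v"] lie_algebra_minus[of B] by simp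

lemma coker_class_eqI:
  assumes a: "\<And>X. a X \<in> lie_algebra G" "\<And>Y. linear (\<lambda>X. a X Y)"
    and \<theta>: "\<And>X Y. \<theta>' X Y = \<theta> X Y + (a X Y - a Y X)"
  shows "coker_class G \<theta>' = coker_class G \<theta>"
proof (intro equalityI subsetI)
  fix x assume "x \<in> coker_class G \<theta>'"
  then obtain b where b: "x = (\<lambda>X Y. \<theta>' X Y + partial_map b X Y)" "\<And>X. b X \<in> lie_algebra G" "\<And>Y. linear (\<lambda>X. b X Y)"
    unfolding coker_class_def by blast
  have "x = (\<lambda>X Y. \<theta> X Y + partial_map (\<lambda>X Y. a X Y + b X Y) X Y)"
    by (simp add: b(1) \<theta> partial_map_def fun_eq_iff)
  then show "x \<in> coker_class G \<theta>"
    unfolding coker_class_def using lie_algebra_add[OF a(1) b(2)] linear_compose_add[OF a(2) b(3)] by blast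
next
  fix x assume "x \<in> coker_class G \<theta>"
  then obtain b where b: "x = (\<lambda>X Y. \<theta> X Y + partial_map b X Y)" "\<And>X. b X \<in> lie_algebra G" "\<And>Y. linear (\<lambda>X. b X Y)"
    unfolding coker_class_def by blast
  have "x = (\<lambda>X Y. \<theta>' X Y + partial_map (\<lambda>X Y. b X Y - a X Y) X Y)"
    by (simp add: b(1) \<theta> partial_map_def fun_eq_iff)
  then show "x \<in> coker_class G \<theta>'"
    unfolding coker_class_def using lie_algebra_diff[OF b(2) a(1)] linear_compose_sub[OF b(3) a(2)] by blast
qed

lemma mem_coker_class: "\<theta> \<in> coker_class G \<theta>"
  unfolding coker_class_def
  using lie_algebra_0 by (intro CollectI exI[of _ "\<lambda>X Y. 0"]) (simp add: partial_map_def fun_eq_iff linear_zero)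

text \<open>The curves in the definition of the Lie algebra are defined for all times; so a family that is only
  defined near a point is composed with a bounded reparametrization.\<close>
lemma lie_algebra_family:
  fixes h :: "'a::euclidean_space \<Rightarrow> 'e \<Rightarrow> 'e"
  assumes S: "open S" "p \<in> S" and h: "\<And>y. y \<in> S \<Longrightarrow> h y \<in> G" "\<And>v. smooth_on S (\<lambda>y. h y v)" and "h p = id"
  shows "(\<lambda>v. frechet_derivative (\<lambda>y. h y v) (at p) X) \<in> lie_algebra G"
proof -
  obtain r where r: "r > 0" "ball p r \<subseteq> S" using S open_contains_ball by blast
  \<comment> \<open>The reparametrization \<open>e sin (t / e)\<close> vanishes at 0 with derivative
    1 and is bounded by \<open>e\<close>, so the curve never leaves the ball of radius
    \<open>r\<close>.\<close>
  define e where "e = r / (norm X + 1)"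
  have nX: "norm X + 1 > 0" by (smt (verit) norm_ge_zero)
  have e: "e > 0" using r nX by (simp add: e_def)
  define \<phi> where "\<phi> t = e * sin (t / e)" for t :: real
  have in_S: "p + \<phi> t *\<^sub>R X \<in> S" for t
  proof -
    have "norm (\<phi> t *\<^sub>R X) \<le> e * norm X"
      using e abs_sin_le_one[of "t / e"] by (simp add: \<phi>_def abs_mult mult_left_le mult_right_mono)
    also have "\<dots> < e * (norm X + 1)" using e by simp
    also have "\<dots> = r" using nX by (simp add: e_def)
    finally show ?thesis using r(2) by (auto simp: dist_norm subset_iff)
  qed
  have s\<phi>: "smooth_on UNIV (\<lambda>t. p + \<phi> t *\<^sub>R X)"
    unfolding \<phi>_def divide_inverse
    by (intro smooth_on_add smooth_on_scaleR smooth_on_mult smooth_on_sin smooth_on_const smooth_on_ident open_UNIV)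
  have d\<phi>: "((\<lambda>t. p + \<phi> t *\<^sub>R X) has_derivative (\<lambda>t. t *\<^sub>R X)) (at 0)"
    unfolding \<phi>_def using e by (auto intro!: derivative_eq_intros simp: field_simps)
  show ?thesis
  proof (rule lie_algebraI[where \<gamma> = "\<lambda>t. h (p + \<phi> t *\<^sub>R X)"])
    show "linear (\<lambda>v. frechet_derivative (\<lambda>y. h y v) (at p) X)"
      by (rule linear_frechet_family[OF S lin[OF h(1)] h(2)])
    show "smooth_on UNIV (\<lambda>t. h (p + \<phi> t *\<^sub>R X) v)" for v
      by (rule smooth_on_compose[OF open_UNIV s\<phi> h(2)]) (use in_S in auto)
    show "((\<lambda>t. h (p + \<phi> t *\<^sub>R X) v) has_vector_derivative frechet_derivative (\<lambda>y. h y v) (at p) X) (at 0)" for v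
    proof -
      have hd: "((\<lambda>y. h y v) has_derivative frechet_derivative (\<lambda>y. h y v) (at p)) (at (p + \<phi> 0 *\<^sub>R X))"
        using smooth_on_has_derivative[OF h(2) S(2)] by (simp add: \<phi>_def)
      show ?thesis
        unfolding has_vector_derivative_def
        using has_derivative_compose[OF d\<phi> hd] linear_cmul[OF has_derivative_linear[OF hd]] by simp
    qed
  qed (use h(1) in_S \<open>h p = id\<close> in \<open>auto simp: \<phi>_def\<close>)
qed

end

text \<open>Products are checked with the stabilizer condition \<open>B_group_iff\<close>, inverses
  with the block form of the semidirect product, whose diagonal blocks are invertible.\<close>

interpretation B: linear_group "B_group :: ('n::finite model \<Rightarrow> 'n model) set"
proof (rule linear_group.intro)
  show "linear g" "bij g" if "g \<in> B_group" for g :: "'n model \<Rightarrow> 'n model"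
    using that B_group_iff by blast+
  show "(id :: 'n model \<Rightarrow> 'n model) \<in> B_group" by (simp add: B_group_iff linear_id)
  fix g h :: "'n model \<Rightarrow> 'n model" assume "g \<in> B_group" "h \<in> B_group"
  then have gh: "linear g" "bij g" "\<And>v. snd (g (v, 0)) = 0" "\<And>v v'. om (fst (g (v, 0))) (fst (g (v', 0))) = snd (g (0, om v v'))"
    "linear h" "bij h" "\<And>v. snd (h (v, 0)) = 0" "\<And>v v'. om (fst (h (v, 0))) (fst (h (v', 0))) = snd (h (0, om v v'))"
    unfolding B_group_iff by blast+
  have sg: "snd (g X) = snd (g (0, snd X))" for X
  proof -
    have "g X = g (fst X, 0) + g (0, snd X)" using linear_add[OF gh(1), of "(fst X, 0)" "(0, snd X)"] by simp
    then show ?thesis by (simp add: gh(3))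
  qed
  have hv: "h (v, 0) = (fst (h (v, 0)), 0)" for v using gh(7) by (simp add: prod_eq_iff)
  have "om (fst (g (h (v, 0)))) (fst (g (h (v', 0)))) = snd (g (h (0, om v v')))" for v v'
    by (subst (1 2) hv) (simp add: gh(4) gh(8) sg[of "h _"])
  moreover have "snd (g (h (v, 0))) = 0" for v by (subst hv) (simp add: gh(3))
  ultimately show "g \<circ> h \<in> B_group"
    unfolding B_group_iff by (simp add: linear_compose[OF gh(5,1)] bij_comp[OF gh(6,2)])
next
  fix g :: "'n model \<Rightarrow> 'n model" assume "g \<in> B_group"
  then obtain a p f where g: "a \<in> Sp" "p \<noteq> 0" "linear f" "\<And>v w. g (v, w) = (act_V a p v + f (act_W p w), act_W p w)"
    and l: "linear g" "bij g"
    using B_group_iff[of g] unfolding B_group_def semidirect_iff by auto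
  have i: "inv g (g X) = X" "g (inv g X) = X" for X using l(2) by (auto simp: bij_def surj_f_inv_f)
  have W: "inv (act_W p) (act_W p w) = w" "act_W p (inv (act_W p) w) = w" for w
    using bij_act(2)[OF g(1,2)] by (auto simp: bij_def surj_f_inv_f)
  have V: "act_V a p (inv (act_V a p) v) = v" for v
    using bij_act(1)[OF g(1,2)] by (simp add: bij_def surj_f_inv_f)
  have V0: "inv g (v, 0) = (inv (act_V a p) v, 0)" for v
    using i(1)[of "(inv (act_V a p) v, 0)"] by (simp add: g(4) V linear_0[OF g(3)] linear_0[OF linear_act_W[OF g(2)]])
  have sW: "snd (inv g (0, w)) = inv (act_W p) w" for w
  proof -
    obtain v w' where "inv g (0, w) = (v, w')" by fastforce
    then have "act_W p w' = w" using i(2)[of "(0, w)"] by (simp add: g(4))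
    then show ?thesis using W(1) \<open>inv g (0, w) = (v, w')\<close> by auto
  qed
  have "om (inv (act_V a p) v) (inv (act_V a p) v') = inv (act_W p) (om v v')" for v v'
    using om_act[OF g(1,2), of "inv (act_V a p) v" "inv (act_V a p) v'"] W(1) by (metis V)
  then show "inv g \<in> B_group"
    unfolding B_group_iff by (simp add: linear_inv[OF l] bij_imp_bij_inv[OF l(2)] V0 sW)
qed

text \<open>The conformal factor is written as the squared length of the image of the unit vector
  \<open>q_i\<close>; in this form it can be differentiated along a family in the group.\<close>

lemma B_group_conformal:
  assumes "b \<in> B_group"
  shows "snd (b (0, w)) \<bullet> snd (b (0, w')) = (snd (b (0, q_i)) \<bullet> snd (b (0, q_i))) * (w \<bullet> w')"
proof -
  obtain g p f where g: "p \<noteq> 0" "\<And>v w. b (v, w) = (act_V g p v + f (act_W p w), act_W p w)"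
    using assms unfolding B_group_def semidirect_iff by auto
  have "q_i \<bullet> q_i = 1" by (simp add: inner_3)
  then show ?thesis by (simp add: g(2) inner_act_W[OF g(1)])
qed

text \<open>\<open>f w y\<close> is the image of \<open>w\<close> under a conformal map with
  parameter \<open>y\<close>. The result serves both for the Lie algebra of B and for the transition
  between two good sections.\<close>

lemma conformal_derivative:
  fixes f :: "real^3 \<Rightarrow> 'a::real_normed_vector \<Rightarrow> real^3"
  assumes f: "\<And>w. (f w has_derivative f' w) (at p)"
    and S: "open S" "p \<in> S" "\<And>y w w'. y \<in> S \<Longrightarrow> f w y \<bullet> f w' y = (f q_i y \<bullet> f q_i y) * (w \<bullet> w')"
  shows "f' w X \<bullet> f w' p + f' w' X \<bullet> f w p = 2 * (f' q_i X \<bullet> f q_i p) * (w \<bullet> w')"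
proof -
  have "((\<lambda>y. f w y \<bullet> f w' y) has_derivative (\<lambda>X. f w p \<bullet> f' w' X + f' w X \<bullet> f w' p)) (at p)"
    by (rule has_derivative_inner[OF f f])
  then have "((\<lambda>y. (f q_i y \<bullet> f q_i y) * (w \<bullet> w')) has_derivative (\<lambda>X. f w p \<bullet> f' w' X + f' w X \<bullet> f w' p)) (at p)"
    by (rule has_derivative_transform_within_open[OF _ S(1,2)]) (rule S(3))
  moreover have "((\<lambda>y. (f q_i y \<bullet> f q_i y) * (w \<bullet> w')) has_derivative
      (\<lambda>X. (f q_i p \<bullet> f' q_i X + f' q_i X \<bullet> f q_i p) * (w \<bullet> w'))) (at p)"
    by (intro has_derivative_mult_left has_derivative_inner f)
  ultimately have "(\<lambda>X. f w p \<bullet> f' w' X + f' w X \<bullet> f w' p) = (\<lambda>X. (f q_i p \<bullet> f' q_i X + f' q_i X \<bullet> f q_i p) * (w \<bullet> w'))"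
    by (rule has_derivative_unique)
  then have "f w p \<bullet> f' w' X + f' w X \<bullet> f w' p = (f q_i p \<bullet> f' q_i X + f' q_i X \<bullet> f q_i p) * (w \<bullet> w')" by meson
  then show ?thesis by (simp add: inner_commute[of _ "f' _ _"])
qed

text \<open>Derivatives at the identity of the invariance of V and of conformality on W. The
  converse direction uses nothing else about this Lie algebra.\<close>

lemma lie_algebra_B_D:
  assumes "A \<in> lie_algebra B_group"
  shows "snd (A (v, 0)) = 0"
    "snd (A (0, w)) \<bullet> w' + snd (A (0, w')) \<bullet> w = 2 * (snd (A (0, q_i)) \<bullet> q_i) * (w \<bullet> w')"
proof -
  obtain \<gamma> where A: "\<And>t. \<gamma> t \<in> B_group" "\<gamma> 0 = id"
    "\<And>v. ((\<lambda>t::real. \<gamma> t v) has_derivative (\<lambda>t. t *\<^sub>R A v)) (at 0)"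
    using assms unfolding lie_algebra_def has_vector_derivative_def by blast
  have d: "((\<lambda>t. snd (\<gamma> t X)) has_derivative (\<lambda>t. t *\<^sub>R snd (A X))) (at 0)" for X
    using has_derivative_snd[OF A(3)[of X]] by simp
  have "snd (\<gamma> t (v, 0)) = 0" for t using A(1) B_group_iff by blast
  then have "((\<lambda>t::real. 0) has_derivative (\<lambda>t. t *\<^sub>R snd (A (v, 0)))) (at 0)" using d[of "(v, 0)"] by simp
  then have "(\<lambda>t::real. t *\<^sub>R snd (A (v, 0))) = (\<lambda>t. 0)" using has_derivative_unique has_derivative_const by blast
  then show "snd (A (v, 0)) = 0" by (metis scaleR_one)
  show "snd (A (0, w)) \<bullet> w' + snd (A (0, w')) \<bullet> w = 2 * (snd (A (0, q_i)) \<bullet> q_i) * (w \<bullet> w')"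
  proof -
    have "snd (\<gamma> 0 (0, w)) = w" for w using A(2) by simp
    from conformal_derivative[where f = "\<lambda>w t. snd (\<gamma> t (0, w))" and X = 1, OF d open_UNIV UNIV_I B_group_conformal[OF A(1)]] this
    show ?thesis by simp
  qed
qed

section \<open>Explicit elements of the Lie algebra of B\<close>

text \<open>The derivative at \<open>r = 1\<close> in direction \<open>q\<close> of right
  multiplication by \<open>r\<close> on V with conjugate(r) w r on W. This is the action of the
  inverse \<open>p\<close> of \<open>r\<close>, written in the form that is polynomial in
  \<open>r\<close>.\<close>

definition quat_infinitesimal :: "real^4 \<Rightarrow> 'n::finite model \<Rightarrow> 'n model" where
  "quat_infinitesimal q X =
     (rmul (fst X) q, im_part (qmul (qconj q) (q_of_im (snd X)) + qmul (q_of_im (snd X)) q))"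

lemma bij_linear_injective:
  fixes f :: "'a::euclidean_space \<Rightarrow> 'a"
  assumes "linear f" "\<And>x. f x = 0 \<Longrightarrow> x = 0" shows "bij f"
  using assms linear_injective_0[OF assms(1)] linear_injective_imp_surjective[OF assms(1)] by (auto simp: bij_def)

lemma rmul_act_Im_B_group:
  assumes "r \<noteq> 0"
  shows "(\<lambda>X. (rmul (fst X) r, act_Im (qconj r) (snd X))) \<in> B_group"
proof -
  let ?b = "\<lambda>X. (rmul (fst X) r, act_Im (qconj r) (snd X))"
  have lin: "linear ?b"
    by (rule linearI) (simp_all add: rmul_distribs linear_add[OF linear_act_Im] linear_cmul[OF linear_act_Im])
  have "bij ?b"
  proof (rule bij_linear_injective[OF lin])
    fix X assume "?b X = 0"
    then have 0: "rmul (fst X) r = 0" "act_Im (qconj r) (snd X) = 0" by (simp_all add: zero_prod_def)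
    from 0(2) have "snd X = 0"
      using act_Im_inverse[of r "snd X"] assms by (simp add: linear_0[OF linear_act_Im])
    moreover have "rmul (rmul (fst X) r) (qinv r) = 0" unfolding 0 by (simp add: rmul_distribs)
    then have "fst X = 0" using assms by (simp add: rmul_rmul)
    ultimately show "X = 0" by (simp add: prod_eq_iff)
  qed
  moreover have "om (rmul v r) (rmul v' r) = act_Im (qconj r) (om v v')" for v v' :: "real^4^'a"
  proof -
    have "om (rmul v r) (rmul v' r) = im_part (qmul (qconj r) (qmul (hprod v v') r))"
      by (simp add: hprod_rmul flip: im_hprod)
    also have "\<dots> = act_Im (qconj r) (om v v')"
      by (simp add: hprod_decomp act_Im_def im_eq_iff algebra_simps)
    finally show ?thesis .
  qed
  ultimately show ?thesis
    unfolding B_group_iff by (simp add: lin linear_0[OF linear_act_Im])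
qed

text \<open>The curve through \<open>exp (c t) (1 + t u)\<close> for \<open>q = c + u\<close> with \<open>u\<close> imaginary.\<close>
lemma lie_algebra_B_quat: "quat_infinitesimal q \<in> lie_algebra B_group"
proof -
  define u where "u = q_of_im (im_part q)"
  have q: "q = q$1 *\<^sub>R qone + u" by (simp add: u_def quat_eq_iff)
  \<comment> \<open>Real part 1 in one factor and positivity of the other keep the curve away from 0
    for all times.\<close>
  define r where "r t = exp (q$1 * t) *\<^sub>R (qone + t *\<^sub>R u)" for t
  have r0: "r t \<noteq> 0" for t
  proof
    assume "r t = 0"
    then have "r t $ 1 = 0" by simp
    then show False by (simp add: r_def u_def)
  qed
  have sr: "smooth_on UNIV r"
    unfolding r_def
    by (intro smooth_on_add smooth_on_scaleR smooth_on_mult smooth_on_exp smooth_on_const smooth_on_ident open_UNIV)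
  have dr: "(r has_vector_derivative q) (at 0)"
  proof -
    have "((\<lambda>t. exp (q$1 * t)) has_real_derivative q$1) (at 0)"
      by (auto intro!: derivative_eq_intros)
    moreover have "((\<lambda>t. qone + t *\<^sub>R u) has_vector_derivative u) (at 0)"
      by (auto intro!: derivative_eq_intros)
    ultimately have "(r has_vector_derivative (exp (q$1 * 0) *\<^sub>R u + q$1 *\<^sub>R (qone + 0 *\<^sub>R u))) (at 0)"
      unfolding r_def by (rule has_vector_derivative_scaleR)
    moreover have "exp (q$1 * 0) *\<^sub>R u + q$1 *\<^sub>R (qone + 0 *\<^sub>R u) = q" by (subst (3) q) simp
    ultimately show ?thesis by simp
  qed
  have r1: "r 0 = qone" by (simp add: r_def)
  have sc: "smooth_on UNIV (\<lambda>t. qconj (r t))" by (rule smooth_on_linear[OF linear_qconj open_UNIV sr])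
  have dc: "((\<lambda>t. qconj (r t)) has_vector_derivative qconj q) (at 0)"
    using bounded_linear.has_vector_derivative[OF _ dr, of qconj] linear_qconj by (simp add: linear_conv_bounded_linear)
  have c1: "qconj qone = qone" by (simp add: quat_eq_iff)
  show ?thesis
  proof (rule B.lie_algebraI[where \<gamma> = "\<lambda>t X. (rmul (fst X) (r t), act_Im (qconj (r t)) (snd X))"])
    show "linear (quat_infinitesimal q :: 'a model \<Rightarrow> _)"
      by (rule linearI) (simp_all add: quat_infinitesimal_def rmul_distribs im_eq_iff algebra_simps)
    show "(\<lambda>X. (rmul (fst X) (r t), act_Im (qconj (r t)) (snd X))) \<in> B_group" for t
      by (rule rmul_act_Im_B_group[OF r0])
    show "(\<lambda>X. (rmul (fst X) (r 0), act_Im (qconj (r 0)) (snd X))) = id"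
      by (simp add: r1 c1 act_Im_def fun_eq_iff im_eq_iff)
    fix X :: "'a model"
    have bb: "bounded_bilinear (rmul :: real^4^'a \<Rightarrow> _)"
      using bilinear_rightmul by (simp add: bilinear_conv_bounded_bilinear)
    have bi: "bounded_linear im_part" using linear_im_part by (simp add: linear_conv_bounded_linear)
    show "smooth_on UNIV (\<lambda>t. (rmul (fst X) (r t), act_Im (qconj (r t)) (snd X)))"
      unfolding act_Im_def qconj_qconj
      by (intro smooth_on_Pair open_UNIV smooth_on_bilinear[OF bb] smooth_on_const sr smooth_on_bounded_linear[OF bi]
          smooth_on_bilinear[OF bounded_bilinear_qmul] sc)
    have "((\<lambda>t. rmul (fst X) (r t)) has_vector_derivative (rmul (fst X) q)) (at 0)"
      using bounded_linear.has_vector_derivative[OF bounded_bilinear.bounded_linear_right[OF bb] dr] .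
    moreover have "((\<lambda>t. qmul (qmul (qconj (r t)) (q_of_im (snd X))) (r t)) has_vector_derivative
        qmul (qmul (qconj (r 0)) (q_of_im (snd X))) q + qmul (qmul (qconj q) (q_of_im (snd X))) (r 0)) (at 0)"
      using bounded_bilinear.has_vector_derivative[OF bounded_bilinear_qmul
          bounded_linear.has_vector_derivative[OF bounded_bilinear.bounded_linear_left[OF bounded_bilinear_qmul] dc] dr] .
    from bounded_linear.has_vector_derivative[OF bi this]
    have "((\<lambda>t. act_Im (qconj (r t)) (snd X)) has_vector_derivative snd (quat_infinitesimal q X)) (at 0)"
      by (simp add: act_Im_def quat_infinitesimal_def r1 c1 add.commute)
    ultimately show "((\<lambda>t. (rmul (fst X) (r t), act_Im (qconj (r t)) (snd X))) has_vector_derivative quat_infinitesimal q X) (at 0)"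
      using has_vector_derivative_Pair by (fastforce simp: quat_infinitesimal_def)
  qed
qed

lemma lie_algebra_B_Hom:
  assumes f: "linear f"
  shows "(\<lambda>X. (f (snd X), 0)) \<in> lie_algebra B_group"
proof (rule B.lie_algebraI[where \<gamma> = "\<lambda>t X. (fst X + t *\<^sub>R f (snd X), snd X)"])
  show "linear (\<lambda>X. (f (snd X), 0))" by (rule linearI) (simp_all add: linear_add[OF f] linear_cmul[OF f])
  fix t :: real
  let ?b = "\<lambda>X. (fst X + t *\<^sub>R f (snd X), snd X)"
  have lin: "linear ?b"
    by (rule linearI) (simp_all add: linear_add[OF f] linear_cmul[OF f] algebra_simps)
  have "bij ?b"
    by (rule bij_linear_injective[OF lin]) (auto simp: zero_prod_def linear_0[OF f])
  then show "?b \<in> B_group" by (simp add: B_group_iff lin linear_0[OF f])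
next
  show "(\<lambda>X. (fst X + 0 *\<^sub>R f (snd X), snd X)) = id" by (simp add: fun_eq_iff)
  fix X :: "'a model"
  show "smooth_on UNIV (\<lambda>t. (fst X + t *\<^sub>R f (snd X), snd X))"
    by (intro smooth_on_Pair smooth_on_add smooth_on_scaleR smooth_on_const smooth_on_ident open_UNIV)
  show "((\<lambda>t. (fst X + t *\<^sub>R f (snd X), snd X)) has_vector_derivative (f (snd X), 0)) (at 0)"
    unfolding has_vector_derivative_def by (rule has_derivative_eq_rhs, (rule derivative_intros | simp)+)
qed

text \<open>The Cayley transform of \<open>t S / 2\<close>.\<close>
lemma lie_algebra_B_Sp:
  fixes S :: "real^4^'n::finite \<Rightarrow> real^4^'n"
  assumes S: "linear S" and skew: "\<And>x y. S x \<bullet> y = - (x \<bullet> S y)" and comm: "\<And>w x. S (rim w x) = rim w (S x)"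
  shows "(\<lambda>X. (S (fst X), 0)) \<in> lie_algebra B_group"
proof -
  define N where "N t v = v - (t / 2) *\<^sub>R S v" for t v
  define M where "M t v = v + (t / 2) *\<^sub>R S v" for t v
  have linN: "linear (N t)" and linM: "linear (M t)" for t
    unfolding N_def M_def by (rule linearI; simp add: linear_add[OF S] linear_cmul[OF S] algebra_simps)+
  have Sxx: "S x \<bullet> x = 0" for x using skew[of x x] by (simp add: inner_commute)
  have inj: "v = 0" if "N t v = 0 \<or> M t v = 0" for t v
  proof -
    have "v = (t / 2) *\<^sub>R S v \<or> v = - (t / 2) *\<^sub>R S v" using that by (auto simp: N_def M_def eq_neg_iff_add_eq_0)
    then have "v \<bullet> v = (t / 2) * (S v \<bullet> v) \<or> v \<bullet> v = - (t / 2) * (S v \<bullet> v)"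
      by (metis inner_scaleR_left)
    then show "v = 0" by (simp add: Sxx)
  qed
  have bijN: "bij (N t)" and bijM: "bij (M t)" for t
    using bij_linear_injective[OF linN] bij_linear_injective[OF linM] inj by blast+
  have NN: "N t (inv (N t) v) = v" for t v using bijN[of t] by (simp add: bij_def surj_f_inv_f)
  have Mrim: "M t (rim w v) = rim w (M t v)" and Nrim: "N t (rim w v) = rim w (N t v)" for t w v
    by (simp_all add: M_def N_def comm linear_add[OF linear_rim(1)] linear_diff[OF linear_rim(1)] linear_cmul[OF linear_rim(1)])
  \<comment> \<open>The mixed terms cancel by skewness; this is why the Cayley transform is an
    isometry.\<close>
  have MN: "M t x \<bullet> M t y = N t x \<bullet> N t y" for t x y
    using skew[of x y] by (simp add: M_def N_def inner_add inner_diff_left inner_diff_right algebra_simps)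
  define \<gamma> where "\<gamma> t v = M t (inv (N t) v)" for t v
  have om\<gamma>: "om (\<gamma> t v) (\<gamma> t v') = om v v'" for t v v'
  proof (rule vector_eq_rdot[THEN iffD1], rule allI)
    fix w
    have "om (\<gamma> t v) (\<gamma> t v') \<bullet> w = N t (rim w (inv (N t) v)) \<bullet> N t (inv (N t) v')"
      by (simp add: om_inner \<gamma>_def MN flip: Mrim)
    then show "om (\<gamma> t v) (\<gamma> t v') \<bullet> w = om v v' \<bullet> w" by (simp add: Nrim NN om_inner)
  qed
  have lin\<gamma>: "linear (\<gamma> t)" and bij\<gamma>: "bij (\<gamma> t)" for t
    unfolding \<gamma>_def using linear_compose[OF linear_inv[OF linN bijN] linM] bij_comp[OF bij_imp_bij_inv[OF bijN] bijM]
    by (simp_all add: o_def)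
  \<comment> \<open>Since \<open>M = 2 - N\<close>, smoothness and the derivative are needed for the
    inverse of \<open>N\<close> only.\<close>
  have \<gamma>2: "\<gamma> t v = 2 *\<^sub>R inv (N t) v - v" for t v
    using NN[of t v] unfolding \<gamma>_def M_def N_def[of t "inv (N t) v"]
    by (simp add: scaleR_2 algebra_simps)
  have N0: "N 0 = (\<lambda>v. v)" by (simp add: N_def fun_eq_iff)
  have inv0: "inv (N 0) v = v" for v using NN[of 0 v] by (simp add: N0)
  have sN: "smooth_on UNIV (\<lambda>t. N t v)" for v
    unfolding N_def divide_inverse
    by (intro smooth_on_diff smooth_on_scaleR smooth_on_mult smooth_on_const smooth_on_ident open_UNIV)
  have sy: "smooth_on UNIV (\<lambda>t. inv (N t) v)" for v
    by (rule smooth_on_inv_family[OF open_UNIV linN bijN sN])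
  have dy: "((\<lambda>t. inv (N t) v) has_derivative (\<lambda>t. (t / 2) *\<^sub>R S v)) (at 0)" for v
  proof -
    obtain y' where y': "((\<lambda>t. inv (N t) v) has_derivative y') (at 0)"
      using smooth_on_has_derivative[OF sy UNIV_I] by blast
    \<comment> \<open>The equation \<open>N y = v\<close> in fixed-point form: at
      \<open>t = 0\<close> the factor \<open>t\<close> removes the unknown derivative
      \<open>y'\<close> from the right-hand side.\<close>
    have "((\<lambda>t. v + (t / 2) *\<^sub>R S (inv (N t) v)) has_derivative (\<lambda>t. (t / 2) *\<^sub>R S v)) (at 0)"
      using bounded_linear.has_derivative[OF _ y', of S] S
      by (auto intro!: derivative_eq_intros simp: linear_conv_bounded_linear inv0)
    moreover have "v + (t / 2) *\<^sub>R S (inv (N t) v) = inv (N t) v" for t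
      using NN[of t v] by (simp add: N_def algebra_simps)
    ultimately show ?thesis by simp
  qed
  show ?thesis
  proof (rule B.lie_algebraI[where \<gamma> = "\<lambda>t X. (\<gamma> t (fst X), snd X)"])
    show "linear (\<lambda>X. (S (fst X), 0))" by (rule linearI) (simp_all add: linear_add[OF S] linear_cmul[OF S])
    fix t :: real
    let ?b = "\<lambda>X :: 'n model. (\<gamma> t (fst X), snd X)"
    have lin: "linear ?b"
      by (rule linearI) (simp_all add: linear_add[OF lin\<gamma>] linear_cmul[OF lin\<gamma>])
    have "bij ?b"
    proof (rule bij_linear_injective[OF lin])
      fix X assume "?b X = 0"
      then have "\<gamma> t (fst X) = \<gamma> t 0" "snd X = 0" by (simp_all add: zero_prod_def linear_0[OF lin\<gamma>])
      then show "X = 0" using bij\<gamma>[of t] by (auto simp: prod_eq_iff bij_def inj_eq)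
    qed
    then show "?b \<in> B_group" by (simp add: B_group_iff lin om\<gamma> linear_0[OF lin\<gamma>])
  next
    show "(\<lambda>X. (\<gamma> 0 (fst X), snd X)) = id" by (simp add: fun_eq_iff \<gamma>2 inv0 scaleR_2)
    fix X :: "'n model"
    show "smooth_on UNIV (\<lambda>t. (\<gamma> t (fst X), snd X))"
      unfolding \<gamma>2 by (intro smooth_on_Pair smooth_on_diff smooth_on_scaleR sy smooth_on_const open_UNIV)
    have "((\<lambda>t. \<gamma> t (fst X)) has_derivative (\<lambda>t. t *\<^sub>R S (fst X))) (at 0)"
      unfolding \<gamma>2 by (auto intro!: derivative_eq_intros dy)
    then show "((\<lambda>t. (\<gamma> t (fst X), snd X)) has_vector_derivative (S (fst X), 0)) (at 0)"
      unfolding has_vector_derivative_def by (auto intro!: derivative_eq_intros)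
  qed
qed

section \<open>The cokernel criterion\<close>

text \<open>Koszul's formula in an orthonormal frame for the metric connection with torsion
  \<open>T\<close>; the sum over the basis is the vector dual to the last two terms of the
  formula.\<close>

definition koszul :: "('a::euclidean_space \<Rightarrow> 'a \<Rightarrow> 'a) \<Rightarrow> 'a \<Rightarrow> 'a \<Rightarrow> 'a" where
  "koszul T x y = (1/2) *\<^sub>R (T x y + (\<Sum>b\<in>Basis. (T b x \<bullet> y - T y b \<bullet> x) *\<^sub>R b))"

context
  fixes T :: "'a::euclidean_space \<Rightarrow> 'a \<Rightarrow> 'a"
  assumes T: "bilinear T" and skewT: "\<And>x y. T x y = - T y x"
begin

lemma koszul_inner: "koszul T x y \<bullet> z = (1/2) * (T x y \<bullet> z + T z x \<bullet> y - T y z \<bullet> x)"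
proof -
  have l: "linear (\<lambda>b. T b x \<bullet> y - T y b \<bullet> x)"
    using T by (intro linearI) (simp_all add: bilinear_ladd bilinear_radd bilinear_lmul bilinear_rmul inner_add_left algebra_simps)
  have "(\<Sum>b\<in>Basis. (T b x \<bullet> y - T y b \<bullet> x) *\<^sub>R b) \<bullet> z = (\<Sum>b\<in>Basis. (z \<bullet> b) *\<^sub>R (T b x \<bullet> y - T y b \<bullet> x))"
    unfolding inner_sum_left by (intro sum.cong refl) (simp add: inner_commute[of z] mult.commute)
  also have "\<dots> = T z x \<bullet> y - T y z \<bullet> x" by (rule linear_euclidean[OF l, symmetric])
  finally show ?thesis by (simp add: koszul_def inner_add_left)
qed

lemma bilinear_koszul: "bilinear (koszul T)"
  unfolding bilinear_def
  by (intro conjI allI linearI; rule vector_eq_rdot[THEN iffD1];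
      simp add: koszul_inner inner_add_left inner_add_right bilinear_ladd[OF T] bilinear_radd[OF T] bilinear_lmul[OF T] bilinear_rmul[OF T] algebra_simps)

lemma koszul_skew: "koszul T x y \<bullet> z = - (y \<bullet> koszul T x z)"
  using skewT[of x z] skewT[of y x] skewT[of y z] by (simp add: inner_commute[of y] koszul_inner field_simps)

lemma koszul_torsion: "koszul T x y - koszul T y x = T x y"
proof (rule vector_eq_rdot[THEN iffD1], rule allI)
  fix z
  show "(koszul T x y - koszul T y x) \<bullet> z = T x y \<bullet> z"
    using skewT[of y x] skewT[of z x] skewT[of y z] by (simp add: inner_diff_left koszul_inner field_simps)
qed

end

text \<open>\<open>A x\<close> stands for the covariant derivative of the almost complex structure
  \<open>J\<close>, and \<open>cyc\<close> for closedness of its fundamental form. The conclusion is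
  the quasi-Kaehler identity of almost Kaehler geometry.\<close>

lemma quasi_kaehler:
  fixes A :: "'a::real_inner \<Rightarrow> 'a \<Rightarrow> 'a"
  assumes JJ: "\<And>x. J (J x) = - x" and lin: "bilinear A"
    and anti: "\<And>x y. A x (J y) = - J (A x y)"
    and skew: "\<And>x y z. A x y \<bullet> z = - (y \<bullet> A x z)" and Jskew: "\<And>y z. J y \<bullet> z = - (y \<bullet> J z)"
    and cyc: "\<And>x y z. A x y \<bullet> z + A y z \<bullet> x + A z x \<bullet> y = 0"
  shows "A (J x) y = A x (J y)"
proof -
  define P where "P x y z = A x y \<bullet> z" for x y z
  have Psk: "P x y z = - P x z y" for x y z using skew[of x y z] by (simp add: P_def inner_commute)
  have PJ: "P x (J y) z = P x y (J z)" for x y z using Jskew[of "A x y" z] by (simp add: P_def anti)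
  have neg: "P x (- y) z = - P x y z" "P x y (- z) = - P x y z" for x y z
    using bilinear_rneg[OF lin] by (simp_all add: P_def)
  have c: "P x y z + P y z x + P z x y = 0" for x y z using cyc by (simp add: P_def)
  have P3: "P (J x) (J y) z = - P x y z" for x y z
  proof -
    have a: "P x (J y) (J z) = - P x y z" "P (J y) (J z) x = P (J y) z (J x)" "P (J z) x (J y) = P (J z) (J x) y"
      "P (J x) y (J z) = P (J x) (J y) z" "P y (J z) (J x) = - P y z x"
      "P (J z) (J x) y = P (J z) x (J y)" "P (J y) z (J x) = P (J y) (J z) x" "P z (J x) (J y) = - P z x y"
      by (simp_all add: PJ JJ neg)
    \<comment> \<open>The first three instances give the pairwise sums of the three cyclic values of
      \<open>P (J _) (J _) _\<close>, and with the fourth the total vanishes; so each value is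
      determined.\<close>
    show ?thesis
      using c[of x "J y" "J z"] c[of "J x" y "J z"] c[of "J x" "J y" z] c[of x y z] a by linarith
  qed
  have "A (J x) y \<bullet> z = A x (J y) \<bullet> z" for z
    using P3[of x "J y" z] neg(1)[of "J x" y z] by (simp add: JJ P_def)
  then show ?thesis using vector_eq_rdot by blast
qed

text \<open>Hitchin's lemma at one point: \<open>A\<^sub>s\<close> plays the role of the covariant derivative of \<open>J\<^sub>s\<close>.\<close>
lemma hyperkaehler_step:
  fixes A1 A2 :: "'a::real_vector \<Rightarrow> 'a \<Rightarrow> 'a"
  assumes J: "linear J1" "linear J2" "\<And>x. J1 (J1 x) = - x" "\<And>x. J2 (J2 x) = - x" "\<And>x. J2 (J1 x) = - J1 (J2 x)"
    and A: "bilinear A1" "bilinear A2"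
    and q1: "\<And>x y. A1 (J1 x) y = A1 x (J1 y)" and q2: "\<And>x y. A2 (J2 x) y = A2 x (J2 y)"
    and q3: "\<And>x y. A1 (J1 (J2 x)) (J2 y) + J1 (A2 (J1 (J2 x)) y) = A1 x (J2 (J1 (J2 y))) + J1 (A2 x (J1 (J2 y)))"
  shows "A1 (J2 x) y = A1 x (J2 y)" "A2 x y = A2 (J1 x) (J1 y)"
proof -
  note neg = bilinear_lneg[OF A(1)] bilinear_rneg[OF A(1)] bilinear_lneg[OF A(2)] bilinear_rneg[OF A(2)]
    linear_neg[OF J(1)] linear_neg[OF J(2)]
  \<comment> \<open>\<open>q3\<close> is the quasi-Kaehler identity for the third structure
    \<open>J1 J2\<close>, expanded by the Leibniz rule; here \<open>y = - J2 u\<close>.\<close>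
  have E: "A1 (J2 x) (J1 u) - J1 (A2 (J1 x) u) = - A1 x (J1 (J2 u)) + J1 (A2 x (J1 u))" for x u
  proof -
    have j: "J1 (J2 x) = - J2 (J1 x)" by (simp add: J(5))
    have "A2 (J1 (J2 x)) v = - A2 (J1 x) (J2 v)" for v by (simp add: j neg q2)
    then show ?thesis using q3[of x "- J2 u"] by (simp add: q1 neg J)
  qed
  \<comment> \<open>\<open>F\<close> and \<open>G\<close> are \<open>E\<close> with
    \<open>J1\<close> inserted in the first or the second argument. The terms in \<open>A1\<close>
    agree while those in \<open>A2\<close> change sides, so adding the two isolates
    \<open>A1\<close>.\<close>
  have F: "A1 (J2 x) u + J1 (A2 x u) = A1 x (J2 u) + J1 (A2 (J1 x) (J1 u))" for x u
    using E[of "J1 x" u] by (simp add: J neg q1)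
  have G: "A1 (J2 x) u + J1 (A2 (J1 x) (J1 u)) = A1 x (J2 u) + J1 (A2 x u)" for x u
    using E[of x "J1 u"] by (simp add: J neg algebra_simps)
  have cancel: "a = b" if "a + c = b + d" "a + d = b + c" for a b c d :: 'a
  proof -
    have "(a + c) + (a + d) = (b + d) + (b + c)" using that by simp
    then have "2 *\<^sub>R a = 2 *\<^sub>R b" by (simp add: scaleR_2 algebra_simps)
    then show ?thesis by simp
  qed
  show *: "A1 (J2 x) y = A1 x (J2 y)" by (rule cancel[OF F G])
  have "J1 (A2 x y) = J1 (A2 (J1 x) (J1 y))" using F[of x y] by (simp add: *)
  then show "A2 x y = A2 (J1 x) (J1 y)" using J(3) by (metis neg_equal_iff_equal)
qed


text \<open>\<open>A w x\<close> is the commutator of \<open>koszul T x\<close> with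
  \<open>rim w\<close>, the algebraic covariant derivative of that structure, and \<open>cyc\<close>
  says that the fundamental forms are closed. Its vanishing is Hitchin's lemma; together with
  skewness it puts \<open>koszul T x\<close> into sp(n).\<close>

lemma koszul_commutes:
  fixes T :: "real^4^'n::finite \<Rightarrow> real^4^'n \<Rightarrow> real^4^'n"
  assumes T: "bilinear T" "\<And>x y. T x y = - T y x"
    and cyc: "\<And>x y z. om (T x y) z + om (T y z) x + om (T z x) y = 0"
  shows "koszul T x (rim w y) = rim w (koszul T x y)"
proof -
  let ?k = "koszul T"
  note kb = bilinear_koszul[OF T]
  note ks = koszul_skew[OF T] and kt = koszul_torsion[OF T]
  define A where "A w x y = ?k x (rim w y) - rim w (?k x y)" for w x y
  have linA: "bilinear (A w)" for w
    unfolding bilinear_def A_def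
    by (intro conjI allI linearI; simp add: bilinear_ladd[OF kb] bilinear_radd[OF kb] bilinear_lmul[OF kb] bilinear_rmul[OF kb]
        linear_add[OF linear_rim(1)] linear_cmul[OF linear_rim(1)] algebra_simps)
  have quasi: "A w (rim w x) y = A w x (rim w y)" if w: "norm w = 1" for w x y
  proof (rule quasi_kaehler[where J = "rim w"])
    show RR: "rim w (rim w x) = - x" for x :: "real^4^'n" using w by (simp add: rim_rim)
    show "bilinear (A w)" by (rule linA)
    show "A w x (rim w y) = - rim w (A w x y)" for x y
      by (simp add: A_def RR linear_diff[OF linear_rim(1)] bilinear_rneg[OF kb])
    show Rs: "rim w y \<bullet> z = - (y \<bullet> rim w z)" for y z :: "real^4^'n" by (rule rim_skew)
    show "A w x y \<bullet> z = - (y \<bullet> A w x z)" for x y z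
      by (simp add: A_def inner_diff_left inner_diff_right ks Rs)
    show "A w x y \<bullet> z + A w y z \<bullet> x + A w z x \<bullet> y = 0" for x y z
    proof -
      have e: "A w x y \<bullet> z = rim w (?k x z) \<bullet> y - rim w (?k x y) \<bullet> z" for x y z
        by (simp add: A_def inner_diff_left ks Rs inner_commute[of y])
      have "rim w (T x y) \<bullet> z + rim w (T y z) \<bullet> x + rim w (T z x) \<bullet> y = 0"
        using arg_cong[OF cyc[of x y z], of "\<lambda>u. u \<bullet> w"] by (simp add: inner_add_left om_inner)
      moreover have t: "rim w (T x y) \<bullet> z = rim w (?k x y) \<bullet> z - rim w (?k y x) \<bullet> z" for x y z
        using kt[of x y] by (metis linear_diff[OF linear_rim(1)] inner_diff_left)
      ultimately show ?thesis
        using e[of x y z] e[of y z x] e[of z x y] t[of x y z] t[of y z x] t[of z x y] by linarith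
    qed
  qed
  have Ak: "A q_j x (rim q_i y) + rim q_j (A q_i x y) = A q_k x y" for x y
    by (simp add: A_def linear_diff[OF linear_rim(1)])
  \<comment> \<open>\<open>rim\<close> reverses products, so \<open>rim q_i (rim q_j x)\<close> is
    the negative of \<open>rim q_k x\<close>; this is the sign on the right.\<close>
  have Ak': "A q_i x (rim q_j y) + rim q_i (A q_j x y) = - A q_k x y" for x y
    by (simp add: A_def linear_diff[OF linear_rim(1)] bilinear_rneg[OF kb])
  have c: "rim q_i (rim q_j x) = - rim q_j (rim q_i x)" for x :: "real^4^'n" by simp
  have RR: "rim q_i (rim q_i x) = - x" "rim q_j (rim q_j x) = - x" for x :: "real^4^'n" by (simp_all add: rim_rim)
  note neg = bilinear_lneg[OF linA] bilinear_rneg[OF linA]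
  have c': "rim q_j (rim q_i x) = - rim q_i (rim q_j x)" for x :: "real^4^'n" by simp
  have q3: "A q_j (rim q_j (rim q_i x)) (rim q_i y) + rim q_j (A q_i (rim q_j (rim q_i x)) y)
      = A q_j x (rim q_i (rim q_j (rim q_i y))) + rim q_j (A q_i x (rim q_j (rim q_i y)))" for x y
    unfolding Ak by (simp add: quasi)
  have q3': "A q_i (rim q_i (rim q_j x)) (rim q_j y) + rim q_i (A q_j (rim q_i (rim q_j x)) y)
      = A q_i x (rim q_j (rim q_i (rim q_j y))) + rim q_i (A q_j x (rim q_i (rim q_j y)))" for x y
    unfolding Ak' by (simp add: quasi neg)
  note s1 = hyperkaehler_step[where ?A1.0 = "A q_j" and ?A2.0 = "A q_i" and ?J1.0 = "rim q_j" and ?J2.0 = "rim q_i", OF linear_rim(1)[of q_j] linear_rim(1)[of q_i] RR(2,1) c linA linA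
      quasi[OF norm_units(2)] quasi[OF norm_units(1)] q3]
  note s2 = hyperkaehler_step[where ?A1.0 = "A q_i" and ?A2.0 = "A q_j" and ?J1.0 = "rim q_i" and ?J2.0 = "rim q_j", OF linear_rim(1)[of q_i] linear_rim(1)[of q_j] RR c' linA linA
      quasi[OF norm_units(1)] quasi[OF norm_units(2)] q3']
  \<comment> \<open>With the roles of i and j exchanged, the two runs of
    \<open>hyperkaehler_step\<close> move both copies of a unit to the second argument, where its
    square is -1.\<close>
  have "A q_j x y = - A q_j x y" "A q_i x y = - A q_i x y" for x y
    using s2(2)[of x y] s1(1)[of x "rim q_i y"] s1(2)[of x y] s2(1)[of x "rim q_j y"] by (simp_all add: RR neg)
  then have 0: "A q_j x y = 0" "A q_i x y = 0" for x y by (simp_all add: eq_neg_iff_add_eq_0 flip: scaleR_2)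
  then have 0: "A q_j x y = 0" "A q_i x y = 0" "A q_k x y = 0" for x y
    using Ak[of x y] by (simp_all add: linear_0[OF linear_rim(1)])
  have "A w x y = 0"
  proof (rule linear_eq_axis[where g = "\<lambda>w. 0"])
    show "linear (\<lambda>w. A w x y)" unfolding A_def
      by (intro linearI; simp add: linear_add[OF linear_rim(2)] linear_cmul[OF linear_rim(2)] bilinear_radd[OF kb] bilinear_rmul[OF kb] algebra_simps)
    show "A (axis s 1) x y = 0" for s using 0 exhaust_3[of s] by auto
  qed (rule linear_zero)
  then show ?thesis by (simp add: A_def)
qed

text \<open>The quaternion \<open>q\<close> with \<open>q\<^sup>- w + w q = \<sigma> w\<close> for a conformal \<open>\<sigma>\<close>, i.e. one whose symmetric part
  is a multiple of the identity.\<close>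
definition conformal_quat :: "(real^3 \<Rightarrow> real^3) \<Rightarrow> real^4" where
  "conformal_quat \<sigma> = (1/2) *\<^sub>R vector [\<sigma> q_i $ 1, - \<sigma> q_j $ 3, \<sigma> q_i $ 3, - \<sigma> q_i $ 2]"

text \<open>A real \<open>q\<close> acts on W by scaling and an imaginary one by a commutator, that
  is, an infinitesimal rotation. These exhaust the maps with conformal symmetric part, and solving
  for the entries of \<open>q\<close> gives the definition.\<close>

lemma conformal_quat:
  assumes \<sigma>: "linear \<sigma>" and conf: "\<And>w w'. \<sigma> w \<bullet> w' + \<sigma> w' \<bullet> w = \<mu> * (w \<bullet> w')"
  shows "snd (quat_infinitesimal (conformal_quat \<sigma>) (v, w)) = \<sigma> w"
proof -
  let ?q = "conformal_quat \<sigma>"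
  have c: "\<sigma> q_i $ 1 + \<sigma> q_i $ 1 = \<mu>" "\<sigma> q_j $ 2 + \<sigma> q_j $ 2 = \<mu>" "\<sigma> q_k $ 3 + \<sigma> q_k $ 3 = \<mu>"
    "\<sigma> q_i $ 2 + \<sigma> q_j $ 1 = 0" "\<sigma> q_i $ 3 + \<sigma> q_k $ 1 = 0" "\<sigma> q_j $ 3 + \<sigma> q_k $ 2 = 0"
    using conf[of q_i q_i] conf[of q_j q_j] conf[of q_k q_k] conf[of q_i q_j] conf[of q_i q_k] conf[of q_j q_k]
    by (simp_all add: inner_3)
  have "im_part (qmul (qconj ?q) (q_of_im w) + qmul (q_of_im w) ?q) = \<sigma> w"
  proof (rule linear_eq_axis[OF _ \<sigma>])
    show "linear (\<lambda>w. im_part (qmul (qconj ?q) (q_of_im w) + qmul (q_of_im w) ?q))"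
      by (rule linearI) (simp_all add: im_eq_iff algebra_simps)
    have q: "?q $ 1 = \<sigma> q_i $ 1 / 2" "?q $ 2 = - \<sigma> q_j $ 3 / 2" "?q $ 3 = \<sigma> q_i $ 3 / 2" "?q $ 4 = - \<sigma> q_i $ 2 / 2"
      by (simp_all add: conformal_quat_def)
    have "im_part (qmul (qconj ?q) (q_of_im q_i) + qmul (q_of_im q_i) ?q) = \<sigma> q_i"
      "im_part (qmul (qconj ?q) (q_of_im q_j) + qmul (q_of_im q_j) ?q) = \<sigma> q_j"
      "im_part (qmul (qconj ?q) (q_of_im q_k) + qmul (q_of_im q_k) ?q) = \<sigma> q_k"
      unfolding im_eq_iff using c by (simp_all add: q)
    then show "im_part (qmul (qconj ?q) (q_of_im (axis s 1)) + qmul (q_of_im (axis s 1)) ?q) = \<sigma> (axis s 1)" for s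
      using exhaust_3[of s] by auto
  qed
  then show ?thesis by (simp add: quat_infinitesimal_def)
qed

lemma linear_conformal_quat:
  assumes "\<And>w. linear (\<lambda>x. \<sigma> x w)" shows "linear (\<lambda>x. conformal_quat (\<sigma> x))"
  using linear_add[OF assms] linear_cmul[OF assms]
  by (intro linearI) (simp_all add: conformal_quat_def quat_eq_iff field_simps)

text \<open>The stabilizer condition of \<open>B_group_iff\<close>, differentiated: the Lie algebra
  acts on \<open>om\<close> by derivations.\<close>

lemma om_quat_infinitesimal:
  "om (rmul v q) v' + om v (rmul v' q) = snd (quat_infinitesimal q (u, om v v'))"
proof -
  have "om (rmul v q) v' + om v (rmul v' q) = im_part (qmul (qconj q) (hprod v v') + qmul (hprod v v') q)"
    using hprod_rmul[of v q v' qone] hprod_rmul[of v qone v' q]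
    by (simp add: quat_eq_iff flip: im_hprod) (simp add: im_eq_iff)
  also have "\<dots> = snd (quat_infinitesimal q (u, om v v'))"
    by (simp add: quat_infinitesimal_def hprod_decomp im_eq_iff algebra_simps)
  finally show ?thesis .
qed

text \<open>A preimage \<open>a\<close> of \<open>\<tau> - Theta0\<close> is assembled block by
  block: quaternions \<open>q v\<close> and \<open>q' w\<close> for the W-components on V x W and W
  x W, the Koszul solution \<open>\<alpha>\<close> for what is left of the V-component on V x V, and
  a homomorphism \<open>F\<close> from W to V for the V-components that involve W.\<close>

lemma coker_class_Theta0I:
  fixes \<tau> :: "'n::finite model \<Rightarrow> 'n model \<Rightarrow> 'n model"
  assumes \<tau>: "bilinear \<tau>" and skew: "\<And>X Y. \<tau> X Y = - \<tau> Y X"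
    and om: "\<And>v v'. snd (\<tau> (v, 0) (v', 0)) = om v v'"
    and conf: "\<And>v w w'. snd (\<tau> (0, w) (v, 0)) \<bullet> w' + snd (\<tau> (0, w') (v, 0)) \<bullet> w = \<mu> v * (w \<bullet> w')"
    and bianchi: "\<And>v1 v2 v3. snd (\<tau> (\<tau> (v1, 0) (v2, 0)) (v3, 0)) + snd (\<tau> (\<tau> (v2, 0) (v3, 0)) (v1, 0))
        + snd (\<tau> (\<tau> (v3, 0) (v1, 0)) (v2, 0)) = 0"
  shows "coker_class B_group \<tau> = coker_class B_group Theta0"
proof -
  note add = bilinear_ladd[OF \<tau>] bilinear_radd[OF \<tau>] and mul = bilinear_lmul[OF \<tau>] bilinear_rmul[OF \<tau>]
  have V: "(v + v', 0::real^3) = (v, 0) + (v', 0)" "(c *\<^sub>R v, 0::real^3) = c *\<^sub>R (v, 0)"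
    and W: "(0::real^4^'n, w + w') = (0, w) + (0, w')" "(0::real^4^'n, c *\<^sub>R w) = c *\<^sub>R (0, w)"
    for v v' :: "real^4^'n" and w w' :: "real^3" and c by (simp_all)
  \<comment> \<open>What \<open>a (v, 0)\<close> has to do on W; the sign comes from the order of
    the arguments of \<open>\<tau>\<close>.\<close>
  define \<sigma> where "\<sigma> v w = - snd (\<tau> (0, w) (v, 0))" for v w
  have lin\<sigma>: "linear (\<sigma> v)" "linear (\<lambda>v. \<sigma> v w)" for v w
    unfolding \<sigma>_def by (rule linearI; simp only: V W add mul snd_add snd_scaleR minus_add_distrib scaleR_minus_right)+
  define q where "q v = conformal_quat (\<sigma> v)" for v
  have linq: "linear q" unfolding q_def by (rule linear_conformal_quat[OF lin\<sigma>(2)])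
  have q\<sigma>: "snd (quat_infinitesimal (q v) (v', w)) = \<sigma> v w" for v v' w
    unfolding q_def
  proof (rule conformal_quat[OF lin\<sigma>(1)])
    show "\<sigma> v w \<bullet> w' + \<sigma> v w' \<bullet> w = (- \<mu> v) * (w \<bullet> w')" for w w'
      using conf[of w v w'] by (simp add: \<sigma>_def)
  qed
  \<comment> \<open>The torsion on V after removing the contribution of the quaternions
    \<open>q\<close>, which are already fixed by \<open>\<sigma>\<close>.\<close>
  define T where "T v v' = fst (\<tau> (v, 0) (v', 0)) - (rmul v' (q v) - rmul v (q v'))" for v v'
  have T: "bilinear T"
    unfolding bilinear_def T_def
    by (intro conjI allI linearI; simp only: V add mul; simp add: rmul_distribs linear_add[OF linq] linear_cmul[OF linq] algebra_simps)
  have Tskew: "T v v' = - T v' v" for v v'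
    using skew[of "(v, 0)" "(v', 0)"] by (simp add: T_def)
  have Tcyc: "om (T v1 v2) v3 + om (T v2 v3) v1 + om (T v3 v1) v2 = 0" for v1 v2 v3
  proof -
    \<comment> \<open>The W-part \<open>om v1 v2\<close> of the inner torsion returns through
      \<open>\<sigma>\<close>, i.e. through the action of \<open>q v3\<close> on \<open>om\<close>,
      which is a derivation. The corrections in \<open>T\<close> cancel exactly these terms.\<close>
    have b: "snd (\<tau> (\<tau> (v1, 0) (v2, 0)) (v3, 0)) = om (fst (\<tau> (v1, 0) (v2, 0))) v3 - (om (rmul v1 (q v3)) v2 + om v1 (rmul v2 (q v3)))" for v1 v2 v3
    proof -
      have "\<tau> (v1, 0) (v2, 0) = (fst (\<tau> (v1, 0) (v2, 0)), 0) + (0, om v1 v2)" using om by (simp add: prod_eq_iff)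
      then have "snd (\<tau> (\<tau> (v1, 0) (v2, 0)) (v3, 0)) = om (fst (\<tau> (v1, 0) (v2, 0))) v3 + snd (\<tau> (0, om v1 v2) (v3, 0))"
        by (metis add(1) snd_add om)
      also have "snd (\<tau> (0, om v1 v2) (v3, 0)) = - (om (rmul v1 (q v3)) v2 + om v1 (rmul v2 (q v3)))"
        using q\<sigma>[of v3 "0 :: real^4^'n" "om v1 v2"] om_quat_infinitesimal[of v1 "q v3" v2 "0 :: real^4^'n"] by (simp only: \<sigma>_def minus_minus)
      finally show ?thesis by simp
    qed
    have t: "om (T v1 v2) v3 = om (fst (\<tau> (v1, 0) (v2, 0))) v3 - om (rmul v2 (q v1)) v3 + om (rmul v1 (q v2)) v3" for v1 v2 v3
      by (simp add: T_def om_diff)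
    have "om (T v1 v2) v3 + om (T v2 v3) v1 + om (T v3 v1) v2
      = snd (\<tau> (\<tau> (v1, 0) (v2, 0)) (v3, 0)) + snd (\<tau> (\<tau> (v2, 0) (v3, 0)) (v1, 0)) + snd (\<tau> (\<tau> (v3, 0) (v1, 0)) (v2, 0))"
      unfolding b t om_skew[of v1 "rmul v2 _"] om_skew[of v2 "rmul v3 _"] om_skew[of v3 "rmul v1 _"] by simp
    then show ?thesis using bianchi by simp
  qed
  define \<alpha> where "\<alpha> = koszul T"
  have \<alpha>: "bilinear \<alpha>" "\<alpha> v v' - \<alpha> v' v = T v v'" for v v'
    unfolding \<alpha>_def by (rule bilinear_koszul[OF T Tskew] koszul_torsion[OF T Tskew])+
  have l\<alpha>: "(\<lambda>X. (\<alpha> v (fst X), 0)) \<in> lie_algebra B_group" for v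
    using \<alpha>(1) koszul_skew[OF T Tskew] koszul_commutes[OF T Tskew Tcyc]
    by (intro lie_algebra_B_Sp) (auto simp: bilinear_def \<alpha>_def)
  \<comment> \<open>The Koszul solution for \<open>C\<close> is skew, an infinitesimal rotation of
    W, and so again the action of a quaternion.\<close>
  define C where "C w w' = snd (\<tau> (0, w) (0, w'))" for w w'
  have C: "bilinear C"
    unfolding bilinear_def C_def by (intro conjI allI linearI; simp only: W add mul snd_add snd_scaleR)
  have Cskew: "C w w' = - C w' w" for w w' using skew[of "(0, w)" "(0, w')"] by (simp add: C_def)
  define \<kappa> where "\<kappa> = koszul C"
  have \<kappa>: "bilinear \<kappa>" "\<kappa> w w' - \<kappa> w' w = C w w'" for w w'
    unfolding \<kappa>_def by (rule bilinear_koszul[OF C Cskew] koszul_torsion[OF C Cskew])+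
  define q' where "q' w = conformal_quat (\<kappa> w)" for w
  have linq': "linear q'"
    unfolding q'_def by (rule linear_conformal_quat) (use \<kappa>(1) in \<open>simp add: bilinear_def\<close>)
  have q'\<kappa>: "snd (quat_infinitesimal (q' w) (v', w')) = \<kappa> w w'" for w v' w'
    unfolding q'_def
  proof (rule conformal_quat)
    show "linear (\<kappa> w)" using \<kappa>(1) by (simp add: bilinear_def)
    show "\<kappa> w x \<bullet> y + \<kappa> w y \<bullet> x = 0 * (x \<bullet> y)" for x y
      using koszul_skew[OF C Cskew, of w x y] by (simp add: \<kappa>_def inner_commute)
  qed
  \<comment> \<open>The block on W x W occurs twice after antisymmetrizing, hence the factor 1/2;
    the middle term cancels the effect of \<open>q'\<close> on V.\<close>
  define F where "F X w' = fst (\<tau> (fst X, 0) (0, w')) + rmul (fst X) (q' w') + (1/2) *\<^sub>R fst (\<tau> (0, snd X) (0, w'))" for X w'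
  have linF: "linear (F X)" for X
    unfolding F_def by (rule linearI; simp only: W add mul linear_add[OF linq'] linear_cmul[OF linq'] rmul_distribs;
        simp add: algebra_simps)
  have linF': "linear (\<lambda>X. F X w')" for w'
    unfolding F_def by (rule linearI; simp only: fst_add snd_add fst_scaleR snd_scaleR V W add mul rmul_distribs; simp add: algebra_simps)
  define a where "a X Y = quat_infinitesimal (q (fst X)) Y + (\<alpha> (fst X) (fst Y), 0) + quat_infinitesimal (q' (snd X)) Y + (F X (snd Y), 0)" for X Y
  show ?thesis
  proof (rule B.coker_class_eqI[of a])
    show "a X \<in> lie_algebra B_group" for X
      unfolding a_def by (intro B.lie_algebra_add lie_algebra_B_quat l\<alpha> lie_algebra_B_Hom linF)
    have qi: "linear (\<lambda>q. quat_infinitesimal q Y)" for Y :: "'n model"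
      by (rule linearI) (simp_all add: quat_infinitesimal_def rmul_distribs im_eq_iff algebra_simps)
    have l1: "linear (\<lambda>X. quat_infinitesimal (q (fst X)) Y)" "linear (\<lambda>X. quat_infinitesimal (q' (snd X)) Y)" for Y :: "'n model"
      by (rule linearI; simp add: linear_add[OF linq] linear_add[OF linq'] linear_cmul[OF linq] linear_cmul[OF linq'] linear_add[OF qi] linear_cmul[OF qi])+
    have l2: "linear (\<lambda>X. (\<alpha> (fst X) (fst Y), 0::real^3))" "linear (\<lambda>X. (F X (snd Y), 0::real^3))" for Y :: "'n model"
      by (rule linearI; simp add: bilinear_ladd[OF \<alpha>(1)] bilinear_lmul[OF \<alpha>(1)] linear_add[OF linF'] linear_cmul[OF linF'])+
    show "linear (\<lambda>X. a X Y)" for Y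
      unfolding a_def by (intro linear_compose_add l1 l2)
    fix X Y :: "'n model"
    obtain v w v' w' where XY: "X = (v, w)" "Y = (v', w')" by fastforce
    have d: "X = (v, 0) + (0, w)" "Y = (v', 0) + (0, w')" by (simp_all add: XY)
    have \<tau>d: "\<tau> X Y = \<tau> (v, 0) (v', 0) + \<tau> (v, 0) (0, w') + (\<tau> (0, w) (v', 0) + \<tau> (0, w) (0, w'))"
      unfolding d add by (simp only: add.assoc add.commute add.left_commute)
    show "\<tau> X Y = Theta0 X Y + (a X Y - a Y X)"
    proof (rule prod_eqI)
      have "snd (a X Y - a Y X) = \<sigma> v w' + \<kappa> w w' - (\<sigma> v' w + \<kappa> w' w)"
        by (simp add: a_def XY q\<sigma> q'\<kappa>)
      also have "\<dots> = snd (\<tau> (v, 0) (0, w')) + snd (\<tau> (0, w) (v', 0)) + snd (\<tau> (0, w) (0, w'))"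
        using \<kappa>(2)[of w w'] skew[of "(0, w')" "(v, 0)"] by (simp add: \<sigma>_def C_def algebra_simps)
      finally have "snd (a X Y - a Y X) = snd (\<tau> (v, 0) (0, w')) + snd (\<tau> (0, w) (v', 0)) + snd (\<tau> (0, w) (0, w'))" .
      moreover have "snd (Theta0 X Y) = om v v'" by (simp add: Theta0_def om_def XY)
      ultimately show "snd (\<tau> X Y) = snd (Theta0 X Y + (a X Y - a Y X))"
        unfolding \<tau>d snd_add om by simp
      have h: "(1/2) *\<^sub>R x + (1/2) *\<^sub>R x = x" for x :: "real^4^'n" by (simp flip: scaleR_add_left)
      have F2: "F X w' - F Y w = fst (\<tau> (v, 0) (0, w')) + fst (\<tau> (0, w) (v', 0)) + rmul v (q' w') - rmul v' (q' w) + fst (\<tau> (0, w) (0, w'))"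
        using skew[of "(0, w')" "(0, w)"] skew[of "(v', 0)" "(0, w)"] h[of "fst (\<tau> (0, w) (0, w'))"]
        by (simp add: F_def XY algebra_simps)
      have "fst (a X Y - a Y X) = rmul v' (q v) - rmul v (q v') + (\<alpha> v v' - \<alpha> v' v) + rmul v' (q' w) - rmul v (q' w') + (F X w' - F Y w)"
        by (simp add: a_def quat_infinitesimal_def XY algebra_simps)
      also have "\<dots> = fst (\<tau> X Y)"
        unfolding \<alpha>(2) F2 \<tau>d by (simp add: T_def)
      finally show "fst (\<tau> X Y) = fst (Theta0 X Y + (a X Y - a Y X))"
        by (simp add: Theta0_def)
    qed
  qed
qed

section \<open>Frame fields and connections\<close>

text \<open>The torsion at \<open>s x\<close> of the flat connection for which \<open>s\<close> is
  parallel, i.e. the exterior derivative of the coframe in its own frame.\<close>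

definition coframe_torsion ::
  "('m, 'e::euclidean_space) chart set \<Rightarrow> ('m \<Rightarrow> 'e \<Rightarrow> 'e) \<Rightarrow> 'm \<Rightarrow> 'e \<Rightarrow> 'e \<Rightarrow> 'e" where
  "coframe_torsion \<A> s x X Y = ext_deriv \<A> (\<lambda>y. inv (s y)) x (s x X) (s x Y)"

context smooth_manifold
begin

text \<open>Maps between fixed vector spaces, such as gauge transformations; no change of tangent
  coordinates is involved, in contrast to \<open>smooth_one_form\<close>.\<close>

definition smooth_family :: "'m set \<Rightarrow> ('m \<Rightarrow> 'a::euclidean_space \<Rightarrow> 'b::euclidean_space) \<Rightarrow> bool" where
  "smooth_family U \<phi> \<longleftrightarrow> (\<forall>x\<in>U. linear (\<phi> x)) \<and>
     (\<forall>c\<in>\<A>. \<forall>v. smooth_on (snd c ` (U \<inter> fst c)) (\<lambda>y. \<phi> (chart_inv c y) v))"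

lemma smooth_one_form_smooth_on:
  "smooth_one_form \<A> U \<alpha> \<Longrightarrow> c \<in> \<A> \<Longrightarrow> smooth_on (snd c ` (U \<inter> fst c)) (\<lambda>y. form_in_chart \<A> c \<alpha> y v)"
  unfolding smooth_one_form_def by blast

lemma chart_image_D:
  assumes "c \<in> \<A>" "y \<in> snd c ` (U \<inter> fst c)"
  shows "chart_inv c y \<in> U" "chart_inv c y \<in> fst c" "snd c (chart_inv c y) = y"
  using assms chart_inv_chart[OF assms(1)] by auto

lemma dir_deriv_family:
  assumes "smooth_family U \<phi>" "open U" "x \<in> U" "c \<in> \<A>" "x \<in> fst c"
  shows "dir_deriv \<A> (\<lambda>y. \<phi> y v) x X = frechet_derivative (\<lambda>y. \<phi> (chart_inv c y) v) (at (snd c x)) (to_chart \<A> c x X)"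
proof -
  have "smooth_on (snd c ` (U \<inter> fst c)) (\<lambda>y. \<phi> (chart_inv c y) v)"
    using assms unfolding smooth_family_def by blast
  then have "((\<lambda>y. \<phi> y v) \<circ> chart_inv c) differentiable (at (snd c x))"
    using smooth_on_differentiable[of _ "\<lambda>y. \<phi> (chart_inv c y) v" "snd c x"] assms by (auto simp: o_def)
  from dir_deriv_chart[OF assms(4,5) this] show ?thesis by (simp add: o_def)
qed

text \<open>The Leibniz rule for \<open>d(\<phi> \<alpha>)\<close>. The values of
  \<open>\<alpha>\<close> are frozen at \<open>x\<close> inside the directional derivatives, so
  these see \<open>\<phi>\<close> only.\<close>

lemma ext_deriv_gauge:
  fixes \<alpha> :: "'m \<Rightarrow> 'e \<Rightarrow> 'a::euclidean_space" and \<phi> :: "'m \<Rightarrow> 'a \<Rightarrow> 'b::euclidean_space"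
  assumes \<phi>: "smooth_family U \<phi>" and \<alpha>: "smooth_one_form \<A> U \<alpha>" and \<beta>: "smooth_one_form \<A> U \<beta>"
    and U: "open U" "x \<in> U" and eq: "\<And>y X. y \<in> U \<Longrightarrow> \<beta> y X = \<phi> y (\<alpha> y X)"
  shows "ext_deriv \<A> \<beta> x X Y = \<phi> x (ext_deriv \<A> \<alpha> x X Y)
    + dir_deriv \<A> (\<lambda>y. \<phi> y (\<alpha> x Y)) x X - dir_deriv \<A> (\<lambda>y. \<phi> y (\<alpha> x X)) x Y"
proof -
  let ?c = "chart_at \<A> x"
  have c: "?c \<in> \<A>" "x \<in> fst ?c" by (rule chart_at)+
  let ?S = "snd ?c ` (U \<inter> fst ?c)" and ?p = "snd ?c x"
  let ?a = "form_in_chart \<A> ?c \<alpha>" and ?b = "form_in_chart \<A> ?c \<beta>" and ?f = "\<lambda>y. \<phi> (chart_inv ?c y)"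
  have S: "open ?S" "?p \<in> ?S" using open_image_chart[OF c(1) U(1)] U c by auto
  have lf: "linear (?f y)" if "y \<in> ?S" for y using \<phi> chart_image_D[OF c(1) that] unfolding smooth_family_def by blast
  have sf: "smooth_on ?S (\<lambda>y. ?f y v)" for v using \<phi> c unfolding smooth_family_def by blast
  have sa: "smooth_on ?S (\<lambda>y. ?a y v)" for v by (rule smooth_one_form_smooth_on[OF \<alpha> c(1)])
  have ax: "?a ?p (to_chart \<A> ?c x Z) = \<alpha> x Z" for Z
    by (simp add: form_in_chart_def chart_inv_chart[OF c] c)
  have fx: "?f ?p = \<phi> x" by (simp add: chart_inv_chart[OF c])
  have d: "frechet_derivative (\<lambda>y. ?b y v) (at ?p) w
      = frechet_derivative (\<lambda>y. ?f y (?a ?p v)) (at ?p) w + \<phi> x (frechet_derivative (\<lambda>y. ?a y v) (at ?p) w)" for v w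
  proof -
    have "((\<lambda>y. ?f y (?a y v)) has_derivative
        (\<lambda>w. frechet_derivative (\<lambda>y. ?f y (?a ?p v)) (at ?p) w + ?f ?p (frechet_derivative (\<lambda>y. ?a y v) (at ?p) w))) (at ?p)"
      by (rule has_derivative_apply[OF S lf sf smooth_on_has_derivative[OF sa S(2)]])
    then have "((\<lambda>y. ?b y v) has_derivative
        (\<lambda>w. frechet_derivative (\<lambda>y. ?f y (?a ?p v)) (at ?p) w + ?f ?p (frechet_derivative (\<lambda>y. ?a y v) (at ?p) w))) (at ?p)"
      by (rule has_derivative_transform_within_open[OF _ S])
         (use chart_image_D[OF c(1)] eq in \<open>auto simp: form_in_chart_def\<close>)
    then show ?thesis unfolding fx by (metis (no_types, lifting) frechet_derivative_at)
  qed
  have l\<phi>: "linear (\<phi> x)" using \<phi> U unfolding smooth_family_def by blast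
  show ?thesis
    unfolding ext_deriv_chart[OF \<alpha> U c] ext_deriv_chart[OF \<beta> U c] ext_deriv_flat_def
      dir_deriv_family[OF \<phi> U c] d ax linear_diff[OF l\<phi>] by simp
qed

lemma smooth_family_const: "linear f \<Longrightarrow> smooth_family U (\<lambda>x. f)"
  unfolding smooth_family_def by simp

lemma dir_deriv_const: "dir_deriv \<A> (\<lambda>y. v) x X = 0"
  unfolding dir_deriv_def by (simp add: o_def frechet_derivative_const)

lemma smooth_family_compose:
  fixes \<phi> :: "'m \<Rightarrow> 'a::euclidean_space \<Rightarrow> 'b::euclidean_space" and \<psi> :: "'m \<Rightarrow> 'c::euclidean_space \<Rightarrow> 'a"
  assumes "smooth_family U \<phi>" "smooth_family U \<psi>" "open U"
  shows "smooth_family U (\<lambda>x v. \<phi> x (\<psi> x v))"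
  unfolding smooth_family_def
proof (intro conjI ballI allI)
  show "linear (\<lambda>v. \<phi> x (\<psi> x v))" if "x \<in> U" for x
    using linear_compose[of "\<psi> x" "\<phi> x"] assms that by (simp add: smooth_family_def o_def)
  fix c v assume c: "c \<in> \<A>"
  show "smooth_on (snd c ` (U \<inter> fst c)) (\<lambda>y. \<phi> (chart_inv c y) (\<psi> (chart_inv c y) v))"
    by (rule smooth_on_apply[OF open_image_chart[OF c assms(3)]])
       (use assms c chart_image_D[OF c] in \<open>auto simp: smooth_family_def\<close>)
qed

lemma dir_deriv_family_apply:
  fixes \<phi> :: "'m \<Rightarrow> 'a::euclidean_space \<Rightarrow> 'b::euclidean_space" and \<psi> :: "'m \<Rightarrow> 'c::euclidean_space \<Rightarrow> 'a"
  assumes \<phi>: "smooth_family U \<phi>" and \<psi>: "smooth_family U \<psi>" and U: "open U" "x \<in> U"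
  shows "dir_deriv \<A> (\<lambda>y. \<phi> y (\<psi> y v)) x X
    = dir_deriv \<A> (\<lambda>y. \<phi> y (\<psi> x v)) x X + \<phi> x (dir_deriv \<A> (\<lambda>y. \<psi> y v) x X)"
proof -
  let ?c = "chart_at \<A> x"
  have c: "?c \<in> \<A>" "x \<in> fst ?c" by (rule chart_at)+
  let ?S = "snd ?c ` (U \<inter> fst ?c)" and ?p = "snd ?c x"
  have S: "open ?S" "?p \<in> ?S" using open_image_chart[OF c(1) U(1)] U c by auto
  have "((\<lambda>y. \<phi> (chart_inv ?c y) (\<psi> (chart_inv ?c y) v)) has_derivative
     (\<lambda>w. frechet_derivative (\<lambda>y. \<phi> (chart_inv ?c y) (\<psi> (chart_inv ?c ?p) v)) (at ?p) w
        + \<phi> (chart_inv ?c ?p) (frechet_derivative (\<lambda>y. \<psi> (chart_inv ?c y) v) (at ?p) w))) (at ?p)"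
  proof (rule has_derivative_apply[OF S])
    show "linear (\<phi> (chart_inv ?c y))" if "y \<in> ?S" for y
      using \<phi> chart_image_D[OF c(1) that] unfolding smooth_family_def by blast
    show "smooth_on ?S (\<lambda>y. \<phi> (chart_inv ?c y) u)" for u using \<phi> c unfolding smooth_family_def by blast
    have "smooth_on ?S (\<lambda>y. \<psi> (chart_inv ?c y) v)" using \<psi> c unfolding smooth_family_def by blast
    then show "((\<lambda>y. \<psi> (chart_inv ?c y) v) has_derivative frechet_derivative (\<lambda>y. \<psi> (chart_inv ?c y) v) (at ?p)) (at ?p)"
      by (rule smooth_on_has_derivative[OF _ S(2)])
  qed
  then have "frechet_derivative (\<lambda>y. \<phi> (chart_inv ?c y) (\<psi> (chart_inv ?c y) v)) (at ?p) w
      = frechet_derivative (\<lambda>y. \<phi> (chart_inv ?c y) (\<psi> x v)) (at ?p) w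
        + \<phi> x (frechet_derivative (\<lambda>y. \<psi> (chart_inv ?c y) v) (at ?p) w)" for w
    unfolding chart_inv_chart[OF c] by (metis (no_types, lifting) frechet_derivative_at)
  then show ?thesis
    unfolding dir_deriv_family[OF smooth_family_compose[OF \<phi> \<psi> U(1)] U c] dir_deriv_family[OF \<phi> U c] dir_deriv_family[OF \<psi> U c] .
qed

lemma dir_deriv_family_linear:
  fixes f :: "'b::euclidean_space \<Rightarrow> 'c::euclidean_space"
  assumes "smooth_family U \<phi>" "open U" "x \<in> U" "linear f"
  shows "dir_deriv \<A> (\<lambda>y. f (\<phi> y v)) x X = f (dir_deriv \<A> (\<lambda>y. \<phi> y v) x X)"
  using dir_deriv_family_apply[OF smooth_family_const[OF assms(4)] assms(1-3), of v X] by (simp add: dir_deriv_const)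

lemma linear_dir_deriv_family:
  assumes "smooth_family U \<phi>" "open U" "x \<in> U"
  shows "linear (\<lambda>X. dir_deriv \<A> (\<lambda>y. \<phi> y v) x X)"
proof -
  let ?c = "chart_at \<A> x"
  have c: "?c \<in> \<A>" "x \<in> fst ?c" by (rule chart_at)+
  have s: "smooth_on (snd ?c ` (U \<inter> fst ?c)) (\<lambda>y. \<phi> (chart_inv ?c y) v)" using assms c unfolding smooth_family_def by blast
  have "snd ?c x \<in> snd ?c ` (U \<inter> fst ?c)" using assms c by auto
  from has_derivative_linear[OF smooth_on_has_derivative[OF s this]]
  have "linear (frechet_derivative (\<lambda>y. \<phi> (chart_inv ?c y) v) (at (snd ?c x)))" .
  from linear_compose[OF linear_to_chart[OF c] this] show ?thesis
    by (simp add: dir_deriv_family[OF assms c] o_def)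
qed

lemma smooth_frame_D:
  assumes "smooth_frame_field \<A> U s" "x \<in> U"
  shows "linear (s x)" "bij (s x)" "inv (s x) (s x v) = v" "s x (inv (s x) v) = v" "linear (inv (s x))"
  using assms linear_inv[of "s x"] by (auto simp: smooth_frame_field_def bij_def surj_f_inv_f)

lemma frame_in_chart:
  assumes s: "smooth_frame_field \<A> U s" and U: "open U" and c: "c \<in> \<A>" and y: "y \<in> snd c ` (U \<inter> fst c)"
  defines "e \<equiv> \<lambda>y v. to_chart \<A> c (chart_inv c y) (s (chart_inv c y) v)"
  shows "linear (e y)" "bij (e y)" "inv (e y) v = form_in_chart \<A> c (\<lambda>x. inv (s x)) y v"
    "smooth_on (snd c ` (U \<inter> fst c)) (\<lambda>y. e y v)"
proof -
  note x = chart_image_D[OF c y]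
  let ?x = "chart_inv c y"
  show lin: "linear (e y)"
    using linear_compose[OF smooth_frame_D(1)[OF s x(1)] linear_to_chart[OF c x(2)]] by (simp add: e_def o_def)
  have ei: "e y (form_in_chart \<A> c (\<lambda>x. inv (s x)) y v) = v" for v
    using smooth_frame_D(4)[OF s x(1)] to_from_chart(1)[OF c x(2)] by (simp add: e_def form_in_chart_def)
  have ie: "form_in_chart \<A> c (\<lambda>x. inv (s x)) y (e y v) = v" for v
    using smooth_frame_D(3)[OF s x(1)] to_from_chart(2)[OF c x(2)] by (simp add: e_def form_in_chart_def)
  show "bij (e y)" using ei ie by (metis bijI' )
  then show "inv (e y) v = form_in_chart \<A> c (\<lambda>x. inv (s x)) y v"
    using ei by (metis bij_inv_eq_iff)
  show "smooth_on (snd c ` (U \<inter> fst c)) (\<lambda>y. e y v)"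
    using s c unfolding e_def smooth_frame_field_def smooth_vector_field_def by blast
qed

text \<open>In a chart the coframe is the inverse of the frame matrix, so
  \<open>smooth_on_inv_family\<close> applies.\<close>

lemma smooth_coframe:
  assumes s: "smooth_frame_field \<A> U s" and U: "open U"
  shows "smooth_one_form \<A> U (\<lambda>x. inv (s x))"
  unfolding smooth_one_form_def
proof (intro conjI ballI allI)
  show "linear (inv (s x))" if "x \<in> U" for x using smooth_frame_D[OF s that] by blast
  fix c v assume c: "c \<in> \<A>"
  note f = frame_in_chart[OF s U c]
  let ?e = "\<lambda>y v. to_chart \<A> c (chart_inv c y) (s (chart_inv c y) v)"
  let ?S = "snd c ` (U \<inter> fst c)"
  have oS: "open ?S" by (rule open_image_chart[OF c U])
  have sm: "smooth_on ?S (\<lambda>y. ?e y v)" for v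
    using s c unfolding smooth_frame_field_def smooth_vector_field_def by blast
  have "smooth_on ?S (\<lambda>y. inv (?e y) v)"
    by (rule smooth_on_inv_family[OF oS f(1) f(2) sm])
  then show "smooth_on ?S (\<lambda>y. form_in_chart \<A> c (\<lambda>x. inv (s x)) y v)"
    using smooth_on_cong[OF oS, of "\<lambda>y. inv (?e y) v" "\<lambda>y. form_in_chart \<A> c (\<lambda>x. inv (s x)) y v"] f(3) by blast
qed

lemma smooth_family_transition:
  assumes s: "smooth_frame_field \<A> U s" and s': "smooth_frame_field \<A> U s'" and U: "open U"
  shows "smooth_family U (\<lambda>x. inv (s x) \<circ> s' x)"
  unfolding smooth_family_def
proof (intro conjI ballI allI)
  show "linear (inv (s x) \<circ> s' x)" if "x \<in> U" for x
    using smooth_frame_D[OF s that] smooth_frame_D[OF s' that] linear_compose by blast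
  fix c v assume c: "c \<in> \<A>"
  let ?S = "snd c ` (U \<inter> fst c)"
  have oS: "open ?S" by (rule open_image_chart[OF c U])
  note \<theta> = smooth_coframe[OF s U]
  have "smooth_on ?S (\<lambda>y. form_in_chart \<A> c (\<lambda>x. inv (s x)) y (to_chart \<A> c (chart_inv c y) (s' (chart_inv c y) v)))"
  proof (rule smooth_on_apply[OF oS, where L = "form_in_chart \<A> c (\<lambda>x. inv (s x))"])
    show "linear (form_in_chart \<A> c (\<lambda>x. inv (s x)) y)" if "y \<in> ?S" for y
      by (rule linear_form_in_chart[OF \<theta> c that])
    show "smooth_on ?S (\<lambda>y. form_in_chart \<A> c (\<lambda>x. inv (s x)) y v)" for v
      by (rule smooth_one_form_smooth_on[OF \<theta> c])
    show "smooth_on ?S (\<lambda>y. to_chart \<A> c (chart_inv c y) (s' (chart_inv c y) v))"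
      using s' c unfolding smooth_frame_field_def smooth_vector_field_def by blast
  qed
  moreover have "form_in_chart \<A> c (\<lambda>x. inv (s x)) y (to_chart \<A> c (chart_inv c y) (s' (chart_inv c y) v))
      = (inv (s (chart_inv c y)) \<circ> s' (chart_inv c y)) v" if "y \<in> ?S" for y
    using chart_image_D[OF c that] c by (simp add: form_in_chart_def)
  ultimately show "smooth_on ?S (\<lambda>y. (inv (s (chart_inv c y)) \<circ> s' (chart_inv c y)) v)"
    using smooth_on_cong[OF oS] by (metis (no_types, lifting))
qed

lemma smooth_frame_field_subset:
  assumes "smooth_frame_field \<A> U s" "N \<subseteq> U" shows "smooth_frame_field \<A> N s"
proof -
  have "smooth_on (snd c ` (N \<inter> fst c)) (\<lambda>y. to_chart \<A> c (chart_inv c y) (s (chart_inv c y) v))"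
    if "c \<in> \<A>" for c v
  proof (rule smooth_on_subset)
    show "smooth_on (snd c ` (U \<inter> fst c)) (\<lambda>y. to_chart \<A> c (chart_inv c y) (s (chart_inv c y) v))"
      using assms(1) that unfolding smooth_frame_field_def smooth_vector_field_def by blast
    show "snd c ` (N \<inter> fst c) \<subseteq> snd c ` (U \<inter> fst c)" using assms(2) by auto
  qed
  moreover have "\<forall>x\<in>N. linear (s x) \<and> bij (s x)" using assms unfolding smooth_frame_field_def by blast
  ultimately show ?thesis unfolding smooth_frame_field_def smooth_vector_field_def by simp
qed

end

section \<open>Flat connections and the computation of intrinsic torsion\<close>

locale manifold_with_group = smooth_manifold \<A> + linear_group G
  for \<A> :: "('m::topological_space, 'e::euclidean_space) chart set" and G :: "('e \<Rightarrow> 'e) set"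
begin

lemma lie_algebra_dir_deriv:
  assumes h: "smooth_family U h" and U: "open U" "x \<in> U" and G: "\<And>y. y \<in> U \<Longrightarrow> h y \<in> G" and "h x = id"
  shows "(\<lambda>v. dir_deriv \<A> (\<lambda>y. h y v) x X) \<in> lie_algebra G"
proof -
  let ?c = "chart_at \<A> x"
  have c: "?c \<in> \<A>" "x \<in> fst ?c" by (rule chart_at)+
  let ?S = "snd ?c ` (U \<inter> fst ?c)"
  have S: "open ?S" "snd ?c x \<in> ?S" using open_image_chart[OF c(1) U(1)] U c by auto
  have "(\<lambda>v. frechet_derivative (\<lambda>y. h (chart_inv ?c y) v) (at (snd ?c x)) (to_chart \<A> ?c x X)) \<in> lie_algebra G"
  proof (rule lie_algebra_family[OF S])
    show "h (chart_inv ?c y) \<in> G" if "y \<in> ?S" for y using chart_image_D[OF c(1) that] G by blast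
    show "smooth_on ?S (\<lambda>y. h (chart_inv ?c y) v)" for v using h c unfolding smooth_family_def by blast
    show "h (chart_inv ?c (snd ?c x)) = id" using assms by (simp add: chart_inv_chart[OF c])
  qed
  then show ?thesis by (simp add: dir_deriv_family[OF h U c])
qed

text \<open>Left translation by \<open>inv (h x)\<close> brings the family to the identity at
  \<open>x\<close>.\<close>

lemma lie_algebra_log_deriv:
  assumes h: "smooth_family U h" and U: "open U" "x \<in> U" and G: "\<And>y. y \<in> U \<Longrightarrow> h y \<in> G"
  shows "(\<lambda>v. inv (h x) (dir_deriv \<A> (\<lambda>y. h y v) x X)) \<in> lie_algebra G"
proof -
  have gx: "inv (h x) \<in> G" by (rule inv[OF G[OF U(2)]])
  have "(\<lambda>v. dir_deriv \<A> (\<lambda>y. inv (h x) (h y v)) x X) \<in> lie_algebra G"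
  proof (rule lie_algebra_dir_deriv[OF _ U])
    show "smooth_family U (\<lambda>y v. inv (h x) (h y v))"
      by (rule smooth_family_compose[OF smooth_family_const[OF lin[OF gx]] h U(1)])
    show "(\<lambda>v. inv (h x) (h y v)) \<in> G" if "y \<in> U" for y
      using comp[OF gx G[OF that]] by (simp add: o_def)
    show "(\<lambda>v. inv (h x) (h x v)) = id" using bij[OF G[OF U(2)]] by (simp add: bij_def fun_eq_iff)
  qed
  then show ?thesis using dir_deriv_family_linear[OF h U lin[OF gx]] by simp
qed

text \<open>The fibrewise half of \<open>G_structure\<close>. Together with explicitly given
  sections it suffices for the torsion of the extended structure.\<close>

definition homogeneous :: "('m \<Rightarrow> ('e \<Rightarrow> 'e) set) \<Rightarrow> bool" where
  "homogeneous P \<longleftrightarrow> (\<forall>x. \<forall>u\<in>P x. linear u \<and> bij u \<and> P x = {u \<circ> g |g. g \<in> G})"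

lemma homogeneous_transition:
  assumes "homogeneous P" "u \<in> P x" "u' \<in> P x"
  shows "inv u \<circ> u' \<in> G"
proof -
  obtain g where g: "g \<in> G" "u' = u \<circ> g" using assms unfolding homogeneous_def by blast
  have "inv u \<circ> u = id" using assms unfolding homogeneous_def bij_def by (meson inv_o_cancel)
  then show ?thesis using g by (simp flip: comp_assoc)
qed

text \<open>The logarithmic derivative of the transition from the reference section
  \<open>s0\<close> to \<open>s\<close>; the section \<open>s0\<close> itself is parallel.\<close>

definition flat_connection :: "('m \<Rightarrow> 'e \<Rightarrow> 'e) \<Rightarrow> ('m \<Rightarrow> 'e \<Rightarrow> 'e) \<Rightarrow> 'm \<Rightarrow> 'e \<Rightarrow> 'e \<Rightarrow> 'e" where
  "flat_connection s0 s x X v =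
     inv (inv (s0 x) \<circ> s x) (dir_deriv \<A> (\<lambda>y. (inv (s0 y) \<circ> s y) v) x X)"

lemma local_section_D:
  assumes "local_section \<A> P U s"
  shows "smooth_frame_field \<A> U s" "\<And>x. x \<in> U \<Longrightarrow> s x \<in> P x"
  using assms unfolding local_section_def by blast+

lemma local_section_subset:
  "local_section \<A> P U s \<Longrightarrow> N \<subseteq> U \<Longrightarrow> local_section \<A> P N s"
  unfolding local_section_def using smooth_frame_field_subset by blast

lemma transition_in_group:
  assumes "homogeneous P" "local_section \<A> P N s" "local_section \<A> P N s'" "x \<in> N"
  shows "inv (s x) \<circ> s' x \<in> G"
  using homogeneous_transition[OF assms(1)] local_section_D(2)[OF assms(2,4)] local_section_D(2)[OF assms(3,4)] by blast

text \<open>Provides a connection, so that the union defining the intrinsic torsion is not empty.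
  The transformation rule is the product rule for the logarithmic derivative of a product
  \<open>h g\<close>.\<close>

lemma G_connection_flat:
  assumes P: "homogeneous P" and s0: "local_section \<A> P U s0"
  shows "G_connection \<A> G P U (flat_connection s0)"
  unfolding G_connection_def
proof (intro conjI allI impI)
  fix N s assume "open N \<and> N \<subseteq> U \<and> local_section \<A> P N s"
  then have N: "open N" "N \<subseteq> U" and s: "local_section \<A> P N s" by auto
  have s0N: "local_section \<A> P N s0" by (rule local_section_subset[OF s0 N(2)])
  define h where "h y = inv (s0 y) \<circ> s y" for y
  have h: "smooth_family N h" unfolding h_def
    by (rule smooth_family_transition[OF local_section_D(1)[OF s0N] local_section_D(1)[OF s] N(1)])
  have hG: "h y \<in> G" if "y \<in> N" for y
    unfolding h_def by (rule transition_in_group[OF P s0N s that])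
  have fc: "flat_connection s0 s x X v = inv (h x) (dir_deriv \<A> (\<lambda>y. h y v) x X)" for x X v
    by (simp add: flat_connection_def h_def)
  show "\<forall>x\<in>N. \<forall>X. flat_connection s0 s x X \<in> lie_algebra G"
    using lie_algebra_log_deriv[OF h N(1) _ hG] unfolding fc[abs_def] by blast
  show "smooth_one_form \<A> N (\<lambda>x X. flat_connection s0 s x X v)" for v
    unfolding smooth_one_form_def fc
  proof (intro conjI ballI allI)
    show "linear (\<lambda>X. inv (h x) (dir_deriv \<A> (\<lambda>y. h y v) x X))" if "x \<in> N" for x
      using linear_compose[OF linear_dir_deriv_family[OF h N(1) that] lin[OF inv[OF hG[OF that]]]] by (simp add: o_def)
    fix c w assume c: "c \<in> \<A>"
    let ?S = "snd c ` (N \<inter> fst c)"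
    have oS: "open ?S" by (rule open_image_chart[OF c N(1)])
    note y = chart_image_D[OF c]
    have sh: "smooth_on ?S (\<lambda>y. h (chart_inv c y) v)" for v using h c unfolding smooth_family_def by blast
    have "smooth_on ?S (\<lambda>y. inv (h (chart_inv c y)) (frechet_derivative (\<lambda>y. h (chart_inv c y) v) (at y) w))"
    proof (rule smooth_on_apply[OF oS, where L = "\<lambda>y. inv (h (chart_inv c y))"])
      show "linear (inv (h (chart_inv c y)))" if "y \<in> ?S" for y by (rule lin[OF inv[OF hG[OF y(1)[OF that]]]])
      show "smooth_on ?S (\<lambda>y. inv (h (chart_inv c y)) v)" for v
        by (rule smooth_on_inv_family[OF oS lin[OF hG[OF y(1)]] bij[OF hG[OF y(1)]] sh])
      show "smooth_on ?S (\<lambda>y. frechet_derivative (\<lambda>y. h (chart_inv c y) v) (at y) w)"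
        by (rule smooth_on_frechet[OF sh])
    qed
    moreover have "inv (h (chart_inv c y)) (frechet_derivative (\<lambda>y. h (chart_inv c y) v) (at y) w)
       = form_in_chart \<A> c (\<lambda>x X. inv (h x) (dir_deriv \<A> (\<lambda>y. h y v) x X)) y w" if "y' = y" "y \<in> ?S" for y y'
      using y[OF that(2)] c by (simp add: form_in_chart_def dir_deriv_family[OF h N(1) _ c])
    ultimately show "smooth_on ?S (\<lambda>y. form_in_chart \<A> c (\<lambda>x X. inv (h x) (dir_deriv \<A> (\<lambda>y. h y v) x X)) y w)"
      using smooth_on_cong[OF oS] by (metis (no_types, lifting))
  qed
next
  fix N s s' assume "open N \<and> N \<subseteq> U \<and> local_section \<A> P N s \<and> local_section \<A> P N s'"
  then have N: "open N" "N \<subseteq> U" and s: "local_section \<A> P N s" and s': "local_section \<A> P N s'" by auto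
  have s0N: "local_section \<A> P N s0" by (rule local_section_subset[OF s0 N(2)])
  let ?h = "\<lambda>y. inv (s0 y) \<circ> s y" and ?g = "\<lambda>y. inv (s y) \<circ> s' y" and ?h' = "\<lambda>y. inv (s0 y) \<circ> s' y"
  note h = smooth_family_transition[OF local_section_D(1)[OF s0N] local_section_D(1)[OF s] N(1)]
  note g = smooth_family_transition[OF local_section_D(1)[OF s] local_section_D(1)[OF s'] N(1)]
  have hg: "?h' y v = ?h y (?g y v)" if "y \<in> N" for y v
    using smooth_frame_D(4)[OF local_section_D(1)[OF s] that] by simp
  have "flat_connection s0 s' x X v =
      inv (?g x) (flat_connection s0 s x X (?g x v)) + inv (?g x) (dir_deriv \<A> (\<lambda>y. ?g y v) x X)" if x: "x \<in> N" for x X v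
  proof -
    have G: "?h x \<in> G" "?g x \<in> G"
      by (rule transition_in_group[OF P s0N s x] transition_in_group[OF P s s' x])+
    have "?h' x = ?h x \<circ> ?g x" using hg[OF x] by (simp add: fun_eq_iff)
    then have invh': "inv (?h' x) z = inv (?g x) (inv (?h x) z)" for z
      using o_inv_distrib[OF bij[OF G(1)] bij[OF G(2)]] by (metis comp_apply)
    have "dir_deriv \<A> (\<lambda>y. ?h' y v) x X = dir_deriv \<A> (\<lambda>y. ?h y (?g y v)) x X"
    proof -
      let ?c = "chart_at \<A> x"
      have c: "?c \<in> \<A>" "x \<in> fst ?c" by (rule chart_at)+
      have "frechet_derivative (\<lambda>y. ?h' (chart_inv ?c y) v) (at (snd ?c x))
          = frechet_derivative (\<lambda>y. ?h (chart_inv ?c y) (?g (chart_inv ?c y) v)) (at (snd ?c x))"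
        by (rule frechet_derivative_cong_open[OF open_image_chart[OF c(1) N(1)]])
           (use x c in simp, metis chart_image_D(1)[OF c(1)] hg)
      then show ?thesis unfolding dir_deriv_def by (simp add: o_def)
    qed
    also have "\<dots> = dir_deriv \<A> (\<lambda>y. ?h y (?g x v)) x X + ?h x (dir_deriv \<A> (\<lambda>y. ?g y v) x X)"
      by (rule dir_deriv_family_apply[OF h g N(1) x])
    finally have d: "dir_deriv \<A> (\<lambda>y. ?h' y v) x X = dir_deriv \<A> (\<lambda>y. ?h y (?g x v)) x X + ?h x (dir_deriv \<A> (\<lambda>y. ?g y v) x X)" .
    have hh: "inv (?h x) (?h x z) = z" for z by (rule inv_f_f[OF bij_is_inj[OF bij[OF G(1)]]])
    show ?thesis
      unfolding flat_connection_def[of s0 s'] flat_connection_def[of s0 s] invh' d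
        linear_add[OF lin[OF inv[OF G(1)]]] linear_add[OF lin[OF inv[OF G(2)]]] hh ..
  qed
  then show "let g = ?g in \<forall>x\<in>N. \<forall>X v. flat_connection s0 s' x X v =
      inv (g x) (flat_connection s0 s x X (g x v)) + inv (g x) (dir_deriv \<A> (\<lambda>y. g y v) x X)"
    unfolding Let_def by blast
qed

text \<open>The transition between the two sections is the identity at \<open>x\<close>, so its
  derivative there lies in the Lie algebra; by \<open>ext_deriv_gauge\<close> the torsions differ by
  the antisymmetrization of this derivative.\<close>

lemma coker_class_section_indep:
  assumes P: "homogeneous P" and s: "local_section \<A> P U s" and s': "local_section \<A> P U s'" and U: "open U" "x \<in> U"
    and eq: "s x = s' x"
  shows "coker_class G (coframe_torsion \<A> s x) = coker_class G (coframe_torsion \<A> s' x)"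
proof -
  let ?g = "\<lambda>y. inv (s y) \<circ> s' y"
  have sf: "smooth_frame_field \<A> U s" "smooth_frame_field \<A> U s'" using local_section_D(1) s s' by blast+
  note g = smooth_family_transition[OF sf U(1)]
  have gG: "?g y \<in> G" if "y \<in> U" for y by (rule transition_in_group[OF P s s' that])
  have gx: "?g x = id" using smooth_frame_D(3)[OF sf(1) U(2)] by (simp add: fun_eq_iff flip: eq)
  define a where "a X v = dir_deriv \<A> (\<lambda>y. ?g y v) x (s x X)" for X v
  show ?thesis
  proof (rule coker_class_eqI[of a])
    show "a X \<in> lie_algebra G" for X
      unfolding a_def by (rule lie_algebra_dir_deriv[OF g U gG gx])
    show "linear (\<lambda>X. a X Y)" for Y
      using linear_compose[OF smooth_frame_D(1)[OF sf(1) U(2)] linear_dir_deriv_family[OF g U, of Y]] unfolding a_def by (simp add: o_def)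
    fix X Y
    have "ext_deriv \<A> (\<lambda>y. inv (s y)) x (s x X) (s x Y) = ?g x (ext_deriv \<A> (\<lambda>y. inv (s' y)) x (s x X) (s x Y))
        + dir_deriv \<A> (\<lambda>y. ?g y (inv (s' x) (s x Y))) x (s x X) - dir_deriv \<A> (\<lambda>y. ?g y (inv (s' x) (s x X))) x (s x Y)"
      by (rule ext_deriv_gauge[OF g smooth_coframe[OF sf(2) U(1)] smooth_coframe[OF sf(1) U(1)] U])
         (simp add: smooth_frame_D(4)[OF sf(2)])
    then show "coframe_torsion \<A> s x X Y = coframe_torsion \<A> s' x X Y + (a X Y - a Y X)"
      unfolding gx coframe_torsion_def a_def using smooth_frame_D(3)[OF sf(2) U(2)] by (simp add: eq)
  qed
qed

lemma coker_class_torsion: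
  assumes s: "local_section \<A> P U s" and U: "open U" "x \<in> U" and \<omega>: "G_connection \<A> G P U \<omega>"
  shows "coker_class G (torsion \<A> \<omega> s x) = coker_class G (coframe_torsion \<A> s x)"
proof (rule coker_class_eqI[of "\<lambda>X. \<omega> s x (s x X)"])
  have w: "\<omega> s x X \<in> lie_algebra G" "linear (\<lambda>X. \<omega> s x X v)" for X v
    using \<omega> s U unfolding G_connection_def smooth_one_form_def by blast+
  then show "\<omega> s x (s x X) \<in> lie_algebra G" for X by blast
  show "linear (\<lambda>X. \<omega> s x (s x X) Y)" for Y
    using linear_compose[OF smooth_frame_D(1)[OF local_section_D(1)[OF s] U(2)] w(2), of Y] by (simp add: o_def)
qed (simp add: torsion_def coframe_torsion_def)

text \<open>All cosets in the union coincide: changing the connection adds an element of the image,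
  and changing the section is covered by \<open>coker_class_section_indep\<close>.\<close>

lemma intrinsic_torsion_eq:
  assumes P: "homogeneous P" and s: "local_section \<A> P U s" and U: "open U" "x \<in> U"
  shows "intrinsic_torsion \<A> G P x (s x) = coker_class G (coframe_torsion \<A> s x)"
proof -
  have "coker_class G (torsion \<A> \<omega> s' x) = coker_class G (coframe_torsion \<A> s x)"
    if U': "open U'" "x \<in> U'" "local_section \<A> P U' s'" "s' x = s x" "G_connection \<A> G P U' \<omega>" for U' s' \<omega>
  proof -
    have "local_section \<A> P (U \<inter> U') s" "local_section \<A> P (U \<inter> U') s'"
      using local_section_subset s U'(3) by blast+
    then have "coker_class G (coframe_torsion \<A> s x) = coker_class G (coframe_torsion \<A> s' x)"
      by (rule coker_class_section_indep[OF P]) (use U U' in auto)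
    then show ?thesis using coker_class_torsion[OF U'(3,1,2,5)] by simp
  qed
  moreover have "G_connection \<A> G P U (flat_connection s)" by (rule G_connection_flat[OF P s])
  ultimately show ?thesis
    unfolding intrinsic_torsion_def using s U
    by (intro equalityI subsetI; (elim UnionE CollectE exE conjE)?) (blast | metis)+
qed

end

section \<open>The Bianchi identity\<close>

lemma bilinear_compose_linear:
  assumes "bilinear b" "linear l" shows "bilinear (\<lambda>x y. b (l x) (l y))"
proof -
  have "linear (b (l x))" "linear (\<lambda>x. b x (l y))" for x y using assms(1) by (auto simp: bilinear_def)
  from linear_compose[OF assms(2) this(1)] linear_compose[OF assms(2) this(2)]
  show ?thesis by (simp add: bilinear_def o_def)
qed

lemma ext_deriv_flat_cong:
  assumes "open S" "p \<in> S" "\<And>y v. y \<in> S \<Longrightarrow> a y v = b y v"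
  shows "ext_deriv_flat a p X Y = ext_deriv_flat b p X Y"
  unfolding ext_deriv_flat_def
  using frechet_derivative_cong_open[OF assms(1,2), of "\<lambda>y. a y _" "\<lambda>y. b y _"] assms(3) by simp

lemma bilinear_ext_deriv_flat:
  fixes a :: "'e::euclidean_space \<Rightarrow> 'e \<Rightarrow> 'b::real_normed_vector"
  assumes S: "open S" "p \<in> S" and lin: "\<And>y. y \<in> S \<Longrightarrow> linear (a y)" and a: "\<And>v. smooth_on S (\<lambda>y. a y v)"
  shows "bilinear (ext_deriv_flat a p)"
  unfolding bilinear_def ext_deriv_flat_def
  by (intro conjI allI linear_compose_sub linear_frechet_family[OF S lin a]
      has_derivative_linear[OF smooth_on_has_derivative[OF a S(2)]])

text \<open>The \<open>P\<close>-component of \<open>d d\<theta> = 0\<close> on three vectors of \<open>N\<close>, when the \<open>P\<close>-component of the torsion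
  is constant on \<open>N\<close>.\<close>
lemma bianchi_flat:
  fixes e :: "'e::euclidean_space \<Rightarrow> 'e \<Rightarrow> 'e" and P :: "'e \<Rightarrow> 'b::euclidean_space"
  assumes S: "open S" "p \<in> S" and lin: "\<And>y. y \<in> S \<Longrightarrow> linear (e y)" and bij: "\<And>y. y \<in> S \<Longrightarrow> bij (e y)"
    and e: "\<And>v. smooth_on S (\<lambda>y. e y v)" and P: "linear P"
    and const: "\<And>y u u'. y \<in> S \<Longrightarrow> u \<in> N \<Longrightarrow> u' \<in> N \<Longrightarrow> P (ext_deriv_flat (\<lambda>y. inv (e y)) y (e y u) (e y u')) = C u u'"
    and u: "u1 \<in> N" "u2 \<in> N" "u3 \<in> N"
  defines "\<tau> \<equiv> \<lambda>u u'. ext_deriv_flat (\<lambda>y. inv (e y)) p (e p u) (e p u')"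
  shows "P (\<tau> (\<tau> u1 u2) u3) + P (\<tau> (\<tau> u2 u3) u1) + P (\<tau> (\<tau> u3 u1) u2) = 0"
proof -
  define \<theta> where "\<theta> y = inv (e y)" for y
  have l\<theta>: "linear (\<theta> y)" if "y \<in> S" for y unfolding \<theta>_def by (rule linear_inv[OF lin[OF that] bij[OF that]])
  have s\<theta>: "smooth_on S (\<lambda>y. \<theta> y v)" for v unfolding \<theta>_def by (rule smooth_on_inv_family[OF S(1) lin bij e])
  have \<theta>e: "\<theta> y (e y v) = v" "e y (\<theta> y v) = v" if "y \<in> S" for y v
    using bij[OF that] by (simp_all add: \<theta>_def bij_def surj_f_inv_f)
  define \<alpha> where "\<alpha> y v = P (\<theta> y v)" for y v
  have s\<alpha>: "smooth_on S (\<lambda>y. \<alpha> y v)" for v unfolding \<alpha>_def by (rule smooth_on_linear[OF P S(1) s\<theta>])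
  have l\<alpha>: "linear (\<alpha> y)" if "y \<in> S" for y unfolding \<alpha>_def using linear_compose[OF l\<theta>[OF that] P] by (simp add: o_def)
  define D\<alpha> where "D\<alpha> y X Y = frechet_derivative (\<lambda>y. \<alpha> y Y) (at y) X" for y X Y
  define W where "W y X Y = D\<alpha> y X Y - D\<alpha> y Y X" for y X Y
  have sD: "smooth_on S (\<lambda>y. D\<alpha> y X Y)" for X Y unfolding D\<alpha>_def by (rule smooth_on_frechet[OF s\<alpha>])
  have sW: "smooth_on S (\<lambda>y. W y X Y)" for X Y unfolding W_def by (intro smooth_on_diff sD S)
  have WP: "W y X Y = P (ext_deriv_flat \<theta> y X Y)" if "y \<in> S" for y X Y
  proof -
    have "bounded_linear P" using P by (simp add: linear_conv_bounded_linear)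
    from frechet_derivative_bounded_linear[OF this smooth_on_differentiable[OF s\<theta> that]]
    show ?thesis by (simp add: W_def D\<alpha>_def \<alpha>_def ext_deriv_flat_def linear_diff[OF P])
  qed
  have bW: "bilinear (W y)" if "y \<in> S" for y
    using bilinear_ext_deriv_flat[OF S(1) that l\<alpha> s\<alpha>] by (simp add: W_def[abs_def] D\<alpha>_def ext_deriv_flat_def[abs_def])
  \<comment> \<open>\<open>d d \<alpha> = 0\<close> on constant vector fields, by symmetry of second
    derivatives.\<close>
  have closed: "frechet_derivative (\<lambda>y. W y Y Z) (at p) X + frechet_derivative (\<lambda>y. W y Z X) (at p) Y
     + frechet_derivative (\<lambda>y. W y X Y) (at p) Z = 0" for X Y Z
  proof -
    have d: "frechet_derivative (\<lambda>y. W y Y Z) (at p) X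
      = frechet_derivative (\<lambda>y. D\<alpha> y Y Z) (at p) X - frechet_derivative (\<lambda>y. D\<alpha> y Z Y) (at p) X" for X Y Z
    proof -
      have "((\<lambda>y. W y Y Z) has_derivative (\<lambda>X. frechet_derivative (\<lambda>y. D\<alpha> y Y Z) (at p) X
          - frechet_derivative (\<lambda>y. D\<alpha> y Z Y) (at p) X)) (at p)"
        unfolding W_def by (intro has_derivative_diff smooth_on_has_derivative[OF sD S(2)])
      then show ?thesis by (metis (no_types, lifting) frechet_derivative_at)
    qed
    have c: "frechet_derivative (\<lambda>y. D\<alpha> y Y Z) (at p) X = frechet_derivative (\<lambda>y. D\<alpha> y X Z) (at p) Y" for X Y Z
      unfolding D\<alpha>_def by (rule frechet_derivative_commute[OF s\<alpha> S])
    show ?thesis unfolding d using c[of X Y Z] c[of Y Z X] c[of Z X Y] by simp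
  qed
  \<comment> \<open>\<open>d \<alpha>\<close> in the moving frame. The hypothesis
    \<open>const\<close> makes it constant in \<open>y\<close> on pairs from
    \<open>N\<close>.\<close>
  define T where "T y a b = W y (e y a) (e y b)" for y a b
  have bT: "bilinear (T y)" if "y \<in> S" for y
    unfolding T_def by (rule bilinear_compose_linear[OF bW[OF that] lin[OF that]])
  have sT: "smooth_on S (\<lambda>y. T y a b)" for a b
  proof -
    have lW: "linear (W y X)" "linear (\<lambda>X. W y X Z)" if "y \<in> S" for y X Z
      using bW[OF that] by (auto simp: bilinear_def)
    have "smooth_on S (\<lambda>y. W y X (e y b))" for X
      by (rule smooth_on_apply[OF S(1) lW(1) sW e])
    from smooth_on_apply[where L = "\<lambda>y X. W y X (e y b)", OF S(1) lW(2) this e]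
    show ?thesis unfolding T_def .
  qed
  define D\<theta> where "D\<theta> X Y = frechet_derivative (\<lambda>y. \<theta> y Y) (at p) X" for X Y
  \<comment> \<open>The coordinate vectors \<open>e p a\<close> and \<open>e p b\<close> are frozen.
    Re-expanding them in the frame at \<open>y\<close> and using that \<open>T y a b\<close> is
    constant leaves only derivatives of the coframe \<open>\<theta>\<close>.\<close>
  have key: "frechet_derivative (\<lambda>y. W y (e p a) (e p b)) (at p) X = T p (D\<theta> X (e p a)) b + T p a (D\<theta> X (e p b))"
    if ab: "a \<in> N" "b \<in> N" for X a b
  proof -
    let ?Y = "e p a" and ?Z = "e p b"
    have dY: "((\<lambda>y. \<theta> y ?Y) has_derivative (\<lambda>X. D\<theta> X ?Y)) (at p)"
      and dZ: "((\<lambda>y. \<theta> y ?Z) has_derivative (\<lambda>X. D\<theta> X ?Z)) (at p)"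
      unfolding D\<theta>_def by (rule smooth_on_has_derivative[OF s\<theta> S(2)])+
    have linT: "linear (T y x)" "linear (\<lambda>x. T y x x')" if "y \<in> S" for y x x' using bT[OF that] by (auto simp: bilinear_def)
    have sM: "smooth_on S (\<lambda>y. T y x (\<theta> y ?Z))" for x
      by (rule smooth_on_apply[OF S(1) linT(1) sT s\<theta>])
    have 1: "((\<lambda>y. T y a (\<theta> y ?Z)) has_derivative (\<lambda>X. frechet_derivative (\<lambda>y. T y a (\<theta> p ?Z)) (at p) X + T p a (D\<theta> X ?Z))) (at p)"
      by (rule has_derivative_apply[OF S linT(1) sT dZ])
    have "T y a b = C a b" if "y \<in> S" for y
      using const[OF that ab] WP[OF that] by (simp add: T_def \<theta>_def[abs_def])
    then have "frechet_derivative (\<lambda>y. T y a b) (at p) = frechet_derivative (\<lambda>y. C a b) (at p)"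
      by (rule frechet_derivative_cong_open[OF S])
    with 1 have 2: "frechet_derivative (\<lambda>y. T y a (\<theta> y ?Z)) (at p) = (\<lambda>X. T p a (D\<theta> X ?Z))"
      using frechet_derivative_at[OF 1] by (simp add: \<theta>e[OF S(2)] frechet_derivative_const)
    have "((\<lambda>y. T y (\<theta> y ?Y) (\<theta> y ?Z)) has_derivative
        (\<lambda>X. frechet_derivative (\<lambda>y. T y (\<theta> p ?Y) (\<theta> y ?Z)) (at p) X + T p (D\<theta> X ?Y) (\<theta> p ?Z))) (at p)"
      by (rule has_derivative_apply[OF S, where L = "\<lambda>y x. T y x (\<theta> y ?Z)"]) (use linT(2) sM dY in auto)
    then have "((\<lambda>y. T y (\<theta> y ?Y) (\<theta> y ?Z)) has_derivative (\<lambda>X. T p a (D\<theta> X ?Z) + T p (D\<theta> X ?Y) b)) (at p)"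
      by (simp add: \<theta>e[OF S(2)] 2)
    then have "((\<lambda>y. W y ?Y ?Z) has_derivative (\<lambda>X. T p a (D\<theta> X ?Z) + T p (D\<theta> X ?Y) b)) (at p)"
      by (rule has_derivative_transform_within_open[OF _ S]) (simp add: T_def \<theta>e)
    then show ?thesis by (metis (no_types, lifting) frechet_derivative_at add.commute)
  qed
  have Tskew: "T p a b = - T p b a" for a b by (simp add: T_def W_def)
  have \<tau>: "\<tau> a b = D\<theta> (e p a) (e p b) - D\<theta> (e p b) (e p a)" for a b
    by (simp add: \<tau>_def ext_deriv_flat_def D\<theta>_def \<theta>_def)
  have P\<tau>: "P (\<tau> a b) = T p a b" for a b
    using WP[OF S(2)] by (simp add: T_def \<tau>_def \<theta>_def[abs_def])
  have sub: "T p (a - b) c = T p a c - T p b c" for a b c by (rule bilinear_lsub[OF bT[OF S(2)]])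
  \<comment> \<open>After \<open>key\<close>, closedness has six terms; skewness of \<open>T\<close>
    pairs them into the differences that make up \<open>\<tau>\<close>.\<close>
  show ?thesis
    unfolding P\<tau> \<tau>[of u1] \<tau>[of u2] \<tau>[of u3] sub
    using closed[of "e p u2" "e p u3" "e p u1"] Tskew[of u1 "D\<theta> _ _"] Tskew[of u2 "D\<theta> _ _"] Tskew[of u3 "D\<theta> _ _"]
    unfolding key[OF u(1,2)] key[OF u(2,3)] key[OF u(3,1)] by (simp add: algebra_simps)
qed

context smooth_manifold
begin

lemma coframe_torsion_chart:
  assumes s: "smooth_frame_field \<A> U s" and U: "open U" "x \<in> U" and c: "c \<in> \<A>" "x \<in> fst c"
  defines "e \<equiv> \<lambda>y v. to_chart \<A> c (chart_inv c y) (s (chart_inv c y) v)"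
  shows "coframe_torsion \<A> s x u u' = ext_deriv_flat (\<lambda>y. inv (e y)) (snd c x) (e (snd c x) u) (e (snd c x) u')"
proof -
  let ?S = "snd c ` (U \<inter> fst c)"
  have S: "open ?S" "snd c x \<in> ?S" using open_image_chart[OF c(1) U(1)] U c by auto
  have "ext_deriv_flat (form_in_chart \<A> c (\<lambda>x. inv (s x))) (snd c x) X Y = ext_deriv_flat (\<lambda>y. inv (e y)) (snd c x) X Y" for X Y
    using frame_in_chart(3)[OF s U(1) c(1)] unfolding e_def by (intro ext_deriv_flat_cong[OF S]) simp
  then show ?thesis
    unfolding coframe_torsion_def ext_deriv_chart[OF smooth_coframe[OF s U(1)] U c]
    by (simp add: e_def chart_inv_chart[OF c])
qed

lemma coframe_torsion_skew: "coframe_torsion \<A> s x u u' = - coframe_torsion \<A> s x u' u"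
  by (simp add: coframe_torsion_def ext_deriv_def Let_def)

lemma bilinear_coframe_torsion:
  assumes s: "smooth_frame_field \<A> U s" and U: "open U" "x \<in> U"
  shows "bilinear (coframe_torsion \<A> s x)"
proof -
  let ?c = "chart_at \<A> x"
  have c: "?c \<in> \<A>" "x \<in> fst ?c" by (rule chart_at)+
  let ?S = "snd ?c ` (U \<inter> fst ?c)"
  have S: "open ?S" "snd ?c x \<in> ?S" using open_image_chart[OF c(1) U(1)] U c by auto
  note \<theta> = smooth_coframe[OF s U(1)]
  have "bilinear (ext_deriv_flat (form_in_chart \<A> ?c (\<lambda>x. inv (s x))) (snd ?c x))"
    by (rule bilinear_ext_deriv_flat[OF S linear_form_in_chart[OF \<theta> c(1)] smooth_one_form_smooth_on[OF \<theta> c(1)]])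
  moreover have "linear (\<lambda>u. to_chart \<A> ?c x (s x u))"
    using linear_compose[OF smooth_frame_D(1)[OF s U(2)] linear_to_chart[OF c]] by (simp add: o_def)
  ultimately show ?thesis
    unfolding coframe_torsion_def[abs_def] ext_deriv_chart[OF \<theta> U c]
    by (rule bilinear_compose_linear)
qed

lemma bianchi_identity:
  fixes P :: "'e \<Rightarrow> 'b::euclidean_space"
  assumes s: "smooth_frame_field \<A> U s" and U: "open U" "x \<in> U" and P: "linear P"
    and const: "\<And>y u u'. y \<in> U \<Longrightarrow> u \<in> N \<Longrightarrow> u' \<in> N \<Longrightarrow> P (coframe_torsion \<A> s y u u') = C u u'"
    and u: "u1 \<in> N" "u2 \<in> N" "u3 \<in> N"
  defines "\<tau> \<equiv> coframe_torsion \<A> s x"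
  shows "P (\<tau> (\<tau> u1 u2) u3) + P (\<tau> (\<tau> u2 u3) u1) + P (\<tau> (\<tau> u3 u1) u2) = 0"
proof -
  let ?c = "chart_at \<A> x"
  have c: "?c \<in> \<A>" "x \<in> fst ?c" by (rule chart_at)+
  let ?S = "snd ?c ` (U \<inter> fst ?c)"
  have S: "open ?S" "snd ?c x \<in> ?S" using open_image_chart[OF c(1) U(1)] U c by auto
  let ?e = "\<lambda>y v. to_chart \<A> ?c (chart_inv ?c y) (s (chart_inv ?c y) v)"
  note f = frame_in_chart[OF s U(1) c(1)]
  have sm: "smooth_on ?S (\<lambda>y. ?e y v)" for v by (rule f(4)[OF S(2)])
  have co: "P (ext_deriv_flat (\<lambda>y. inv (?e y)) y (?e y u) (?e y u')) = C u u'" if "y \<in> ?S" "u \<in> N" "u' \<in> N" for y u u'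
    using coframe_torsion_chart[OF s U(1) chart_image_D(1)[OF c(1) that(1)] c(1) chart_image_D(2)[OF c(1) that(1)], of u u']
      const[OF chart_image_D(1)[OF c(1) that(1)] that(2,3)]
    unfolding chart_image_D(3)[OF c(1) that(1)] by simp
  show ?thesis
    unfolding \<tau>_def coframe_torsion_chart[OF s U c]
    by (rule bianchi_flat[OF S f(1) f(2) sm P co u])
qed

lemma dir_deriv_cong:
  assumes "open U" "x \<in> U" "\<And>y. y \<in> U \<Longrightarrow> f y = g y"
  shows "dir_deriv \<A> f x X = dir_deriv \<A> g x X"
proof -
  let ?c = "chart_at \<A> x"
  have c: "?c \<in> \<A>" "x \<in> fst ?c" by (rule chart_at)+
  have "frechet_derivative (f \<circ> chart_inv ?c) (at (snd ?c x)) = frechet_derivative (g \<circ> chart_inv ?c) (at (snd ?c x))"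
    by (rule frechet_derivative_cong_open[OF open_image_chart[OF c(1) assms(1)]])
       (use assms c chart_image_D(1)[OF c(1)] in auto)
  then show ?thesis unfolding dir_deriv_def by simp
qed

end

section \<open>Adapted frames\<close>

locale qc_manifold = smooth_manifold \<A>
  for \<A> :: "('m::topological_space, 'n::finite model) chart set"
begin

sublocale BG: manifold_with_group \<A> B_group ..

definition good_section :: "('m \<Rightarrow> 'n model set) \<Rightarrow> 'm set \<Rightarrow> ('m \<Rightarrow> 'n model \<Rightarrow> 'n model) \<Rightarrow> bool" where
  "good_section D U s \<longleftrightarrow> open U \<and> smooth_frame_field \<A> U s \<and> (\<forall>x\<in>U.
     s x ` (UNIV \<times> {0}) = D x \<and>
     (\<forall>v v'. snd (coframe_torsion \<A> s x (v, 0) (v', 0)) = om v v') \<and>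
     (\<exists>\<mu>. \<forall>v w w'. snd (coframe_torsion \<A> s x (0, w) (v, 0)) \<bullet> w' + snd (coframe_torsion \<A> s x (0, w') (v, 0)) \<bullet> w
        = \<mu> v * (w \<bullet> w')))"

lemma good_section_D:
  assumes "good_section D U s"
  shows "open U" "smooth_frame_field \<A> U s" "\<And>x. x \<in> U \<Longrightarrow> s x ` (UNIV \<times> {0}) = D x"
    "\<And>x v v'. x \<in> U \<Longrightarrow> snd (coframe_torsion \<A> s x (v, 0) (v', 0)) = om v v'"
    "\<And>x. x \<in> U \<Longrightarrow> \<exists>\<mu>. \<forall>v w w'. snd (coframe_torsion \<A> s x (0, w) (v, 0)) \<bullet> w'
       + snd (coframe_torsion \<A> s x (0, w') (v, 0)) \<bullet> w = \<mu> v * (w \<bullet> w')"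
  using assms unfolding good_section_def by auto

text \<open>On V the W-component of the torsion is the constant \<open>om\<close> at every point of
  \<open>U\<close>, so \<open>bianchi_identity\<close> applies with V as \<open>N\<close>.\<close>

lemma good_section_coker_class:
  assumes s: "good_section D U s" and x: "x \<in> U"
  shows "coker_class B_group (coframe_torsion \<A> s x) = coker_class B_group Theta0"
proof -
  note g = good_section_D[OF s]
  obtain \<mu> where \<mu>: "snd (coframe_torsion \<A> s x (0, w) (v, 0)) \<bullet> w'
       + snd (coframe_torsion \<A> s x (0, w') (v, 0)) \<bullet> w = \<mu> v * (w \<bullet> w')" for v w w'
    using g(5)[OF x] by blast
  have c: "snd (coframe_torsion \<A> s y u u') = om (fst u) (fst u')" if "y \<in> U" "u \<in> UNIV \<times> {0}" "u' \<in> UNIV \<times> {0}" for y u u'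
    using g(4)[OF that(1), of "fst u" "fst u'"] that(2,3) by (auto simp: prod_eq_iff)
  show ?thesis
    by (rule coker_class_Theta0I[OF bilinear_coframe_torsion[OF g(2,1) x] coframe_torsion_skew g(4)[OF x] \<mu>])
       (rule bianchi_identity[OF g(2,1) x linear_snd c], auto)
qed

lemma K_group_D:
  assumes "k \<in> K_group"
  obtains g p z where "g \<in> Sp" "p \<noteq> 0" "\<And>v w. k (v, w) = (act_V g p v + rim (act_W p w) z, act_W p w)"
  using assms unfolding K_group_def semidirect_iff EH_eq by blast

lemma K_subset_B: "k \<in> K_group \<Longrightarrow> k \<in> B_group"
  using linear_rim(2) unfolding K_group_def B_group_def semidirect_iff EH_eq by blast

text \<open>For a constant \<open>k\<close> the gauge formula has no derivative terms, and the
  torsion is merely conjugated. The EH-part of \<open>k\<close> alters the multiple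
  \<open>\<mu>\<close> according to \<open>rim_conformal\<close>.\<close>

lemma good_section_comp_K:
  assumes s: "good_section D U s" and k: "k \<in> K_group"
  shows "good_section D U (\<lambda>x. s x \<circ> k)"
proof -
  note g = good_section_D[OF s]
  obtain a p z where a: "a \<in> Sp" "p \<noteq> 0" and kd: "\<And>v w. k (v, w) = (act_V a p v + rim (act_W p w) z, act_W p w)"
    using K_group_D[OF k] by metis
  have kB: "k \<in> B_group" by (rule K_subset_B[OF k])
  have lk: "linear k" and bk: "bij k" using B.lin[OF kB] B.bij[OF kB] .
  have lW: "linear (act_W p)" and bW: "bij (act_W p)" and bV: "bij (act_V a p)"
    using linear_act_W[OF a(2)] bij_act[OF a] by auto
  have kV: "k (v, 0) = (act_V a p v, 0)" and kW: "k (0, w) = (rim (act_W p w) z, 0) + (0, act_W p w)" for v w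
    using linear_0[OF lW] linear_0[OF linear_rim(2)] linear_0[OF linear_act_V] by (simp_all add: kd)
  let ?s = "\<lambda>x. s x \<circ> k"
  have sf: "smooth_frame_field \<A> U ?s"
    using g(2) linear_compose[OF lk] bij_comp[OF bk]
    unfolding smooth_frame_field_def comp_apply by blast
  have ik: "inv k (k X) = X" "k (inv k X) = X" for X using bk by (auto simp: bij_def surj_f_inv_f)
  \<comment> \<open>The factor by which \<open>act_W p\<close> scales the inner product of
    W.\<close>
  define C where "C = 1 / norm p ^ 4"
  have C: "C \<noteq> 0" "act_W p w \<bullet> act_W p w' = C * (w \<bullet> w')" for w w'
    using inner_act_W[OF a(2)] a(2) by (simp_all add: C_def)
  have sk: "snd (k X) = act_W p (snd X)" for X by (cases X) (simp add: kd)
  have si: "snd (inv k X) = inv (act_W p) (snd X)" for X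
    using sk[of "inv k X"] bW by (simp add: ik bij_def)
  have ia: "inv (act_W p) y \<bullet> w = (1 / C) * (y \<bullet> act_W p w)" for y w
  proof -
    have "y \<bullet> act_W p w = act_W p (inv (act_W p) y) \<bullet> act_W p w" using bW by (simp add: bij_def surj_f_inv_f)
    then show ?thesis using C by simp
  qed
  have \<tau>: "coframe_torsion \<A> ?s x X Y = inv k (coframe_torsion \<A> s x (k X) (k Y))" if x: "x \<in> U" for x X Y
  proof -
    have "ext_deriv \<A> (\<lambda>y. inv (?s y)) x X Y = inv k (ext_deriv \<A> (\<lambda>y. inv (s y)) x X Y)
      + dir_deriv \<A> (\<lambda>y. inv k (inv (s x) Y)) x X - dir_deriv \<A> (\<lambda>y. inv k (inv (s x) X)) x Y" for X Y
    proof (rule ext_deriv_gauge[OF smooth_family_const[OF linear_inv[OF lk bk]] smooth_coframe[OF g(2,1)] smooth_coframe[OF sf g(1)] g(1) x])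
      show "inv (?s y) X = inv k (inv (s y) X)" if "y \<in> U" for y X
        using o_inv_distrib[OF _ bk, of "s y"] smooth_frame_D(2)[OF g(2) that] by (metis comp_apply)
    qed
    then show ?thesis by (simp add: coframe_torsion_def dir_deriv_const)
  qed
  show ?thesis
    unfolding good_section_def
  proof (intro conjI ballI)
    fix x assume x: "x \<in> U"
    have "k ` (UNIV \<times> {0}) = UNIV \<times> {0}"
    proof (intro equalityI subsetI)
      fix X :: "'n model" assume "X \<in> UNIV \<times> {0}"
      then have "X = k (inv (act_V a p) (fst X), 0)" using bV by (auto simp: kV bij_def surj_f_inv_f)
      then show "X \<in> k ` (UNIV \<times> {0})" by blast
    qed (auto simp: kV)
    then show "?s x ` (UNIV \<times> {0}) = D x" using g(3)[OF x] by (metis image_comp)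
    show "\<forall>v v'. snd (coframe_torsion \<A> ?s x (v, 0) (v', 0)) = om v v'"
      using bW by (simp add: \<tau>[OF x] kV si g(4)[OF x] om_act[OF a] bij_def)
    obtain \<mu> where \<mu>: "snd (coframe_torsion \<A> s x (0, w) (v, 0)) \<bullet> w'
       + snd (coframe_torsion \<A> s x (0, w') (v, 0)) \<bullet> w = \<mu> v * (w \<bullet> w')" for v w w'
      using g(5)[OF x] by blast
    \<comment> \<open>The Hom-part of \<open>k\<close> moves \<open>w\<close> into V, where the
      torsion is \<open>om\<close>.\<close>
    have e: "snd (coframe_torsion \<A> ?s x (0, w) (v, 0)) \<bullet> w' = (1 / C) * (om (rim (act_W p w) z) (act_V a p v) \<bullet> act_W p w'
        + snd (coframe_torsion \<A> s x (0, act_W p w) (act_V a p v, 0)) \<bullet> act_W p w')" for v w w'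
      by (simp add: \<tau>[OF x] si ia kV kW g(4)[OF x] bilinear_ladd[OF bilinear_coframe_torsion[OF g(2,1) x]] inner_add_left
          del: add_Pair)
    have "snd (coframe_torsion \<A> ?s x (0, w) (v, 0)) \<bullet> w' + snd (coframe_torsion \<A> ?s x (0, w') (v, 0)) \<bullet> w
        = (- 2 * (z \<bullet> act_V a p v) + \<mu> (act_V a p v)) * (w \<bullet> w')" for v w w'
    proof -
      have "om (rim (act_W p w) z) (act_V a p v) \<bullet> act_W p w' + om (rim (act_W p w') z) (act_V a p v) \<bullet> act_W p w
         = C * (- 2 * (z \<bullet> act_V a p v) * (w \<bullet> w'))"
        unfolding rim_conformal C(2) by simp
      moreover have "snd (coframe_torsion \<A> s x (0, act_W p w) (act_V a p v, 0)) \<bullet> act_W p w'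
         + snd (coframe_torsion \<A> s x (0, act_W p w') (act_V a p v, 0)) \<bullet> act_W p w = C * (\<mu> (act_V a p v) * (w \<bullet> w'))"
        unfolding \<mu> C(2) by simp
      ultimately have "(om (rim (act_W p w) z) (act_V a p v) \<bullet> act_W p w' + snd (coframe_torsion \<A> s x (0, act_W p w) (act_V a p v, 0)) \<bullet> act_W p w')
        + (om (rim (act_W p w') z) (act_V a p v) \<bullet> act_W p w + snd (coframe_torsion \<A> s x (0, act_W p w') (act_V a p v, 0)) \<bullet> act_W p w)
        = C * ((- 2 * (z \<bullet> act_V a p v) + \<mu> (act_V a p v)) * (w \<bullet> w'))" by (simp add: algebra_simps)
      then show ?thesis unfolding e distrib_left[symmetric] using C(1) by simp
    qed
    then show "\<exists>\<mu>. \<forall>v w w'. snd (coframe_torsion \<A> ?s x (0, w) (v, 0)) \<bullet> w' + snd (coframe_torsion \<A> ?s x (0, w') (v, 0)) \<bullet> w = \<mu> v * (w \<bullet> w')"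
      by (intro exI[of _ "\<lambda>v. - 2 * (z \<bullet> act_V a p v) + \<mu> (act_V a p v)"]) blast
  qed (use g(1) sf in auto)
qed

text \<open>On V x V the gauge formula for the transition \<open>g\<close> is the stabilizer
  condition of B. On W x V it expresses the Hom-part of \<open>g\<close> by the two torsions and a
  derivative of \<open>g\<close>, all with conformal symmetric part.\<close>

lemma good_section_transition:
  assumes s: "good_section D U s" and s': "good_section D U' s'" and x: "x \<in> U" "x \<in> U'"
  shows "inv (s' x) \<circ> s x \<in> K_group"
proof -
  define N where "N = U \<inter> U'"
  have N: "open N" "x \<in> N" using good_section_D(1)[OF s] good_section_D(1)[OF s'] x by (auto simp: N_def)
  have sf: "smooth_frame_field \<A> N s" and sf': "smooth_frame_field \<A> N s'"
    using smooth_frame_field_subset good_section_D(2)[OF s] good_section_D(2)[OF s'] by (auto simp: N_def)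
  have gD: "s y ` (UNIV \<times> {0}) = D y" "s' y ` (UNIV \<times> {0}) = D y" if "y \<in> N" for y
    using that good_section_D(3)[OF s] good_section_D(3)[OF s'] by (auto simp: N_def)
  have gom: "snd (coframe_torsion \<A> s y (v, 0) (v', 0)) = om v v'" "snd (coframe_torsion \<A> s' y (v, 0) (v', 0)) = om v v'" if "y \<in> N" for y v v'
    using that good_section_D(4)[OF s] good_section_D(4)[OF s'] by (auto simp: N_def)
  define g where "g y = inv (s' y) \<circ> s y" for y
  have sg: "smooth_family N g" unfolding g_def by (rule smooth_family_transition[OF sf' sf N(1)])
  have ss: "s y X = s' y (g y X)" if "y \<in> N" for y X using smooth_frame_D(4)[OF sf' that] by (simp add: g_def)
  have lg: "linear (g y)" and bg: "bij (g y)" if "y \<in> N" for y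
    using smooth_frame_D[OF sf that] smooth_frame_D[OF sf' that] linear_compose bij_comp bij_imp_bij_inv unfolding g_def by blast+
  have g0: "snd (g y (v, 0)) = 0" if y: "y \<in> N" for y v
  proof -
    have "s y (v, 0) \<in> s' y ` (UNIV \<times> {0})" using gD[OF y] by blast
    then obtain X where "X \<in> UNIV \<times> {0}" "s y (v, 0) = s' y X" by blast
    then show ?thesis using smooth_frame_D(3)[OF sf' y, of X] by (auto simp: g_def)
  qed
  have sgW: "snd (g y X) = snd (g y (0, snd X))" if "y \<in> N" for y X
    using linear_add[OF lg[OF that], of "(fst X, 0)" "(0, snd X)"] g0[OF that, of "fst X"] by simp
  define \<delta> where "\<delta> y X w = snd (dir_deriv \<A> (\<lambda>y. g y (0, w)) y X)" for y X w
  \<comment> \<open>\<open>g\<close> maps V into V at every point of \<open>N\<close>, so its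
    derivative on V has no W-component either.\<close>
  have \<delta>0: "snd (dir_deriv \<A> (\<lambda>z. g z (v, 0)) y X) = 0" if y: "y \<in> N" for y v X
  proof -
    have "dir_deriv \<A> (\<lambda>z. snd (g z (v, 0))) y X = dir_deriv \<A> (\<lambda>z. 0) y X"
      by (rule dir_deriv_cong[OF N(1) y]) (rule g0)
    then show ?thesis using dir_deriv_family_linear[OF sg N(1) y linear_snd] by (simp add: dir_deriv_const)
  qed
  have gauge: "coframe_torsion \<A> s' y (g y X) (g y Y) = g y (coframe_torsion \<A> s y X Y)
     + dir_deriv \<A> (\<lambda>z. g z Y) y (s y X) - dir_deriv \<A> (\<lambda>z. g z X) y (s y Y)" if y: "y \<in> N" for y X Y
  proof -
    have "ext_deriv \<A> (\<lambda>y. inv (s' y)) y (s y X) (s y Y) = g y (ext_deriv \<A> (\<lambda>y. inv (s y)) y (s y X) (s y Y))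
      + dir_deriv \<A> (\<lambda>z. g z (inv (s y) (s y Y))) y (s y X) - dir_deriv \<A> (\<lambda>z. g z (inv (s y) (s y X))) y (s y Y)"
      by (rule ext_deriv_gauge[OF sg smooth_coframe[OF sf N(1)] smooth_coframe[OF sf' N(1)] N(1) y])
         (simp add: g_def smooth_frame_D(4)[OF sf])
    then show ?thesis by (simp add: coframe_torsion_def smooth_frame_D(3)[OF sf y] flip: ss[OF y])
  qed
  have gV: "g y (v, 0) = (fst (g y (v, 0)), 0)" if "y \<in> N" for y v using g0[OF that] by (simp add: prod_eq_iff)
  have gB: "g y \<in> B_group" if y: "y \<in> N" for y
    unfolding B_group_iff
  proof (intro conjI allI lg[OF y] bg[OF y] g0[OF y])
    fix v v'
    have "om (fst (g y (v, 0))) (fst (g y (v', 0))) = snd (coframe_torsion \<A> s' y (g y (v, 0)) (g y (v', 0)))"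
      by (subst (3 4) gV[OF y]) (simp add: gom[OF y])
    also have "\<dots> = snd (g y (0, om v v'))"
      unfolding gauge[OF y] using \<delta>0[OF y] sgW[OF y, of "coframe_torsion \<A> s y (v, 0) (v', 0)"] by (simp add: gom[OF y])
    finally show "om (fst (g y (v, 0))) (fst (g y (v', 0))) = snd (g y (0, om v v'))" .
  qed
  obtain a p f where a: "a \<in> Sp" "p \<noteq> 0" "linear f" and gd: "\<And>v w. g x (v, w) = (act_V a p v + f (act_W p w), act_W p w)"
    using gB[OF N(2)] unfolding B_group_def semidirect_iff by auto
  let ?A = "act_V a p" and ?r = "act_W p"
  have lW: "linear ?r" and bW: "bij ?r" and bV: "bij ?A"
    using linear_act_W[OF a(2)] bij_act[OF a(1,2)] by auto
  have kV: "g x (v, 0) = (?A v, 0)" and kW: "g x (0, w) = (f (?r w), 0) + (0, ?r w)" for v w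
    using linear_0[OF lW] linear_0[OF a(3)] linear_0[OF linear_act_V] by (simp_all add: gd)
  define C where "C = 1 / norm p ^ 4"
  have C: "C \<noteq> 0" "?r w \<bullet> ?r w' = C * (w \<bullet> w')" for w w'
    using inner_act_W[OF a(2)] a(2) by (simp_all add: C_def)
  obtain \<mu> where \<mu>: "snd (coframe_torsion \<A> s x (0, w) (v, 0)) \<bullet> w'
       + snd (coframe_torsion \<A> s x (0, w') (v, 0)) \<bullet> w = \<mu> v * (w \<bullet> w')" for v w w'
    using good_section_D(5)[OF s x(1)] by blast
  obtain \<mu>' where \<mu>': "snd (coframe_torsion \<A> s' x (0, w) (v, 0)) \<bullet> w'
       + snd (coframe_torsion \<A> s' x (0, w') (v, 0)) \<bullet> w = \<mu>' v * (w \<bullet> w')" for v w w'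
    using good_section_D(5)[OF s' x(2)] by blast
  \<comment> \<open>This uses that \<open>g\<close> lies in B near \<open>x\<close> and not only at
    \<open>x\<close>.\<close>
  have \<delta>: "\<delta> x X w \<bullet> ?r w' + \<delta> x X w' \<bullet> ?r w = 2 * (\<delta> x X q_i \<bullet> ?r q_i) * (w \<bullet> w')" for X w w'
  proof -
    let ?c = "chart_at \<A> x"
    have c: "?c \<in> \<A>" "x \<in> fst ?c" by (rule chart_at)+
    let ?S = "snd ?c ` (N \<inter> fst ?c)"
    have S: "open ?S" "snd ?c x \<in> ?S" using open_image_chart[OF c(1) N(1)] N c by auto
    have "((\<lambda>y. snd (g (chart_inv ?c y) (0, w))) has_derivative
      (\<lambda>X. snd (frechet_derivative (\<lambda>y. g (chart_inv ?c y) (0, w)) (at (snd ?c x)) X))) (at (snd ?c x))" for w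
      using sg c unfolding smooth_family_def
      by (intro has_derivative_snd smooth_on_has_derivative[OF _ S(2)]) blast
    from conformal_derivative[where f = "\<lambda>w y. snd (g (chart_inv ?c y) (0, w))", OF this S B_group_conformal[OF gB[OF chart_image_D(1)[OF c(1)]]],
        of w "to_chart \<A> ?c x X" w']
    show ?thesis
      by (simp add: \<delta>_def dir_deriv_family[OF sg N c] chart_inv_chart[OF c] gd)
  qed
  \<comment> \<open>The W-component of \<open>gauge\<close> on \<open>(0, w)\<close> and
    \<open>(v, 0)\<close>; of the two derivative terms, \<open>\<delta>0\<close> removes the
    second.\<close>
  have f_om: "om (f (?r w)) (?A v) = ?r (snd (coframe_torsion \<A> s x (0, w) (v, 0))) - \<delta> x (s x (v, 0)) w
      - snd (coframe_torsion \<A> s' x (0, ?r w) (?A v, 0))" for v w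
  proof -
    have "snd (coframe_torsion \<A> s' x (g x (0, w)) (g x (v, 0))) = om (f (?r w)) (?A v) + snd (coframe_torsion \<A> s' x (0, ?r w) (?A v, 0))"
      by (simp add: kV kW gom[OF N(2)] bilinear_ladd[OF bilinear_coframe_torsion[OF sf' N]] del: add_Pair)
    moreover have "snd (g x Z) = ?r (snd Z)" for Z by (cases Z) (simp add: gd)
    ultimately show ?thesis
      unfolding gauge[OF N(2)] using \<delta>0[OF N(2), of v "s x (0, w)"] by (simp add: \<delta>_def)
  qed
  \<comment> \<open>Division by \<open>C\<close> turns the multiple of \<open>w \<bullet> w'\<close>
    coming from the derivative into a multiple of \<open>?r w \<bullet> ?r w'\<close>.\<close>
  define \<kappa> where "\<kappa> v = \<mu> v - (2 * (\<delta> x (s x (v, 0)) q_i \<bullet> ?r q_i)) / C - \<mu>' (?A v)" for v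
  have sym: "om (f (?r w)) (?A v) \<bullet> ?r w' + om (f (?r w')) (?A v) \<bullet> ?r w = \<kappa> v * (?r w \<bullet> ?r w')" for v w w'
  proof -
    have "om (f (?r w)) (?A v) \<bullet> ?r w' + om (f (?r w')) (?A v) \<bullet> ?r w
      = C * (snd (coframe_torsion \<A> s x (0, w) (v, 0)) \<bullet> w' + snd (coframe_torsion \<A> s x (0, w') (v, 0)) \<bullet> w)
        - (\<delta> x (s x (v, 0)) w \<bullet> ?r w' + \<delta> x (s x (v, 0)) w' \<bullet> ?r w)
        - (snd (coframe_torsion \<A> s' x (0, ?r w) (?A v, 0)) \<bullet> ?r w' + snd (coframe_torsion \<A> s' x (0, ?r w') (?A v, 0)) \<bullet> ?r w)"
      unfolding f_om by (simp add: inner_diff_left C(2) algebra_simps)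
    also have "\<dots> = \<kappa> v * (?r w \<bullet> ?r w')"
      unfolding \<mu> \<mu>' \<delta> \<kappa>_def C(2) using C(1) by (simp add: field_simps)
    finally show ?thesis .
  qed
  \<comment> \<open>\<open>sym\<close> at the preimages of the basis vectors under the actions on W
    and V is the hypothesis of \<open>EH_I\<close>.\<close>
  have "f \<in> EH"
  proof (rule EH_I[OF a(3)])
    fix r t v
    have i: "?A (inv ?A v) = v" "?r (inv ?r w) = w" for w using bV bW by (simp_all add: bij_def surj_f_inv_f)
    show "om (f (axis r 1)) v $ t + om (f (axis t 1)) v $ r = (if r = t then \<kappa> (inv ?A v) else 0)"
    proof -
      have "axis r (1::real) \<bullet> axis t 1 = (if r = t then 1 else 0)" by (simp add: inner_axis) (simp add: axis_def)
      then show ?thesis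
        using sym[of "inv ?r (axis r 1)" "inv ?A v" "inv ?r (axis t 1)"] unfolding i by (simp add: inner_axis)
    qed
  qed
  then show ?thesis
    unfolding K_group_def semidirect_iff using a(1,2) gd by (auto simp: g_def)
qed

end

section \<open>Quaternionic Gram-Schmidt\<close>

lemma bilinear_hprod: "bilinear hprod"
  unfolding bilinear_def
  by (intro conjI allI linearI; simp add: hprod_def linear_add[OF linear_qconj] linear_cmul[OF linear_qconj]
      qmul_distribs sum.distrib scaleR_sum_right)

lemma qconj_hprod: "qconj (hprod u v) = hprod v u"
  by (simp add: hprod_def linear_sum[OF linear_qconj] qconj_qmul)

lemma rmul_decomp: "rmul u q = q$1 *\<^sub>R u + q$2 *\<^sub>R rim q_i u + q$3 *\<^sub>R rim q_j u + q$4 *\<^sub>R rim q_k u"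
proof -
  have "q = q$1 *\<^sub>R qone + q$2 *\<^sub>R q_of_im q_i + q$3 *\<^sub>R q_of_im q_j + q$4 *\<^sub>R q_of_im q_k"
    by (simp add: quat_eq_iff)
  then have "rmul u q = rmul u (q$1 *\<^sub>R qone + q$2 *\<^sub>R q_of_im q_i + q$3 *\<^sub>R q_of_im q_j + q$4 *\<^sub>R q_of_im q_k)" by simp
  then show ?thesis by (simp only: rmul_distribs rmul_qone rim_def)
qed

lemma smooth_on_quat:
  assumes "open S" "smooth_on S f" "smooth_on S g"
  shows "smooth_on S (\<lambda>y. f y *\<^sub>R qone + q_of_im (g y))"
  by (intro smooth_on_add smooth_on_scaleR smooth_on_const smooth_on_linear[OF linear_q_of_im] assms)

text \<open>\<open>\<tau> y\<close> is the triple of forms on V and \<open>C y\<close> an adapted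
  frame chosen at each point with no regularity in \<open>y\<close>. Smoothness has to come from
  \<open>\<tau>\<close> alone.\<close>

locale adapted_family =
  fixes S :: "'p::euclidean_space set" and \<tau> :: "'p \<Rightarrow> real^4^'n::finite \<Rightarrow> real^4^'n \<Rightarrow> real^3"
    and C :: "'p \<Rightarrow> real^4^'n \<Rightarrow> real^4^'n"
  assumes S: "open S" and bil: "y \<in> S \<Longrightarrow> bilinear (\<tau> y)" and smooth: "smooth_on S (\<lambda>y. \<tau> y v v')"
    and C: "y \<in> S \<Longrightarrow> linear (C y)" "y \<in> S \<Longrightarrow> bij (C y)" "y \<in> S \<Longrightarrow> \<tau> y (C y v) (C y v') = om v v'"
begin

definition Ci :: "'p \<Rightarrow> real^4^'n \<Rightarrow> real^4^'n" where "Ci y = inv (C y)"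

text \<open>Scalar multiplication transported by \<open>C y\<close>; below, \<open>herm\<close> is
  the transported Hermitian form. The smoothness proofs express both through
  \<open>\<tau> y\<close>.\<close>

definition act :: "'p \<Rightarrow> real^4^'n \<Rightarrow> real^4 \<Rightarrow> real^4^'n" where "act y x q = C y (rmul (Ci y x) q)"

definition herm :: "'p \<Rightarrow> real^4^'n \<Rightarrow> real^4^'n \<Rightarrow> real^4" where "herm y x x' = hprod (Ci y x) (Ci y x')"

lemma C_Ci [simp]: "y \<in> S \<Longrightarrow> C y (Ci y x) = x" "y \<in> S \<Longrightarrow> Ci y (C y x) = x"
  using C(2)[of y] by (simp_all add: Ci_def bij_def surj_f_inv_f)

lemma lin_Ci: "y \<in> S \<Longrightarrow> linear (Ci y)"
  unfolding Ci_def by (rule linear_inv[OF C(1,2)])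

lemma tau_om: "y \<in> S \<Longrightarrow> \<tau> y x x' = om (Ci y x) (Ci y x')"
  using C(3)[of y "Ci y x" "Ci y x'"] by simp

text \<open>Let \<open>N w\<close> be the matrix of the form \<open>\<tau> \<bullet> w\<close> in
  the standard metric. The inverse of \<open>N q_i\<close> times \<open>N q_j\<close> is the
  transported \<open>rim q_k\<close>, and times \<open>- N q_k\<close> the transported
  \<open>rim q_j\<close>. These quotients do not involve \<open>C\<close> and are smooth;
  \<open>rim q_i\<close> is a product of the other two.\<close>

lemma smooth_endo:
  "smooth_on S (\<lambda>y. C y (rim q_i (Ci y x)))" "smooth_on S (\<lambda>y. C y (rim q_j (Ci y x)))"
  "smooth_on S (\<lambda>y. C y (rim q_k (Ci y x)))"
proof -
  define N where "N w y x = (\<Sum>b\<in>Basis. (\<tau> y x b \<bullet> w) *\<^sub>R b)" for w y x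
  have N: "N w y x \<bullet> z = \<tau> y x z \<bullet> w" if "y \<in> S" for w y x z
  proof -
    have "linear (\<lambda>z. \<tau> y x z \<bullet> w)"
      using bil[OF that] by (intro linearI) (simp_all add: bilinear_radd bilinear_rmul inner_add_left)
    then have "\<tau> y x z \<bullet> w = (\<Sum>b\<in>Basis. (z \<bullet> b) *\<^sub>R (\<tau> y x b \<bullet> w))" by (rule linear_euclidean)
    also have "\<dots> = N w y x \<bullet> z"
      unfolding N_def inner_sum_left by (intro sum.cong refl) (simp add: inner_commute[of z] mult.commute)
    finally show ?thesis by simp
  qed
  have linN: "linear (N w y)" if "y \<in> S" for w y
    by (intro linearI; rule vector_eq_rdot[THEN iffD1];
        simp add: N[OF that] inner_add_left bilinear_ladd[OF bil[OF that]] bilinear_lmul[OF bil[OF that]])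
  have smN: "smooth_on S (\<lambda>y. N w y x)" for w x
    unfolding N_def by (intro smooth_on_sum smooth_on_scaleR smooth_on_inner smooth smooth_on_const S)
  have bijN: "bij (N q_i y)" if y: "y \<in> S" for y
  proof (rule bij_linear_injective[OF linN[OF y]])
    fix x assume "N q_i y x = 0"
    then have "om (Ci y x) (Ci y (C y u)) \<bullet> q_i = 0" for u
      using N[OF y, of q_i x "C y u"] tau_om[OF y] by simp
    then have "rim q_i (Ci y x) \<bullet> u = 0" for u using y by (simp add: om_inner)
    from this[of "rim q_i (Ci y x)"] have "rim q_i (Ci y x) = 0" by simp
    then have "- Ci y x = 0" using rim_rim[of q_i "Ci y x"] by (simp add: linear_0[OF linear_rim(1)])
    then have "C y (Ci y x) = 0" using linear_0[OF C(1)[OF y]] by simp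
    then show "x = 0" using y by simp
  qed
  have inv: "z = inv (N q_i y) u" if "y \<in> S" "N q_i y z = u" for y z u
    using bijN[OF that(1)] that(2) by (metis bij_inv_eq_iff)
  have j: "C y (rim q_j (Ci y x)) = inv (N q_i y) (- N q_k y x)" if y: "y \<in> S" for y x
  proof (rule inv[OF y], rule vector_eq_rdot[THEN iffD1], rule allI)
    show "N q_i y (C y (rim q_j (Ci y x))) \<bullet> z = - N q_k y x \<bullet> z" for z
      using y by (simp add: N[OF y] tau_om[OF y] om_inner)
  qed
  have k: "C y (rim q_k (Ci y x)) = inv (N q_i y) (N q_j y x)" if y: "y \<in> S" for y x
  proof (rule inv[OF y], rule vector_eq_rdot[THEN iffD1], rule allI)
    show "N q_i y (C y (rim q_k (Ci y x))) \<bullet> z = N q_j y x \<bullet> z" for z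
      using y by (simp add: N[OF y] tau_om[OF y] om_inner)
  qed
  have sinv: "smooth_on S (\<lambda>y. inv (N q_i y) (f y))" if "smooth_on S f" for f
    using smooth_on_apply[where L = "\<lambda>y. inv (N q_i y)", OF S linear_inv[OF linN bijN] smooth_on_inv_family[OF S linN bijN smN] that] .
  show sj: "smooth_on S (\<lambda>y. C y (rim q_j (Ci y x)))" for x
    using sinv[OF smooth_on_minus[OF S smN]] smooth_on_cong[OF S j] by simp
  show sk: "smooth_on S (\<lambda>y. C y (rim q_k (Ci y x)))" for x
    using sinv[OF smN] smooth_on_cong[OF S k] by simp
  have lk: "linear (\<lambda>x. C y (rim q_k (Ci y x)))" if "y \<in> S" for y
    using linear_compose[OF linear_compose[OF lin_Ci[OF that] linear_rim(1)] C(1)[OF that]] by (simp add: o_def)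
  have "smooth_on S (\<lambda>y. C y (rim q_k (Ci y (C y (rim q_j (Ci y x))))))"
    by (rule smooth_on_apply[where L = "\<lambda>y x. C y (rim q_k (Ci y x))", OF S lk sk sj])
  moreover have "C y (rim q_k (Ci y (C y (rim q_j (Ci y x))))) = C y (rim q_i (Ci y x))" if "y \<in> S" for y
    using that by simp
  ultimately show "smooth_on S (\<lambda>y. C y (rim q_i (Ci y x)))"
    using smooth_on_cong[OF S] by (metis (no_types, lifting))
qed

lemma smooth_act:
  assumes T: "open T" "T \<subseteq> S" and f: "smooth_on T f" and q: "smooth_on T q"
  shows "smooth_on T (\<lambda>y. act y (f y) (q y))"
proof -
  have l: "linear (\<lambda>x. C y (rim w (Ci y x)))" if "y \<in> T" for y w
    using linear_compose[OF linear_compose[OF lin_Ci linear_rim(1)] C(1)] that T by (auto simp: o_def)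
  have J: "smooth_on T (\<lambda>y. C y (rim q_i (Ci y (f y))))" "smooth_on T (\<lambda>y. C y (rim q_j (Ci y (f y))))"
    "smooth_on T (\<lambda>y. C y (rim q_k (Ci y (f y))))"
    using smooth_on_apply[where L = "\<lambda>y x. C y (rim q_i (Ci y x))", OF T(1) l smooth_on_subset[OF smooth_endo(1) T(2)] f]
      smooth_on_apply[where L = "\<lambda>y x. C y (rim q_j (Ci y x))", OF T(1) l smooth_on_subset[OF smooth_endo(2) T(2)] f]
      smooth_on_apply[where L = "\<lambda>y x. C y (rim q_k (Ci y x))", OF T(1) l smooth_on_subset[OF smooth_endo(3) T(2)] f]
    by simp_all
  have "act y (f y) (q y) = q y $ 1 *\<^sub>R f y + q y $ 2 *\<^sub>R C y (rim q_i (Ci y (f y)))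
      + q y $ 3 *\<^sub>R C y (rim q_j (Ci y (f y))) + q y $ 4 *\<^sub>R C y (rim q_k (Ci y (f y)))" if "y \<in> T" for y
    using C(1)[of y] that T(2) by (auto simp: act_def rmul_decomp linear_add linear_cmul)
  moreover have "smooth_on T (\<lambda>y. q y $ 1 *\<^sub>R f y + q y $ 2 *\<^sub>R C y (rim q_i (Ci y (f y)))
      + q y $ 3 *\<^sub>R C y (rim q_j (Ci y (f y))) + q y $ 4 *\<^sub>R C y (rim q_k (Ci y (f y))))"
    by (intro smooth_on_add smooth_on_scaleR smooth_on_nth T f q J)
  ultimately show ?thesis using smooth_on_cong[OF T(1)] by (metis (no_types, lifting))
qed

lemma smooth_tau:
  assumes T: "open T" "T \<subseteq> S" and f: "smooth_on T f" "smooth_on T f'"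
  shows "smooth_on T (\<lambda>y. \<tau> y (f y) (f' y))"
proof -
  have l: "linear (\<tau> y x)" "linear (\<lambda>x. \<tau> y x x')" if "y \<in> T" for y x x'
    using bil[of y] that T by (auto simp: bilinear_def)
  have "smooth_on T (\<lambda>y. \<tau> y x (f' y))" for x
    by (rule smooth_on_apply[OF T(1) l(1) smooth_on_subset[OF smooth T(2)] f(2)])
  from smooth_on_apply[where L = "\<lambda>y x. \<tau> y x (f' y)", OF T(1) l(2) this f(1)] show ?thesis .
qed

text \<open>The imaginary part is \<open>\<tau>\<close>; the real part, the transported metric, is
  recovered by inserting the endomorphism for i into the first form.\<close>

lemma smooth_herm:
  assumes T: "open T" "T \<subseteq> S" and f: "smooth_on T f" "smooth_on T f'"
  shows "smooth_on T (\<lambda>y. herm y (f y) (f' y))"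
proof -
  have "herm y (f y) (f' y) = (\<tau> y (f y) (act y (f' y) (q_of_im q_i)) \<bullet> q_i) *\<^sub>R qone + q_of_im (\<tau> y (f y) (f' y))" if "y \<in> T" for y
  proof -
    have y: "y \<in> S" using that T by auto
    have "om u (rim q_i u') \<bullet> q_i = u \<bullet> u'" for u u' :: "real^4^'n"
      by (simp add: om_inner rim_skew rim_rim)
    then show ?thesis by (simp add: herm_def hprod_decomp tau_om[OF y] act_def y flip: rim_def)
  qed
  moreover have "smooth_on T (\<lambda>y. (\<tau> y (f y) (act y (f' y) (q_of_im q_i)) \<bullet> q_i) *\<^sub>R qone + q_of_im (\<tau> y (f y) (f' y)))"
    by (intro smooth_on_quat smooth_on_inner smooth_tau smooth_act T f smooth_on_const)
  ultimately show ?thesis using smooth_on_cong[OF T(1)] by (metis (no_types, lifting))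
qed

lemma herm_simps:
  assumes "y \<in> S"
  shows "herm y (a + b) c = herm y a c + herm y b c" "herm y c (a + b) = herm y c a + herm y c b"
    "herm y (a - b) c = herm y a c - herm y b c" "herm y c (a - b) = herm y c a - herm y c b"
    "herm y (r *\<^sub>R a) c = r *\<^sub>R herm y a c" "herm y c (r *\<^sub>R a) = r *\<^sub>R herm y c a"
    "herm y c (act y a q) = qmul (herm y c a) q" "herm y (act y a q) c = qmul (qconj q) (herm y a c)"
    "qconj (herm y a c) = herm y c a" "herm y c c = (herm y c c $ 1) *\<^sub>R qone"
proof -
  note b = bilinear_hprod and l = lin_Ci[OF assms]
  show "herm y (a + b) c = herm y a c + herm y b c" "herm y c (a + b) = herm y c a + herm y c b"
    "herm y (a - b) c = herm y a c - herm y b c" "herm y c (a - b) = herm y c a - herm y c b"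
    "herm y (r *\<^sub>R a) c = r *\<^sub>R herm y a c" "herm y c (r *\<^sub>R a) = r *\<^sub>R herm y c a"
    by (simp_all add: herm_def linear_add[OF l] linear_diff[OF l] linear_cmul[OF l] bilinear_ladd[OF b] bilinear_radd[OF b]
        bilinear_lsub[OF b] bilinear_rsub[OF b] bilinear_lmul[OF b] bilinear_rmul[OF b])
  show "herm y c (act y a q) = qmul (herm y c a) q" "herm y (act y a q) c = qmul (qconj q) (herm y a c)"
    using hprod_rmul[of "Ci y c" qone "Ci y a" q] hprod_rmul[of "Ci y a" q "Ci y c" qone] assms
    by (simp_all add: herm_def act_def quat_eq_iff)
  show "qconj (herm y a c) = herm y c a" by (simp add: herm_def qconj_hprod)
  then show "herm y c c = (herm y c c $ 1) *\<^sub>R qone"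
    using qconj_hprod[of "Ci y c" "Ci y c"] by (simp add: herm_def quat_eq_iff)
qed

lemma herm_sum: "y \<in> S \<Longrightarrow> herm y c (\<Sum>j\<in>F. f j) = (\<Sum>j\<in>F. herm y c (f j))"
proof -
  assume y: "y \<in> S"
  have l: "linear (hprod (Ci y c))" using bilinear_hprod[unfolded bilinear_def] by blast
  show ?thesis by (simp only: herm_def linear_sum[OF lin_Ci[OF y]] linear_sum[OF l])
qed

text \<open>The process starts from constant vectors that are already orthonormal at
  \<open>p\<close>. Prescribing \<open>b j p\<close> keeps the projections zero at \<open>p\<close>,
  so the new vector has norm 1 there and can be normalised nearby.\<close>

lemma gram_schmidt:
  assumes p: "p \<in> S" and F: "finite (F :: 'n set)"
  shows "\<exists>T b. open T \<and> p \<in> T \<and> T \<subseteq> S \<and> (\<forall>j\<in>F. smooth_on T (b j) \<and> b j p = C p (axis j qone)) \<and>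
    (\<forall>y\<in>T. \<forall>i\<in>F. \<forall>j\<in>F. herm y (b i y) (b j y) = (if i = j then qone else 0))"
  using F
proof (induction F)
  case empty
  then show ?case using S p by auto
next
  case (insert k F)
  then obtain T b where T: "open T" "p \<in> T" "T \<subseteq> S" and b: "\<And>j. j \<in> F \<Longrightarrow> smooth_on T (b j)" "\<And>j. j \<in> F \<Longrightarrow> b j p = C p (axis j qone)"
    "\<And>y i j. y \<in> T \<Longrightarrow> i \<in> F \<Longrightarrow> j \<in> F \<Longrightarrow> herm y (b i y) (b j y) = (if i = j then qone else 0)" by blast
  define e where "e j = C p (axis j qone)" for j
  have he: "herm p (e i) (e j) = (if i = j then qone else 0)" for i j
    unfolding herm_def e_def using p
    by (simp add: hprod_def) (subst sum.remove[of _ j], auto simp: axis_def quat_eq_iff intro!: sum.neutral)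
  \<comment> \<open>Scalars act from the right, so the coefficient of the projection stands on the
    right of \<open>b j y\<close>.\<close>
  define c where "c y = e k - (\<Sum>j\<in>F. act y (b j y) (herm y (b j y) (e k)))" for y
  have sc: "smooth_on T c"
    unfolding c_def by (intro smooth_on_diff smooth_on_sum smooth_act smooth_herm T b smooth_on_const)
  have cp: "c p = e k"
  proof -
    have "act p (b j p) (herm p (b j p) (e k)) = 0" if "j \<in> F" for j
      using he[of j k] insert.hyps that b(2)[OF that] by (auto simp: e_def act_def rmul_distribs linear_0[OF C(1)[OF p]])
    then show ?thesis by (simp add: c_def)
  qed
  have hc: "herm y (b i y) (c y) = 0" if y: "y \<in> T" and i: "i \<in> F" for y i
  proof -
    have yS: "y \<in> S" using y T by auto
    have "(\<Sum>j\<in>F. qmul (herm y (b i y) (b j y)) (herm y (b j y) (e k))) = (\<Sum>j\<in>F. if i = j then herm y (b j y) (e k) else 0)"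
      by (intro sum.cong refl) (simp add: b(3)[OF y i] qmul_distribs)
    also have "\<dots> = herm y (b i y) (e k)" using insert.hyps i by simp
    finally show ?thesis by (simp add: c_def herm_simps[OF yS] herm_sum[OF yS])
  qed
  have sn: "smooth_on T (\<lambda>y. herm y (c y) (c y) $ 1)"
    by (intro smooth_on_nth smooth_herm T sc)
  define T' where "T' = T \<inter> (\<lambda>y. herm y (c y) (c y) $ 1) -` {0<..}"
  have T': "open T'" "p \<in> T'" "T' \<subseteq> T"
    using continuous_on_open_vimage[OF T(1), THEN iffD1, OF smooth_on_continuous[OF sn], rule_format, of "{0<..}"] T(2) he[of k k]
    by (auto simp: T'_def cp Int_commute)
  have pos: "herm y (c y) (c y) $ 1 > 0" if "y \<in> T'" for y using that by (simp add: T'_def)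
  define b' where "b' = b(k := \<lambda>y. ((herm y (c y) (c y) $ 1) powr (-1/2)) *\<^sub>R c y)"
  have "smooth_on T' (b' j) \<and> b' j p = C p (axis j qone)" if "j \<in> insert k F" for j
  proof (cases "j = k")
    case True
    have "smooth_on T' (\<lambda>y. ((herm y (c y) (c y) $ 1) powr (-1/2)) *\<^sub>R c y)"
      using T' sc sn pos by (intro smooth_on_scaleR smooth_on_powr) (auto intro: smooth_on_subset)
    then show ?thesis using True he[of k k] by (simp add: b'_def cp) (simp add: e_def)
  next
    case False
    then show ?thesis using that b T' by (auto simp: b'_def intro: smooth_on_subset)
  qed
  moreover have "herm y (b' i y) (b' j y) = (if i = j then qone else 0)" if y: "y \<in> T'" and ij: "i \<in> insert k F" "j \<in> insert k F" for y i j
  proof -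
    have yT: "y \<in> T" and yS: "y \<in> S" using y T' T by auto
    have hc': "herm y (c y) (b j y) = 0" if "j \<in> F" for j
      using hc[OF yT that] herm_simps(9)[OF yS, of "b j y" "c y"] linear_0[OF linear_qconj] by simp
    let ?r = "herm y (c y) (c y) $ 1"
    have "?r powr (-1/2) * (?r powr (-1/2) * ?r) = ?r powr (-1/2) * ?r powr (-1/2) * ?r powr 1" using pos[OF y] by simp
    also have "\<dots> = 1" using pos[OF y] by (simp flip: powr_add)
    finally have n: "?r powr (-1/2) * (?r powr (-1/2) * ?r) = 1" .
    define R where "R = ?r powr (-1/2)"
    have kk: "herm y (b' k y) (b' k y) = qone"
    proof -
      have "herm y (b' k y) (b' k y) = R *\<^sub>R R *\<^sub>R herm y (c y) (c y)"
        by (simp only: b'_def fun_upd_same herm_simps(5,6)[OF yS] R_def)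
      also have "\<dots> = R *\<^sub>R R *\<^sub>R ?r *\<^sub>R qone" using herm_simps(10)[OF yS, of "c y"] by simp
      also have "\<dots> = (R * (R * ?r)) *\<^sub>R qone" by (simp only: scaleR_scaleR mult.assoc)
      finally show ?thesis using n by (simp only: R_def scaleR_one)
    qed
    show ?thesis
      using ij kk hc[OF yT] hc' b(3)[OF yT] insert.hyps
      by (cases "i = k"; cases "j = k") (auto simp: b'_def herm_simps(5,6)[OF yS])
  qed
  ultimately show ?case using T' T by (intro exI[of _ T'] exI[of _ b']) auto
qed

text \<open>The orthonormal vectors are the images of the standard quaternionic basis; right
  linearity extends them to an isometry of Hermitian forms, whose imaginary parts are
  \<open>om\<close> and \<open>\<tau>\<close>.\<close>

lemma smooth_adapted_frame:
  assumes p: "p \<in> S"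
  obtains T and A :: "'p \<Rightarrow> real^4^'n \<Rightarrow> real^4^'n" where "open T" "p \<in> T" "T \<subseteq> S" "\<And>y. y \<in> T \<Longrightarrow> linear (A y)" "\<And>v. smooth_on T (\<lambda>y. A y v)"
    "\<And>y v v'. y \<in> T \<Longrightarrow> \<tau> y (A y v) (A y v') = om v v'" "\<And>y. y \<in> T \<Longrightarrow> bij (A y)"
proof -
  obtain T and b :: "'n \<Rightarrow> 'p \<Rightarrow> real^4^'n" where *: "open T \<and> p \<in> T \<and> T \<subseteq> S \<and>
    (\<forall>j\<in>UNIV. smooth_on T (b j) \<and> b j p = C p (axis j qone)) \<and>
    (\<forall>y\<in>T. \<forall>i\<in>UNIV. \<forall>j\<in>UNIV. herm y (b i y) (b j y) = (if i = j then qone else 0))"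
    using gram_schmidt[OF p finite[of UNIV]] by (elim exE)
  then have T: "open T" "p \<in> T" "T \<subseteq> S" and b: "smooth_on T (b j)"
    "y \<in> T \<Longrightarrow> herm y (b i y) (b j y) = (if i = j then qone else 0)" for y i j by auto
  define A where "A y v = (\<Sum>j\<in>UNIV. act y (b j y) (v $ j))" for y and v :: "real^4^'n"
  have linA: "linear (A y)" if "y \<in> T" for y
    using C(1)[of y] that T(3)
    by (intro linearI) (auto simp: A_def act_def rmul_distribs linear_add linear_cmul sum.distrib scaleR_sum_right)
  have smA: "smooth_on T (\<lambda>y. A y v)" for v
    unfolding A_def by (intro smooth_on_sum smooth_act T b smooth_on_const)
  have hA: "herm y (A y v) (A y v') = hprod v v'" if y: "y \<in> T" for y v v'
  proof -
    have yS: "y \<in> S" using y T by auto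
    have e: "herm y (b i y) (A y v') = v' $ i" for i v'
    proof -
      have "herm y (b i y) (A y v') = (\<Sum>j\<in>UNIV. if i = j then v' $ j else 0)"
        unfolding A_def herm_sum[OF yS] by (intro sum.cong refl) (simp add: herm_simps[OF yS] b(2)[OF y] qmul_distribs)
      then show ?thesis by simp
    qed
    have "herm y (A y v) (A y v') = qconj (herm y (A y v') (A y v))" by (simp add: herm_simps[OF yS])
    also have "\<dots> = (\<Sum>j\<in>UNIV. qconj (qmul (qconj (herm y (b j y) (A y v'))) (v $ j)))"
      unfolding A_def[of y v] herm_sum[OF yS] linear_sum[OF linear_qconj] by (simp add: herm_simps[OF yS])
    finally show ?thesis by (simp add: e hprod_def qconj_qmul)
  qed
  have \<tau>A: "\<tau> y (A y v) (A y v') = om v v'" if "y \<in> T" for y v v'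
  proof -
    have "\<tau> y (A y v) (A y v') = im_part (herm y (A y v) (A y v'))"
      using tau_om[of y] that T by (auto simp: herm_def im_hprod)
    then show ?thesis by (simp add: hA[OF that] im_hprod)
  qed
  have bijA: "bij (A y)" if "y \<in> T" for y
  proof (rule bij_linear_injective[OF linA[OF that]])
    fix v assume "A y v = 0"
    then have "hprod v v = 0"
      using hA[OF that, of v v] herm_simps(5)[of y 0 0 0] that T(3) by auto
    then show "v = 0" using hprod_nth1[of v v] by simp
  qed
  show ?thesis by (rule that[OF T linA smA \<tau>A bijA])
qed

end

section \<open>Adapted frames of Duchemin integrable structures\<close>

lemma smooth_on_bilinear_family:
  fixes f :: "'p::real_normed_vector \<Rightarrow> 'a::euclidean_space" and g :: "'p \<Rightarrow> 'b::euclidean_space"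
  assumes S: "open S" and b: "\<And>y. y \<in> S \<Longrightarrow> bilinear (b y)" "\<And>u v. smooth_on S (\<lambda>y. b y u v)"
    and f: "smooth_on S f" and g: "smooth_on S g"
  shows "smooth_on S (\<lambda>y. b y (f y) (g y))"
proof -
  have l: "linear (b y u)" "linear (\<lambda>u. b y u v)" if "y \<in> S" for y u v using b(1)[OF that] by (auto simp: bilinear_def)
  have "smooth_on S (\<lambda>y. b y u (g y))" for u by (rule smooth_on_apply[OF S l(1) b(2) g])
  from smooth_on_apply[where L = "\<lambda>y u. b y u (g y)", OF S l(2) this f] show ?thesis .
qed

lemma smooth_ext_deriv_flat:
  assumes "open S" "\<And>v. smooth_on S (\<lambda>y. a y v)"
  shows "smooth_on S (\<lambda>y. ext_deriv_flat a y X Y)"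
  unfolding ext_deriv_flat_def by (intro smooth_on_diff smooth_on_frechet assms)

text \<open>The maps \<open>f\<close> from \<open>W\<close> to \<open>V\<close> that make the symmetric part conformal form an affine space over
  \<open>EH\<close>, so that there is exactly one with \<open>f i = 0\<close>; it is given by an explicit formula in \<open>\<beta>\<close>.\<close>
definition conformal_lift :: "(real^3 \<Rightarrow> real^4^'n::finite \<Rightarrow> real^3) \<Rightarrow> real^3 \<Rightarrow> real^4^'n" where
  "conformal_lift \<beta> w = - (w$2 *\<^sub>R rim q_j (\<Sum>b\<in>Basis. (\<beta> q_i b $ 1 - \<beta> q_j b $ 2) *\<^sub>R b)
     + w$3 *\<^sub>R rim q_k (\<Sum>b\<in>Basis. (\<beta> q_i b $ 1 - \<beta> q_k b $ 3) *\<^sub>R b))"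

lemma linear_conformal_lift: "linear (conformal_lift \<beta>)"
  unfolding conformal_lift_def by (rule linearI) (simp_all add: algebra_simps)

text \<open>The vectors \<open>g\<close> are the V-parts of Reeb vectors. Adding a suitable element
  of EH gives a map \<open>h\<close> that is still conformal and vanishes at \<open>q_i\<close>; the
  diagonal conditions then express \<open>h\<close> by \<open>\<beta>\<close>, which does not refer
  to \<open>g\<close> any more.\<close>

lemma conformal_lift:
  fixes \<beta> :: "real^3 \<Rightarrow> real^4^'n::finite \<Rightarrow> real^3" and g :: "3 \<Rightarrow> real^4^'n"
  assumes \<beta>: "bilinear \<beta>"
    and g: "\<And>r s v. om (g r) v $ s + \<beta> (axis r 1) v $ s + (om (g s) v $ r + \<beta> (axis s 1) v $ r) = 0"
  shows "\<exists>\<mu>. \<forall>v w w'. (om (conformal_lift \<beta> w) v + \<beta> w v) \<bullet> w' + (om (conformal_lift \<beta> w') v + \<beta> w' v) \<bullet> w = \<mu> v * (w \<bullet> w')"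
proof -
  define G where "G w = (\<Sum>r\<in>UNIV. w$r *\<^sub>R g r)" for w :: "real^3"
  have linG: "linear G" unfolding G_def by (rule linearI) (simp_all add: scaleR_add_left sum.distrib scaleR_sum_right)
  have Gax: "G (axis r 1) = g r" for r
    by (simp add: G_def axis_def if_distrib[of "\<lambda>c. c *\<^sub>R _"] cong: if_cong)
  have wd: "w = w$1 *\<^sub>R q_i + w$2 *\<^sub>R q_j + w$3 *\<^sub>R q_k" for w :: "real^3" by (simp add: im_eq_iff)
  define \<Psi> where "\<Psi> v w = om (G w) v + \<beta> w v" for v w
  have lin\<Psi>: "linear (\<Psi> v)" for v
    unfolding \<Psi>_def by (rule linearI) (simp_all add: linear_add[OF linG] linear_cmul[OF linG] om_add om_scaleR
        bilinear_ladd[OF \<beta>] bilinear_lmul[OF \<beta>] algebra_simps)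
  have \<Psi>ax: "\<Psi> v (axis r 1) $ s + \<Psi> v (axis s 1) $ r = 0" for r s v
    using g[of r v s] by (simp add: \<Psi>_def Gax)
  have \<Psi>0: "\<Psi> v w \<bullet> w' + \<Psi> v w' \<bullet> w = 0" for v w w'
  proof -
    have d: "\<Psi> v w = w$1 *\<^sub>R \<Psi> v q_i + w$2 *\<^sub>R \<Psi> v q_j + w$3 *\<^sub>R \<Psi> v q_k" for w
      by (subst wd) (simp only: linear_add[OF lin\<Psi>] linear_cmul[OF lin\<Psi>])
    have c: "\<Psi> v q_i $ 1 = 0" "\<Psi> v q_j $ 2 = 0" "\<Psi> v q_k $ 3 = 0" "\<Psi> v q_j $ 1 = - \<Psi> v q_i $ 2"
      "\<Psi> v q_k $ 1 = - \<Psi> v q_i $ 3" "\<Psi> v q_k $ 2 = - \<Psi> v q_j $ 3"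
      using \<Psi>ax[of v 1 1] \<Psi>ax[of v 2 2] \<Psi>ax[of v 3 3] \<Psi>ax[of v 1 2] \<Psi>ax[of v 1 3] \<Psi>ax[of v 2 3] by simp_all
    show ?thesis
      unfolding d[of w] d[of w'] inner_3 by (simp add: c algebra_simps)
  qed
  \<comment> \<open>Chosen so that \<open>rim q_i z\<close> cancels \<open>G q_i\<close>.\<close>
  define z where "z = rim q_i (G q_i)"
  define h where "h w = G w + rim w z" for w
  have linh: "linear h" unfolding h_def by (rule linear_compose_add[OF linG linear_rim(2)])
  have hi: "h q_i = 0" by (simp add: h_def z_def rim_rim)
  have conf: "(om (h w) v + \<beta> w v) \<bullet> w' + (om (h w') v + \<beta> w' v) \<bullet> w = - 2 * (z \<bullet> v) * (w \<bullet> w')" for v w w'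
    using \<Psi>0[of v w w'] rim_conformal[of w z v w'] by (simp add: h_def \<Psi>_def om_add inner_add_left)
  have h1: "h (axis s 1) = - rim (axis s 1) (\<Sum>b\<in>Basis. (\<beta> q_i b $ 1 - \<beta> (axis s 1) b $ s) *\<^sub>R b)" for s
  proof -
    have i1: "axis s (1::real) \<bullet> axis s 1 = 1" for s :: 3 by (simp add: inner_axis)
    \<comment> \<open>The conformal factor is read off at \<open>q_i\<close>, where \<open>h\<close>
      vanishes, and inserted into the condition at \<open>axis s 1\<close>.\<close>
    have hv: "rim (axis s 1) (h (axis s 1)) \<bullet> v = \<beta> q_i v $ 1 - \<beta> (axis s 1) v $ s" for v
      using conf[of q_i v q_i] conf[of "axis s 1" v "axis s 1"]
      by (simp add: hi i1 inner_axis om_inner[symmetric] inner_add_left bilinear_lzero[OF bilinear_om])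
    have "(\<Sum>b\<in>Basis. (\<beta> q_i b $ 1 - \<beta> (axis s 1) b $ s) *\<^sub>R b) = rim (axis s 1) (h (axis s 1))"
      unfolding hv[symmetric] by (rule euclidean_representation)
    then show ?thesis by (simp add: rim_rim)
  qed
  have "conformal_lift \<beta> w = h w" for w
  proof (rule linear_eq_axis[OF linear_conformal_lift linh])
    fix s :: 3
    show "conformal_lift \<beta> (axis s 1) = h (axis s 1)"
      using exhaust_3[of s] hi h1[of 2] h1[of 3] by (auto simp: conformal_lift_def)
  qed
  then show ?thesis using conf by (intro exI[of _ "\<lambda>v. - 2 * (z \<bullet> v)"]) simp
qed

text \<open>The condition in one chart, with \<open>a\<close> the triple of contact forms. The data
  at \<open>p\<close> are continued smoothly to a complement \<open>Q\<close> and a frame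
  \<open>B\<close> of the kernel; the data at the other points enter only as existence
  statements.\<close>

lemma duchemin_frame_flat:
  fixes a :: "'n::finite model \<Rightarrow> 'n model \<Rightarrow> real^3"
  assumes S: "open S" "p \<in> S" and lin: "\<And>y. y \<in> S \<Longrightarrow> linear (a y)" and a: "\<And>X. smooth_on S (\<lambda>y. a y X)"
  defines "\<omega> \<equiv> ext_deriv_flat a"
  assumes u: "\<And>y. y \<in> S \<Longrightarrow> \<exists>u :: real^4^'n \<Rightarrow> 'n model. linear u \<and> bij_betw u UNIV {X. a y X = 0} \<and>
      (\<forall>v v'. \<omega> y (u v) (u v') = om v v')"
    and R: "\<And>y. y \<in> S \<Longrightarrow> \<exists>R :: 3 \<Rightarrow> 'n model. \<forall>r s. a y (R r) = axis r 1 \<and>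
      (\<forall>X. a y X = 0 \<longrightarrow> \<omega> y (R s) X $ r + \<omega> y (R r) X $ s = 0)"
  shows "\<exists>T (e :: 'n model \<Rightarrow> 'n model \<Rightarrow> 'n model). open T \<and> p \<in> T \<and> T \<subseteq> S \<and>
    (\<forall>y\<in>T. linear (e y) \<and> bij (e y)) \<and> (\<forall>X. smooth_on T (\<lambda>y. e y X)) \<and>
    (\<forall>y\<in>T. (\<forall>X. a y (e y X) = snd X) \<and> (\<forall>v v'. \<omega> y (e y (v, 0)) (e y (v', 0)) = om v v') \<and>
      (\<exists>\<mu>. \<forall>v w w'. \<omega> y (e y (0, w)) (e y (v, 0)) \<bullet> w' + \<omega> y (e y (0, w')) (e y (v, 0)) \<bullet> w = \<mu> v * (w \<bullet> w')))"
proof -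
  have b\<omega>: "bilinear (\<omega> y)" if "y \<in> S" for y unfolding \<omega>_def by (rule bilinear_ext_deriv_flat[OF S(1) that lin a])
  have s\<omega>: "smooth_on S (\<lambda>y. \<omega> y X Y)" for X Y unfolding \<omega>_def by (rule smooth_ext_deriv_flat[OF S(1) a])
  obtain u0 :: "real^4^'n \<Rightarrow> 'n model" where u0: "linear u0" "bij_betw u0 UNIV {X. a p X = 0}" using u[OF S(2)] by blast
  obtain R0 :: "3 \<Rightarrow> 'n model" where R0: "\<And>r. a p (R0 r) = axis r 1" using R[OF S(2)] by blast
  define L where "L w = (\<Sum>r\<in>UNIV. w$r *\<^sub>R R0 r)" for w :: "real^3"
  have linL: "linear L" unfolding L_def by (rule linearI) (simp_all add: scaleR_add_left sum.distrib scaleR_sum_right)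
  define M where "M y w = a y (L w)" for y w
  have linM: "linear (M y)" if "y \<in> S" for y using linear_compose[OF linL lin[OF that]] by (simp add: M_def[abs_def] o_def)
  have smM: "smooth_on S (\<lambda>y. M y w)" for w unfolding M_def by (rule a)
  have "M p w = w" for w
  proof (rule linear_eq_axis[OF linM[OF S(2)] linear_ident])
    show "M p (axis r 1) = axis r 1" for r
      by (simp add: M_def L_def axis_def[of r] if_distrib[of "\<lambda>c. c *\<^sub>R _"] R0 cong: if_cong)
  qed
  then have "inj (M p)" by (simp add: inj_def)
  then obtain T1 where T1: "open T1" "p \<in> T1" "T1 \<subseteq> S" "\<And>y. y \<in> T1 \<Longrightarrow> bij (M y)"
    using linear_family_bij_open[OF S linM smooth_on_continuous[OF smM]] by metis
  have linM1: "linear (M y)" and linA1: "linear (a y)" if "y \<in> T1" for y using linM lin T1(3) that by blast+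
  \<comment> \<open>\<open>M p\<close> is the identity, so \<open>M y\<close> is invertible near
    \<open>p\<close>, and correcting \<open>L\<close> by its inverse gives a smooth right inverse of
    \<open>a y\<close>.\<close>
  define Q where "Q y w = L (inv (M y) w)" for y w
  have linQ: "linear (Q y)" if "y \<in> T1" for y
    using linear_compose[OF linear_inv[OF linM1[OF that] T1(4)[OF that]] linL] by (simp add: Q_def[abs_def] o_def)
  have smQ: "smooth_on T1 (\<lambda>y. Q y w)" for w
    unfolding Q_def
    by (rule smooth_on_linear[OF linL T1(1)]) (rule smooth_on_inv_family[OF T1(1) linM1 T1(4) smooth_on_subset[OF smM T1(3)]])
  have aQ: "a y (Q y w) = w" if "y \<in> T1" for y w
    using T1(4)[OF that] by (simp add: Q_def flip: M_def) (simp add: bij_def surj_f_inv_f)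
  \<comment> \<open>The frame \<open>u0\<close> of the kernel at \<open>p\<close>, projected along
    the complement into the kernel at \<open>y\<close>.\<close>
  define B where "B y v = u0 v - Q y (a y (u0 v))" for y v
  have linB: "linear (B y)" if "y \<in> T1" for y
    using linear_compose_sub[OF u0(1) linear_compose[OF linear_compose[OF u0(1) linA1[OF that]] linQ[OF that]]]
    by (simp add: B_def[abs_def] o_def)
  have smB: "smooth_on T1 (\<lambda>y. B y v)" for v
    unfolding B_def
    by (intro smooth_on_diff smooth_on_const T1(1) smooth_on_apply[where L = Q, OF T1(1) linQ smQ smooth_on_subset[OF a T1(3)]])
  have aB: "a y (B y v) = 0" if "y \<in> T1" for y v
    by (simp add: B_def linear_diff[OF linA1[OF that]] aQ[OF that])
  have Bp: "B p v = u0 v" for v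
  proof -
    have "u0 v \<in> {X. a p X = 0}" using u0(2) unfolding bij_betw_def by blast
    then have "a p (u0 v) = 0" by simp
    then show ?thesis by (simp add: B_def linear_0[OF linQ[OF T1(2)]])
  qed
  have "inj (B p)" using u0(2) by (simp add: bij_betw_def Bp[abs_def])
  then obtain c T2 where T2: "c > 0" "open T2" "p \<in> T2" "T2 \<subseteq> T1" "\<And>y v. y \<in> T2 \<Longrightarrow> c * norm v \<le> norm (B y v)"
    using linear_family_bounded_below[OF T1(1,2) linB smooth_on_continuous[OF smB]] by metis
  have T2S: "T2 \<subseteq> S" using T2(4) T1(3) by blast
  have injB: "v = 0" if "y \<in> T2" "B y v = 0" for y v
    using T2(5)[OF that(1), of v] T2(1) that(2) by (simp add: mult_le_0_iff)
  define \<tau> where "\<tau> y v v' = \<omega> y (B y v) (B y v')" for y v v'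
  have b\<tau>: "bilinear (\<tau> y)" if "y \<in> T2" for y
  proof -
    have "bilinear (\<omega> y)" "linear (B y)" using b\<omega> linB that T2(4) T2S by blast+
    from bilinear_compose_linear[OF this] show ?thesis by (simp add: \<tau>_def[abs_def])
  qed
  have sm\<tau>: "smooth_on T2 (\<lambda>y. \<tau> y v v')" for v v'
    unfolding \<tau>_def
    by (rule smooth_on_bilinear_family[OF T2(2) b\<omega>[OF subsetD[OF T2S]] smooth_on_subset[OF s\<omega> T2S] smooth_on_subset[OF smB T2(4)] smooth_on_subset[OF smB T2(4)]])
  \<comment> \<open>The pointwise adapted frame \<open>u\<close>, expressed in the smooth frame
    \<open>B y\<close> of the kernel.\<close>
  have "\<exists>C :: real^4^'n \<Rightarrow> real^4^'n. linear C \<and> bij C \<and> (\<forall>v v'. \<tau> y (C v) (C v') = om v v') \<and> range (\<lambda>v. B y (C v)) = {X. a y X = 0}" if y: "y \<in> T2" for y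
  proof -
    obtain u :: "real^4^'n \<Rightarrow> 'n model" where u: "linear u" "bij_betw u UNIV {X. a y X = 0}" "\<And>v v'. \<omega> y (u v) (u v') = om v v'"
      using u y T2S by blast
    have iu: "inv u (u v) = v" for v using u(2) by (simp add: bij_betw_def)
    have uB: "u (inv u (B y v)) = B y v" for v
    proof -
      have "B y v \<in> range u" using u(2) aB[of y v] y T2(4) by (auto simp: bij_betw_def)
      then show ?thesis by (rule f_inv_into_f)
    qed
    define K where "K v = inv u (B y v)" for v
    have lB: "linear (B y)" using linB y T2(4) by blast
    have linK: "linear K"
    proof (rule linearI)
      show "K (x + z) = K x + K z" for x z
        using iu[of "K x + K z"] by (simp add: K_def linear_add[OF u(1)] linear_add[OF lB] uB)
      show "K (r *\<^sub>R x) = r *\<^sub>R K x" for r x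
        using iu[of "r *\<^sub>R K x"] by (simp add: K_def linear_cmul[OF u(1)] linear_cmul[OF lB] uB)
    qed
    have bijK: "bij K"
    proof (rule bij_linear_injective[OF linK])
      fix v assume "K v = 0"
      then have "B y v = 0" using uB[of v] linear_0[OF u(1)] by (simp add: K_def)
      then show "v = 0" by (rule injB[OF y])
    qed
    have BC: "B y (inv K v) = u v" for v
    proof -
      have "K (inv K v) = v" using bijK by (simp add: bij_def surj_f_inv_f)
      then show ?thesis using uB[of "inv K v"] by (simp add: K_def)
    qed
    show ?thesis
      by (intro exI[of _ "inv K"] conjI allI linear_inv linK bijK bij_imp_bij_inv)
         (use u in \<open>simp_all add: \<tau>_def BC bij_betw_def\<close>)
  qed
  then obtain C :: "'n model \<Rightarrow> real^4^'n \<Rightarrow> real^4^'n" where C: "\<And>y. y \<in> T2 \<Longrightarrow> linear (C y)" "\<And>y. y \<in> T2 \<Longrightarrow> bij (C y)"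
    "\<And>y v v'. y \<in> T2 \<Longrightarrow> \<tau> y (C y v) (C y v') = om v v'" "\<And>y. y \<in> T2 \<Longrightarrow> range (\<lambda>v. B y (C y v)) = {X. a y X = 0}"
    by metis
  interpret AF: adapted_family T2 \<tau> C
    by (rule adapted_family.intro[OF T2(2) b\<tau> sm\<tau> C(1-3)])
  obtain T and A :: "'n model \<Rightarrow> real^4^'n \<Rightarrow> real^4^'n" where T: "open T" "p \<in> T" "T \<subseteq> T2" and A: "\<And>y. y \<in> T \<Longrightarrow> linear (A y)" "\<And>v. smooth_on T (\<lambda>y. A y v)"
    "\<And>y v v'. y \<in> T \<Longrightarrow> \<tau> y (A y v) (A y v') = om v v'" "\<And>y. y \<in> T \<Longrightarrow> bij (A y)"
    using AF.smooth_adapted_frame[OF T2(3)] by metis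
  have TT: "y \<in> T2" "y \<in> T1" "y \<in> S" if "y \<in> T" for y using that T(3) T2(4) T1(3) by blast+
  have TS: "T \<subseteq> T1" "T \<subseteq> S" using TT by blast+
  define F where "F y v = B y (A y v)" for y v
  have linF: "linear (F y)" if "y \<in> T" for y
    using linear_compose[OF A(1)[OF that] linB[OF TT(2)[OF that]]] by (simp add: F_def[abs_def] o_def)
  have smF: "smooth_on T (\<lambda>y. F y (f y))" if "smooth_on T f" for f
    unfolding F_def
    using smooth_on_apply[where L = B, OF T(1) linB[OF TT(2)] smooth_on_subset[OF smB TS(1)] smooth_on_apply[OF T(1) A(1,2) that]] .
  have F\<omega>: "\<omega> y (F y v) (F y v') = om v v'" if "y \<in> T" for y v v' using A(3)[OF that] by (simp add: F_def \<tau>_def)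
  have aF: "a y (F y v) = 0" if "y \<in> T" for y v unfolding F_def by (rule aB[OF TT(2)[OF that]])
  have kerF: "\<exists>v. X = F y v" if y: "y \<in> T" and X: "a y X = 0" for y X
  proof -
    obtain v where "X = B y (C y v)" using C(4)[OF TT(1)[OF y]] X by blast
    moreover obtain v' where "C y v = A y v'" using A(4)[OF y] by (metis bij_pointE)
    ultimately show ?thesis by (auto simp: F_def)
  qed
  have injF: "v = 0" if "y \<in> T" "F y v = 0" for y v
  proof -
    have "A y v = A y 0" using injB[OF TT(1)[OF that(1)]] that(2) linear_0[OF A(1)[OF that(1)]] by (simp add: F_def)
    then show ?thesis using A(4)[OF that(1)] by (simp add: bij_def inj_eq)
  qed
  define \<beta> where "\<beta> y w v = \<omega> y (Q y w) (F y v)" for y w v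
  have b\<beta>: "bilinear (\<beta> y)" if "y \<in> T" for y
    unfolding bilinear_def \<beta>_def
    by (intro conjI allI linearI; simp add: linear_add[OF linQ[OF TT(2)[OF that]]] linear_cmul[OF linQ[OF TT(2)[OF that]]]
        linear_add[OF linF[OF that]] linear_cmul[OF linF[OF that]] bilinear_ladd[OF b\<omega>[OF TT(3)[OF that]]]
        bilinear_radd[OF b\<omega>[OF TT(3)[OF that]]] bilinear_lmul[OF b\<omega>[OF TT(3)[OF that]]] bilinear_rmul[OF b\<omega>[OF TT(3)[OF that]]])
  have sm\<beta>: "smooth_on T (\<lambda>y. \<beta> y w v)" for w v
    unfolding \<beta>_def
    by (rule smooth_on_bilinear_family[OF T(1) b\<omega>[OF TT(3)] smooth_on_subset[OF s\<omega> TS(2)] smooth_on_subset[OF smQ TS(1)] smF[OF smooth_on_const]])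
  have sml: "smooth_on T (\<lambda>y. conformal_lift (\<beta> y) w)" for w
    unfolding conformal_lift_def
    by (intro smooth_on_minus smooth_on_add smooth_on_scaleR smooth_on_const T(1) smooth_on_linear[OF linear_rim(1)] smooth_on_sum
        smooth_on_diff smooth_on_nth sm\<beta>)
  \<comment> \<open>Reeb directions are the complement \<open>Q\<close> corrected within the kernel
    by the normalised lift.\<close>
  define e where "e y X = F y (fst X + conformal_lift (\<beta> y) (snd X)) + Q y (snd X)" for y X
  have line: "linear (e y)" if "y \<in> T" for y
    unfolding e_def
    by (intro linearI; simp add: linear_add[OF linQ[OF TT(2)[OF that]]] linear_cmul[OF linQ[OF TT(2)[OF that]]]
        linear_add[OF linF[OF that]] linear_cmul[OF linF[OF that]] linear_add[OF linear_conformal_lift] linear_cmul[OF linear_conformal_lift]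
        algebra_simps)
  have ae: "a y (e y X) = snd X" if "y \<in> T" for y X
    by (simp add: e_def linear_add[OF lin[OF TT(3)[OF that]]] aF[OF that] aQ[OF TT(2)[OF that]])
  have bije: "bij (e y)" if "y \<in> T" for y
  proof (rule bij_linear_injective[OF line[OF that]])
    fix X assume X: "e y X = 0"
    then have "snd X = 0" using ae[OF that, of X] linear_0[OF lin[OF TT(3)[OF that]]] by simp
    moreover from this have "fst X = 0"
      using X injF[OF that, of "fst X"] linear_0[OF linQ[OF TT(2)[OF that]]]
      by (simp add: e_def linear_0[OF linear_conformal_lift])
    ultimately show "X = 0" by (simp add: prod_eq_iff)
  qed
  have sme: "smooth_on T (\<lambda>y. e y X)" for X
    unfolding e_def by (intro smooth_on_add smF sml smooth_on_const T(1) smooth_on_subset[OF smQ TS(1)])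
  have eV: "e y (v, 0) = F y v" if "y \<in> T" for y v
    by (simp add: e_def linear_0[OF linear_conformal_lift] linear_0[OF linQ[OF TT(2)[OF that]]])
  have eW: "\<omega> y (e y (0, w)) (e y (v, 0)) = om (conformal_lift (\<beta> y) w) v + \<beta> y w v" if "y \<in> T" for y w v
    unfolding eV[OF that] by (simp add: e_def bilinear_ladd[OF b\<omega>[OF TT(3)[OF that]]] F\<omega>[OF that] \<beta>_def)
  have conf: "\<exists>\<mu>. \<forall>v w w'. \<omega> y (e y (0, w)) (e y (v, 0)) \<bullet> w' + \<omega> y (e y (0, w')) (e y (v, 0)) \<bullet> w = \<mu> v * (w \<bullet> w')"
    if y: "y \<in> T" for y
  proof -
    obtain R where R: "\<And>r. a y (R r) = axis r 1" "\<And>r s X. a y X = 0 \<Longrightarrow> \<omega> y (R s) X $ r + \<omega> y (R r) X $ s = 0"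
      using R[OF TT(3)[OF y]] by blast
    have "\<exists>v. R r - Q y (axis r 1) = F y v" for r
      by (rule kerF[OF y]) (simp add: linear_diff[OF lin[OF TT(3)[OF y]]] R(1) aQ[OF TT(2)[OF y]])
    then obtain g where g: "\<And>r. R r - Q y (axis r 1) = F y (g r)" by metis
    have "om (g r) v + \<beta> y (axis r 1) v = \<omega> y (R r) (F y v)" for r v
    proof -
      have "R r = F y (g r) + Q y (axis r 1)" using g[of r] by (simp add: algebra_simps)
      then show ?thesis by (simp add: bilinear_ladd[OF b\<omega>[OF TT(3)[OF y]]] F\<omega>[OF y] \<beta>_def)
    qed
    then have "om (g r) v $ s + \<beta> y (axis r 1) v $ s + (om (g s) v $ r + \<beta> y (axis s 1) v $ r) = 0" for r s v
      using R(2)[OF aF[OF y], of s v r] by (metis add.commute vector_add_component)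
    from conformal_lift[OF b\<beta>[OF y] this] show ?thesis unfolding eW[OF y] .
  qed
  have eom: "\<omega> y (e y (v, 0)) (e y (v', 0)) = om v v'" if "y \<in> T" for y v v' unfolding eV[OF that] by (rule F\<omega>[OF that])
  show ?thesis
    by (intro exI[of _ T] exI[of _ e] conjI ballI allI T(1,2) TS(2) line bije sme ae eom conf)
qed

section \<open>From Duchemin's condition to a K-structure\<close>

context qc_manifold
begin

lemma duchemin_good_section:
  assumes D: "duchemin_integrable \<A> D"
  obtains U s where "x \<in> U" "good_section D U s"
proof -
  obtain U \<eta> where *: "open U \<and> x \<in> U \<and> qc_forms \<A> D U \<eta> \<and>
        (\<forall>y\<in>U. \<exists>R :: 3 \<Rightarrow> 'n model. \<forall>r s.
           \<eta> s y (R r) = (if s = r then 1 else 0) \<and>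
           (\<forall>X\<in>D y. ext_deriv \<A> (\<eta> r) y (R s) X + ext_deriv \<A> (\<eta> s) y (R r) X = 0))"
    using D[unfolded duchemin_integrable_def, rule_format, of x] by (elim exE)
  then have U: "open U" "x \<in> U" and qc: "qc_forms \<A> D U \<eta>" by blast+
  have \<eta>: "smooth_one_form \<A> U (\<eta> r)" for r using qc unfolding qc_forms_def by blast
  have Dker: "X \<in> D y \<longleftrightarrow> (\<forall>s. \<eta> s y X = 0)" if "y \<in> U" for y X using qc that unfolding qc_forms_def by blast
  let ?c = "chart_at \<A> x"
  have c: "?c \<in> \<A>" "x \<in> fst ?c" by (rule chart_at)+
  let ?S = "snd ?c ` (U \<inter> fst ?c)" and ?i = "chart_inv ?c"
  have S: "open ?S" "snd ?c x \<in> ?S" using open_image_chart[OF c(1) U(1)] U c by auto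
  note cD = chart_image_D[OF c(1)]
  define a where "a y X = (\<chi> r. form_in_chart \<A> ?c (\<eta> r) y X)" for y X
  have lina: "linear (a y)" if "y \<in> ?S" for y
    using linear_form_in_chart[OF \<eta> c(1) that] unfolding a_def
    by (intro linearI) (simp_all add: vec_eq_iff linear_add linear_cmul)
  have sma: "smooth_on ?S (\<lambda>y. a y X)" for X
    unfolding a_def by (intro smooth_on_vec_lambda S smooth_one_form_smooth_on[OF \<eta> c(1)])
  have \<omega>: "ext_deriv_flat a y (to_chart \<A> ?c (?i y) X) (to_chart \<A> ?c (?i y) Y) $ r = ext_deriv \<A> (\<eta> r) (?i y) X Y" if y: "y \<in> ?S" for y X Y r
  proof -
    have "frechet_derivative (\<lambda>y. a y v) (at y) w $ r = frechet_derivative (\<lambda>y. form_in_chart \<A> ?c (\<eta> r) y v) (at y) w" for v w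
      using frechet_derivative_bounded_linear[OF bounded_linear_vec_nth[of r] smooth_on_differentiable[OF sma[of v] y], of w] by (simp add: a_def)
    then show ?thesis
      unfolding ext_deriv_chart[OF \<eta> U(1) cD(1)[OF y] c(1) cD(2)[OF y]] cD(3)[OF y] ext_deriv_flat_def by simp
  qed
  have a0: "a y X = 0 \<longleftrightarrow> from_chart \<A> ?c (?i y) X \<in> D (?i y)" if "y \<in> ?S" for y X
    by (simp add: a_def vec_eq_iff form_in_chart_def Dker[OF cD(1)[OF that]])
  have u: "\<exists>u :: real^4^'n \<Rightarrow> 'n model. linear u \<and> bij_betw u UNIV {X. a y X = 0} \<and>
      (\<forall>v v'. ext_deriv_flat a y (u v) (u v') = om v v')" if y: "y \<in> ?S" for y
  proof -
    note ft = to_from_chart[OF c(1) cD(2)[OF y]] and lt = linear_to_chart[OF c(1) cD(2)[OF y]]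
    obtain u :: "real^4^'n \<Rightarrow> 'n model" where u: "linear u" "bij_betw u UNIV (D (?i y))"
      "\<And>s v v'. ext_deriv \<A> (\<eta> s) (?i y) (u v) (u v') = qc_omega s v v'"
      using qc cD(1)[OF y] unfolding qc_forms_def by meson
    let ?u = "to_chart \<A> ?c (?i y) \<circ> u"
    have "bij_betw (to_chart \<A> ?c (?i y)) (D (?i y)) {X. a y X = 0}"
      by (rule bij_betw_byWitness[where f' = "from_chart \<A> ?c (?i y)"]) (use ft a0[OF y] in auto)
    then have "bij_betw ?u UNIV {X. a y X = 0}" by (rule bij_betw_trans[OF u(2)])
    moreover have "ext_deriv_flat a y (?u v) (?u v') = om v v'" for v v'
      using \<omega>[OF y, of "u v" "u v'"] u(3) by (simp add: vec_eq_iff om_def)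
    ultimately show ?thesis using linear_compose[OF u(1) lt] by blast
  qed
  have R: "\<exists>R :: 3 \<Rightarrow> 'n model. \<forall>r s. a y (R r) = axis r 1 \<and>
      (\<forall>X. a y X = 0 \<longrightarrow> ext_deriv_flat a y (R s) X $ r + ext_deriv_flat a y (R r) X $ s = 0)" if y: "y \<in> ?S" for y
  proof -
    note ft = to_from_chart[OF c(1) cD(2)[OF y]]
    obtain R :: "3 \<Rightarrow> 'n model" where R: "\<And>r s. \<eta> s (?i y) (R r) = (if s = r then 1 else 0)"
       "\<And>r s X. X \<in> D (?i y) \<Longrightarrow> ext_deriv \<A> (\<eta> r) (?i y) (R s) X + ext_deriv \<A> (\<eta> s) (?i y) (R r) X = 0"
    proof -
      obtain R where "\<forall>r s. \<eta> s (?i y) (R r) = (if s = r then 1 else 0) \<and>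
           (\<forall>X\<in>D (?i y). ext_deriv \<A> (\<eta> r) (?i y) (R s) X + ext_deriv \<A> (\<eta> s) (?i y) (R r) X = 0)"
        using *[THEN conjunct2, THEN conjunct2, THEN conjunct2, THEN bspec, OF cD(1)[OF y]] by (elim exE)
      then show thesis using that[of R] by blast
    qed
    let ?R = "\<lambda>r. to_chart \<A> ?c (?i y) (R r)"
    have "a y (?R r) = axis r 1" for r
      by (simp add: a_def vec_eq_iff form_in_chart_def ft R(1)) (simp add: axis_def)
    moreover have "ext_deriv_flat a y (?R s) X $ r + ext_deriv_flat a y (?R r) X $ s = 0" if "a y X = 0" for r s X
      using R(2)[of "from_chart \<A> ?c (?i y) X" r s] \<omega>[OF y, of "R s" "from_chart \<A> ?c (?i y) X" r]
        \<omega>[OF y, of "R r" "from_chart \<A> ?c (?i y) X" s] a0[OF y] that by (simp add: ft)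
    ultimately show ?thesis by (intro exI[of _ ?R]) blast
  qed
  obtain T and e :: "'n model \<Rightarrow> 'n model \<Rightarrow> 'n model" where **: "open T \<and> snd ?c x \<in> T \<and> T \<subseteq> ?S \<and>
    (\<forall>y\<in>T. linear (e y) \<and> bij (e y)) \<and> (\<forall>X. smooth_on T (\<lambda>y. e y X)) \<and>
    (\<forall>y\<in>T. (\<forall>X. a y (e y X) = snd X) \<and> (\<forall>v v'. ext_deriv_flat a y (e y (v, 0)) (e y (v', 0)) = om v v') \<and>
      (\<exists>\<mu>. \<forall>v w w'. ext_deriv_flat a y (e y (0, w)) (e y (v, 0)) \<bullet> w'
        + ext_deriv_flat a y (e y (0, w')) (e y (v, 0)) \<bullet> w = \<mu> v * (w \<bullet> w')))"
    by (atomize_elim; rule duchemin_frame_flat[OF S lina sma u R]; assumption)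
  then have T: "open T" "snd ?c x \<in> T" "T \<subseteq> ?S"
    and e: "y \<in> T \<Longrightarrow> linear (e y)" "y \<in> T \<Longrightarrow> bij (e y)" "smooth_on T (\<lambda>y. e y X)"
    "y \<in> T \<Longrightarrow> a y (e y X) = snd X"
    "y \<in> T \<Longrightarrow> ext_deriv_flat a y (e y (v, 0)) (e y (v', 0)) = om v v'"
    "y \<in> T \<Longrightarrow> \<exists>\<mu>. \<forall>v w w'. ext_deriv_flat a y (e y (0, w)) (e y (v, 0)) \<bullet> w'
        + ext_deriv_flat a y (e y (0, w')) (e y (v, 0)) \<bullet> w = \<mu> v * (w \<bullet> w')" for y X v v'
    by blast+
  define N where "N = {y \<in> fst ?c. snd ?c y \<in> T}"
  have N: "open N" "x \<in> N" "N \<subseteq> fst ?c"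
    using open_chart_preimage[OF c(1) T(1)] c T(2) by (auto simp: N_def)
  have NT: "snd ?c y \<in> T" "y \<in> fst ?c" "?i (snd ?c y) = y" if "y \<in> N" for y
    using that chart_inv_chart[OF c(1)] by (auto simp: N_def)
  have NU: "y \<in> U" if "y \<in> N" for y
    using cD(1)[OF subsetD[OF T(3) NT(1)[OF that]]] NT(3)[OF that] by simp
  \<comment> \<open>The frame in coordinates, carried back to tangent vectors in the preferred
    charts of the individual points.\<close>
  define s where "s y X = from_chart \<A> ?c y (e (snd ?c y) X)" for y X
  have iN: "snd ?c ` N \<subseteq> T" using NT(1) by blast
  have oN: "open (snd ?c ` N)" by (rule open_image_chart_subset[OF c(1) N(1,3)])
  have es: "to_chart \<A> ?c (?i y) (s (?i y) X) = e y X" if "y \<in> snd ?c ` N" for y X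
    using that NT(2,3) c(1) by (auto simp: s_def)
  have sf: "smooth_frame_field \<A> N s"
    unfolding smooth_frame_field_def
  proof (intro conjI ballI allI)
    fix y assume y: "y \<in> N"
    show "linear (s y)"
      using linear_compose[OF e(1)[OF NT(1)[OF y]] linear_from_chart[OF c(1) NT(2)[OF y]]] by (simp add: s_def[abs_def] o_def)
    have "bij (from_chart \<A> ?c y)"
      by (rule bijI'[where f = "from_chart \<A> ?c y"]) (metis to_from_chart[OF c(1) NT(2)[OF y]])+
    from bij_comp[OF e(2)[OF NT(1)[OF y]] this] show "bij (s y)" by (simp add: s_def[abs_def] o_def)
  next
    fix X
    have "smooth_on (snd ?c ` N) (\<lambda>y. e y X)" by (rule smooth_on_subset[OF e(3) iN])
    then have "smooth_on (snd ?c ` N) (\<lambda>y. to_chart \<A> ?c (?i y) (s (?i y) X))"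
      using smooth_on_cong[OF oN, of "\<lambda>y. to_chart \<A> ?c (?i y) (s (?i y) X)" "\<lambda>y. e y X"] es by blast
    then show "smooth_vector_field \<A> N (\<lambda>y. s y X)" by (rule smooth_vector_field_chartI[OF c(1) N(1,3)])
  qed
  have ct: "snd (coframe_torsion \<A> s y X Y) = ext_deriv_flat a (snd ?c y) (e (snd ?c y) X) (e (snd ?c y) Y)" if y: "y \<in> N" for y X Y
  proof -
    let ?p = "snd ?c y" and ?e = "\<lambda>y X. to_chart \<A> ?c (?i y) (s (?i y) X)"
    have p: "?p \<in> snd ?c ` N" using y by blast
    \<comment> \<open>From \<open>a (e X) = snd X\<close>: the W-component of the coframe is the
      triple of contact forms, so its exterior derivative is that of \<open>a\<close>.\<close>
    have ie: "snd (inv (?e q) X) = a q X" if "q \<in> snd ?c ` N" for q X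
    proof -
      have q: "q \<in> T" using that iN by blast
      have "e q (inv (e q) X) = X" using e(2)[OF q] by (simp add: bij_def surj_f_inv_f)
      then show ?thesis using e(4)[OF q, of "inv (e q) X"] by (simp add: es[OF that])
    qed
    have "smooth_on (snd ?c ` N) (\<lambda>q. inv (?e q) X)" for X
      using smooth_on_inv_family[OF oN e(1)[OF subsetD[OF iN]] e(2)[OF subsetD[OF iN]] smooth_on_subset[OF e(3) iN]]
        smooth_on_cong[OF oN, of "\<lambda>q. inv (?e q) X" "\<lambda>q. inv (e q) X"] es by simp
    from smooth_on_differentiable[OF this p]
    have fr: "snd (frechet_derivative (\<lambda>q. inv (?e q) X) (at ?p) Y) = frechet_derivative (\<lambda>q. a q X) (at ?p) Y" for X Y
      using frechet_derivative_bounded_linear[OF bounded_linear_snd, of "\<lambda>q. inv (?e q) X" ?p Y]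
        frechet_derivative_cong_open[OF oN p, of "\<lambda>q. snd (inv (?e q) X)" "\<lambda>q. a q X"] ie by simp
    have "snd (ext_deriv_flat (\<lambda>q. inv (?e q)) ?p X Y) = ext_deriv_flat a ?p X Y" for X Y
      unfolding ext_deriv_flat_def snd_diff fr ..
    then show ?thesis
      unfolding coframe_torsion_chart[OF sf N(1) y c(1) NT(2)[OF y]] es[OF p] .
  qed
  have "good_section D N s"
    unfolding good_section_def
  proof (intro conjI ballI N(1) sf)
    fix y assume y: "y \<in> N"
    note t = NT[OF y] and tf = to_from_chart[OF c(1) NT(2)[OF y]]
    have tS: "snd ?c y \<in> ?S" using t(1) T(3) by blast
    have ay: "from_chart \<A> ?c y X \<in> D y \<longleftrightarrow> a (snd ?c y) X = 0" for X using a0[OF tS, of X] t(3) by simp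
    show "s y ` (UNIV \<times> {0}) = D y"
    proof (intro equalityI subsetI)
      fix X assume "X \<in> s y ` (UNIV \<times> {0})"
      then obtain v where "X = s y (v, 0)" by auto
      then show "X \<in> D y" using e(4)[OF t(1), of "(v, 0)"] by (simp add: s_def ay)
    next
      fix X assume X: "X \<in> D y"
      obtain Z where Z: "to_chart \<A> ?c y X = e (snd ?c y) Z" using e(2)[OF t(1)] by (metis bij_pointE)
      have "a (snd ?c y) (to_chart \<A> ?c y X) = 0" using ay[of "to_chart \<A> ?c y X"] X by (simp only: tf)
      then have "snd Z = 0" using e(4)[OF t(1), of Z] by (simp add: Z)
      moreover have "X = s y Z" by (simp add: s_def tf flip: Z)
      ultimately show "X \<in> s y ` (UNIV \<times> {0})" by (metis SigmaI UNIV_I image_eqI prod.collapse singletonI)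
    qed
    show "\<forall>v v'. snd (coframe_torsion \<A> s y (v, 0) (v', 0)) = om v v'"
      unfolding ct[OF y] using e(5)[OF t(1)] by blast
    show "\<exists>\<mu>. \<forall>v w w'. snd (coframe_torsion \<A> s y (0, w) (v, 0)) \<bullet> w' + snd (coframe_torsion \<A> s y (0, w') (v, 0)) \<bullet> w = \<mu> v * (w \<bullet> w')"
      unfolding ct[OF y] by (rule e(6)[OF t(1)])
  qed
  with N(2) show ?thesis by (rule that)
qed

text \<open>Two base frames in one fibre of \<open>P\<close> differ by an element of
  \<open>K_group\<close>, which \<open>B_group\<close> absorbs.\<close>

lemma homogeneous_extend:
  assumes P: "\<And>x u. u \<in> P x \<Longrightarrow> linear u \<and> bij u \<and> P x = {u \<circ> k |k. k \<in> K_group}"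
  shows "BG.homogeneous (extend_structure P B_group)"
  unfolding BG.homogeneous_def
proof (intro allI ballI conjI)
  fix x w assume "w \<in> extend_structure P B_group x"
  then obtain u g where u: "u \<in> P x" and g: "g \<in> B_group" and w: "w = u \<circ> g" unfolding extend_structure_def by blast
  show "linear w" "bij w" unfolding w using P[OF u] B.lin[OF g] B.bij[OF g] linear_compose bij_comp by blast+
  have gi: "g \<circ> inv g = id" using B.bij[OF g] by (simp add: bij_def surj_iff)
  show "extend_structure P B_group x = {w \<circ> h |h. h \<in> B_group}"
  proof (intro equalityI subsetI)
    fix z assume "z \<in> extend_structure P B_group x"
    then obtain u' g' where z: "u' \<in> P x" "g' \<in> B_group" "z = u' \<circ> g'" unfolding extend_structure_def by blast
    then obtain k where k: "k \<in> K_group" "u' = u \<circ> k" using P[OF u] by blast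
    have "z = u \<circ> (g \<circ> inv g) \<circ> (k \<circ> g')" unfolding gi by (simp add: z k comp_assoc)
    then have "z = w \<circ> (inv g \<circ> (k \<circ> g'))" by (simp add: w comp_assoc)
    moreover have "inv g \<circ> (k \<circ> g') \<in> B_group" by (intro B.comp B.inv g K_subset_B k z)
    ultimately show "z \<in> {w \<circ> h |h. h \<in> B_group}" by blast
  next
    fix z assume "z \<in> {w \<circ> h |h. h \<in> B_group}"
    then obtain h where "h \<in> B_group" "z = u \<circ> (g \<circ> h)" by (auto simp: w comp_assoc)
    then show "z \<in> extend_structure P B_group x" using u B.comp[OF g] unfolding extend_structure_def by blast
  qed
qed

lemma local_section_extend:
  assumes "local_section \<A> P U s" shows "local_section \<A> (extend_structure P B_group) U s"
proof -
  have "s x \<in> extend_structure P B_group x" if "s x \<in> P x" for x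
    unfolding extend_structure_def using that B.id by (intro CollectI exI[of _ "s x"] exI[of _ id]) simp
  then show ?thesis using assms unfolding local_section_def by blast
qed

lemma duchemin_imp_K_structure:
  assumes D: "duchemin_integrable \<A> D"
  shows "\<exists>P. integrable_qc_K_structure \<A> P \<and> (\<forall>x. P x \<subseteq> Q_structure_of D x)"
proof -
  define P where "P x = {s x |U s. good_section D U s \<and> x \<in> U}" for x
  have sec: "local_section \<A> P U s" if "good_section D U s" for U s
    using good_section_D(2)[OF that] that unfolding local_section_def P_def by blast
  have fib: "linear u \<and> bij u \<and> P x = {u \<circ> k |k. k \<in> K_group}" if u: "u \<in> P x" for x u
  proof -
    obtain U s where s: "good_section D U s" "x \<in> U" "u = s x" using u unfolding P_def by blast
    have lb: "linear u" "bij u" using smooth_frame_D[OF good_section_D(2)[OF s(1)] s(2)] s(3) by auto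
    have "P x = {u \<circ> k |k. k \<in> K_group}"
    proof (intro equalityI subsetI)
      fix z assume "z \<in> P x"
      then obtain U' s' where s': "good_section D U' s'" "x \<in> U'" "z = s' x" unfolding P_def by blast
      have "u \<circ> inv u = id" using lb(2) by (simp add: bij_def surj_iff)
      then have "z = u \<circ> (inv u \<circ> z)" by (simp flip: comp_assoc)
      then show "z \<in> {u \<circ> k |k. k \<in> K_group}"
        using good_section_transition[OF s'(1) s(1) s'(2) s(2)] s(3) s'(3) by blast
    next
      fix z assume "z \<in> {u \<circ> k |k. k \<in> K_group}"
      then obtain k where k: "k \<in> K_group" "z = s x \<circ> k" using s(3) by blast
      show "z \<in> P x"
        unfolding P_def using good_section_comp_K[OF s(1) k(1)] s(2) k(2)
        by (intro CollectI exI[of _ "\<lambda>x. s x \<circ> k"] exI[of _ U]) simp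
    qed
    with lb show ?thesis by blast
  qed
  have secs: "\<exists>U s. open U \<and> x \<in> U \<and> local_section \<A> P U s" for x
  proof -
    obtain U s where us: "x \<in> U" "good_section D U s" by (rule duchemin_good_section[OF D])
    show ?thesis using us(1) good_section_D(1)[OF us(2)] sec[OF us(2)] by blast
  qed
  have gs: "G_structure \<A> K_group P"
    unfolding G_structure_def by (rule conjI[OF allI[OF ballI[OF fib]] allI[OF secs]])
  have it: "intrinsic_torsion \<A> B_group (extend_structure P B_group) x u = coker_class B_group Theta0"
    if u: "u \<in> P x" for x u
  proof -
    obtain U s where s: "good_section D U s" "x \<in> U" "u = s x" using u unfolding P_def by blast
    have "intrinsic_torsion \<A> B_group (extend_structure P B_group) x (s x) = coker_class B_group (coframe_torsion \<A> s x)"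
      by (rule BG.intrinsic_torsion_eq[OF homogeneous_extend[OF fib] local_section_extend[OF sec[OF s(1)]] good_section_D(1)[OF s(1)] s(2)])
    then show ?thesis using good_section_coker_class[OF s(1,2)] s(3) by simp
  qed
  have "P x \<subseteq> Q_structure_of D x" for x
  proof
    fix u assume u: "u \<in> P x"
    then obtain U s where s: "good_section D U s" "x \<in> U" "u = s x" unfolding P_def by blast
    then show "u \<in> Q_structure_of D x"
      using fib[OF u] good_section_D(3)[OF s(1,2)] unfolding Q_structure_of_def by simp
  qed
  moreover have "integrable_qc_K_structure \<A> P"
    unfolding integrable_qc_K_structure_def by (rule conjI[OF gs allI[OF ballI[OF it]]])
  ultimately show ?thesis by blast
qed

section \<open>From a K-structure to Duchemin's condition\<close>

lemma K_structure_imp_duchemin: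
  assumes P: "integrable_qc_K_structure \<A> P" and Q: "\<And>x. P x \<subseteq> Q_structure_of D x"
  shows "duchemin_integrable \<A> D"
  unfolding duchemin_integrable_def
proof
  fix x
  have fib: "linear u \<and> bij u \<and> P y = {u \<circ> k |k. k \<in> K_group}" if "u \<in> P y" for y u
    using P that unfolding integrable_qc_K_structure_def G_structure_def by blast
  obtain U s where U: "open U" "x \<in> U" and s: "local_section \<A> P U s"
    using P unfolding integrable_qc_K_structure_def G_structure_def by blast
  have sf: "smooth_frame_field \<A> U s" and sP: "\<And>y. y \<in> U \<Longrightarrow> s y \<in> P y" using s unfolding local_section_def by blast+
  define f where "f r X = snd X $ r" for r :: 3 and X :: "'n model"
  have linf: "linear (f r)" for r unfolding f_def by (rule linearI) simp_all
  \<comment> \<open>The contact forms are the W-components of the coframe of the given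
    section.\<close>
  define \<eta> where "\<eta> r y X = f r (inv (s y) X)" for r y X
  have \<eta>: "smooth_one_form \<A> U (\<eta> r)" for r
    unfolding smooth_one_form_def
  proof (intro conjI ballI allI)
    show "linear (\<eta> r y)" if "y \<in> U" for y
      using linear_compose[OF smooth_frame_D(5)[OF sf that] linf] by (simp add: \<eta>_def[abs_def] o_def)
    fix c v assume c: "c \<in> \<A>"
    show "smooth_on (snd c ` (U \<inter> fst c)) (\<lambda>y. form_in_chart \<A> c (\<eta> r) y v)"
      using smooth_on_linear[OF linf open_image_chart[OF c U(1)] smooth_one_form_smooth_on[OF smooth_coframe[OF sf U(1)] c]]
      by (simp add: form_in_chart_def \<eta>_def)
  qed
  have d\<eta>: "ext_deriv \<A> (\<eta> r) y (s y X) (s y Y) = snd (coframe_torsion \<A> s y X Y) $ r" if y: "y \<in> U" for r y X Y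
    using ext_deriv_gauge[OF smooth_family_const[OF linf] smooth_coframe[OF sf U(1)] \<eta> U(1) y, of r]
    by (simp add: \<eta>_def coframe_torsion_def dir_deriv_const) (simp add: f_def)
  have \<eta>s: "\<eta> r y (s y X) = snd X $ r" if "y \<in> U" for r y X
    by (simp add: \<eta>_def f_def smooth_frame_D(3)[OF sf that])
  have tor: "\<exists>a. (\<forall>X. a X \<in> lie_algebra B_group) \<and> (\<forall>X Y. coframe_torsion \<A> s y X Y = Theta0 X Y + (a X Y - a Y X))" if y: "y \<in> U" for y
  proof -
    have "coker_class B_group (coframe_torsion \<A> s y) = coker_class B_group Theta0"
      using BG.intrinsic_torsion_eq[OF homogeneous_extend[OF fib] local_section_extend[OF s] U(1) y]
        P sP[OF y] unfolding integrable_qc_K_structure_def by simp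
    then have "coframe_torsion \<A> s y \<in> coker_class B_group Theta0" using B.mem_coker_class by blast
    then show ?thesis unfolding coker_class_def partial_map_def by (auto simp: fun_eq_iff)
  qed
  \<comment> \<open>Lie algebra elements have no W-component on V, so there the torsion agrees with
    \<open>Theta0\<close>.\<close>
  have tV: "snd (coframe_torsion \<A> s y (v, 0) (v', 0)) = om v v'" if "y \<in> U" for y v v'
    using tor[OF that] by (auto simp: Theta0_def om_def lie_algebra_B_D(1))
  have Dy: "s y ` (UNIV \<times> {0}) = D y" if "y \<in> U" for y
    using Q[of y] sP[OF that] unfolding Q_structure_of_def by blast
  have Dker: "X \<in> D y \<longleftrightarrow> snd (inv (s y) X) = 0" if y: "y \<in> U" for y X
  proof
    assume "X \<in> D y"
    then obtain v where "X = s y (v, 0)" using Dy[OF y] by auto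
    then show "snd (inv (s y) X) = 0" by (simp add: smooth_frame_D(3)[OF sf y])
  next
    assume "snd (inv (s y) X) = 0"
    then have "inv (s y) X \<in> UNIV \<times> {0}" by (metis SigmaI UNIV_I prod.collapse singletonI)
    then have "s y (inv (s y) X) \<in> s y ` (UNIV \<times> {0})" by (rule imageI)
    then show "X \<in> D y" by (simp add: Dy[OF y] smooth_frame_D(4)[OF sf y])
  qed
  have qc: "qc_forms \<A> D U \<eta>"
    unfolding qc_forms_def
  proof (intro conjI allI ballI \<eta>)
    fix y assume y: "y \<in> U"
    show "D y = {X. \<forall>r. \<eta> r y X = 0}"
      using Dker[OF y] by (auto simp: \<eta>_def f_def vec_eq_iff)
    let ?u = "\<lambda>v. s y (v, 0)"
    have "linear ?u"
      using smooth_frame_D(1)[OF sf y] linear_add[of "s y" "(_, 0)" "(_, 0)"] linear_cmul[of "s y" _ "(_, 0)"]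
      by (intro linearI) (simp_all)
    moreover have "bij_betw ?u UNIV (D y)"
      using Dy[OF y] smooth_frame_D(3)[OF sf y] by (auto simp: bij_betw_def intro!: inj_onI) (metis prod.inject)
    moreover have "ext_deriv \<A> (\<eta> r) y (?u v) (?u v') = qc_omega r v v'" for r v v'
      by (simp add: d\<eta>[OF y] tV[OF y]) (simp add: om_def)
    ultimately show "\<exists>u :: real^4^'n \<Rightarrow> 'n model. linear u \<and> bij_betw u UNIV (D y) \<and>
           (\<forall>r v v'. ext_deriv \<A> (\<eta> r) y (u v) (u v') = qc_omega r v v')" by blast
  qed
  have "\<exists>R :: 3 \<Rightarrow> 'n model. \<forall>r t. \<eta> t y (R r) = (if t = r then 1 else 0) \<and>
       (\<forall>X\<in>D y. ext_deriv \<A> (\<eta> r) y (R t) X + ext_deriv \<A> (\<eta> t) y (R r) X = 0)" if y: "y \<in> U" for y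
  proof -
    let ?\<tau> = "coframe_torsion \<A> s y"
    have b\<tau>: "bilinear ?\<tau>" by (rule bilinear_coframe_torsion[OF sf U(1) y])
    obtain a where a: "\<And>X. a X \<in> lie_algebra B_group" "\<And>X Y. ?\<tau> X Y = Theta0 X Y + (a X Y - a Y X)"
      using tor[OF y] by blast
    have tW: "snd (?\<tau> (0, w) (v, 0)) = - snd (a (v, 0) (0, w))" for w v
      by (simp add: a(2) lie_algebra_B_D(1)[OF a(1)] Theta0_def bilinear_lzero[OF bilinear_om] flip: om_def)
    define \<mu> where "\<mu> v = 2 * (snd (?\<tau> (0, q_i) (v, 0)) \<bullet> q_i)" for v
    have lin\<mu>: "linear \<mu>"
    proof (rule linearI)
      show "\<mu> (v + v') = \<mu> v + \<mu> v'" for v v'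
        using bilinear_radd[OF b\<tau>, of "(0, q_i)" "(v, 0)" "(v', 0)"] by (simp add: \<mu>_def inner_add_left)
      show "\<mu> (c *\<^sub>R v) = c *\<^sub>R \<mu> v" for c v
        using bilinear_rmul[OF b\<tau>, of "(0, q_i)" c "(v, 0)"] by (simp add: \<mu>_def)
    qed
    \<comment> \<open>The metric dual of \<open>\<mu> / 2\<close>; by \<open>rim_conformal\<close>,
      moving the Reeb vectors along EH by \<open>z\<close> subtracts
      \<open>2 * (z \<bullet> v) * (w \<bullet> w')\<close>, which is the whole symmetric
      part.\<close>
    define z where "z = (1/2) *\<^sub>R (\<Sum>b\<in>Basis. \<mu> b *\<^sub>R b)"
    have z: "2 * (z \<bullet> v) = \<mu> v" for v
    proof -
      have "\<mu> v = (\<Sum>b\<in>Basis. (v \<bullet> b) *\<^sub>R \<mu> b)" by (rule linear_euclidean[OF lin\<mu>])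
      also have "\<dots> = 2 * (z \<bullet> v)"
        unfolding z_def inner_scaleR_left inner_sum_left by (simp add: inner_commute[of _ v] mult.commute)
      finally show ?thesis by simp
    qed
    have sym: "snd (?\<tau> (0, w) (v, 0)) \<bullet> w' + snd (?\<tau> (0, w') (v, 0)) \<bullet> w = \<mu> v * (w \<bullet> w')" for v w w'
      using lie_algebra_B_D(2)[OF a(1), of "(v, 0)" w w'] by (simp add: tW \<mu>_def)
    define R where "R r = s y (rim (axis r 1) z, axis r 1)" for r :: 3
    have "\<eta> t y (R r) = (if t = r then 1 else 0)" for r t
      by (simp add: R_def \<eta>s[OF y]) (simp add: axis_def)
    moreover have "ext_deriv \<A> (\<eta> r) y (R t) X + ext_deriv \<A> (\<eta> t) y (R r) X = 0" if "X \<in> D y" for r t X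
    proof -
      obtain v where X: "X = s y (v, 0)" using \<open>X \<in> D y\<close> Dy[OF y] by auto
      have d: "ext_deriv \<A> (\<eta> r) y (R t) X = om (rim (axis t 1) z) v \<bullet> axis r 1 + snd (?\<tau> (0, axis t 1) (v, 0)) \<bullet> axis r 1" for r t
      proof -
        have e: "(rim (axis t 1) z, axis t 1) = (rim (axis t 1) z, 0) + (0, axis t (1::real))" by simp
        show ?thesis
          unfolding R_def X d\<eta>[OF y] e by (simp only: bilinear_ladd[OF b\<tau>] snd_add tV[OF y]) (simp add: inner_axis)
      qed
      show ?thesis
        using rim_conformal[of "axis t 1" z v "axis r 1"] sym[of "axis t 1" v "axis r 1"] z[of v]
        unfolding d by (simp add: algebra_simps)
    qed
    ultimately show ?thesis by (intro exI[of _ R]) blast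
  qed
  with U qc show "\<exists>U \<eta>. open U \<and> x \<in> U \<and> qc_forms \<A> D U \<eta> \<and>
        (\<forall>y\<in>U. \<exists>R :: 3 \<Rightarrow> 'n model. \<forall>r s.
           \<eta> s y (R r) = (if s = r then 1 else 0) \<and>
           (\<forall>X\<in>D y. ext_deriv \<A> (\<eta> r) y (R s) X + ext_deriv \<A> (\<eta> s) y (R r) X = 0))"
    by blast
qed

end

theorem corollary37:
  fixes \<A> :: "('m::{t2_space, second_countable_topology}, 'n::finite model) chart set"
    and D :: "'m \<Rightarrow> 'n model set"
  assumes "smooth_atlas \<A>"
    and "qc_structure \<A> D"
  shows "duchemin_integrable \<A> D \<longleftrightarrow>
    (\<exists>P. integrable_qc_K_structure \<A> P \<and> (\<forall>x. P x \<subseteq> Q_structure_of D x))"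
proof -
  interpret qc_manifold \<A> by (intro qc_manifold.intro smooth_manifold.intro assms(1))
  show ?thesis using duchemin_imp_K_structure K_structure_imp_duchemin by blast
qed

end
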